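(* Let $\mathcal{N}\subseteq\mathcal{M}$ be a finite inclusion of finite von Neumann algebras such that $\mathcal{M}$ is a $\lambda$-extension of $\mathcal{N}$ (with the standing assumptions on the next step of the tower given in the context). Let $\Phi:\mathcal{M}\to\mathcal{M}$ be a normal completely positive $\mathcal{N}$-$\mathcal{N}$-bimodule map. Let $B=\bigvee_{k=0}^\infty\mathcal{R}\big(\widehat{\Phi}^{( *k)}\big)$. Consider the statements: (i) $B=\mathbf{1}$; (ii) $\Phi$ is relatively irreducible; (iii) for any projection $p\in\mathcal{M}$, $\mathcal{R}\big((\Phi+\mathrm{id})^{d-1}(p)\big)\in\mathcal{N}$, where $d=\dim_{\mathbb{C}}(\mathcal{M}'\cap\mathcal{M}_2)$. Then (i) $\Rightarrow$ (ii) $\Leftrightarrow$ (iii).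
   Context: Standing assumptions: $\tau$ is a fixed normal faithful tracial state on $\mathcal{M}$, $e_1$ the projection of $L^2(\mathcal{M},\tau)$ onto $L^2(\mathcal{N},\tau)$, and $\mathcal{M}_1=\langle\mathcal{M},e_1\rangle$ the basic construction. The inclusion is finite (finite-index) if $\mathcal{M}_1$ is a finite von Neumann algebra. $\mathcal{M}$ is a $\lambda$-extension of $\mathcal{N}$ ($\lambda>0$): there is a normal faithful tracial state $\tau_1$ on $\mathcal{M}_1$ with $\tau_1|_{\mathcal{M}}=\tau$ and $E_{\mathcal{M}}(e_1)=\lambda\mathbf{1}$, where $E_{\mathcal{M}}$ is the $\tau_1$-preserving conditional expectation onto $\mathcal{M}$. In this case there is a finite Pimsner-Popa basis $\{\eta_j\}_{j=1}^m\subset\mathcal{M}$, i.e. $x=\sum_jE_{\mathcal{N}}(x\eta_j^* )\eta_j$ for all $x\in\mathcal{M}$, where $E_{\mathcal{N}}$ is the $\tau$-preserving conditional expectation onto $\mathcal{N}$. Similarly the next basic construction $\mathcal{M}_2=\langle\mathcal{M}_1,e_2\rangle$ of $\mathcal{M}\subseteq\mathcal{M}_1$ (acting on $L^2(\mathcal{M}_1,\tau_1)$, with $e_2$ the projection onto $L^2(\mathcal{M},\tau)$) is assumed to carry a normal faithful tracial state extending $\tau_1$ with $E_{\mathcal{M}_1}(e_2)=\lambda\mathbf{1}$, where $E_{\mathcal{M}_1}$ is the corresponding trace-preserving conditional expectation onto $\mathcal{M}_1$. $\mathcal{N}$-$\mathcal{N}$-bimodule map: $\Phi(y_1xy_2)=y_1\Phi(x)y_2$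 for $x\in\mathcal{M}$, $y_1,y_2\in\mathcal{N}$. Relatively irreducible: whenever $p\in\mathcal{M}$ is a projection with $\Phi(p)\le c\,p$ for some $c>0$, then $p\in\mathcal{N}$. $\mathcal{R}(\cdot)$ denotes the range projection. Fourier multiplier: for a bounded bimodule map $\Psi$, $\widehat{\Psi}\in\mathcal{M}'\cap\mathcal{M}_2$ is determined by $\widehat{\Psi}\,xe_1y\,\Omega_1=\lambda^{-1/2}\sum_{j=1}^m x\eta_j^*e_1\Psi(\eta_j)y\,\Omega_1$ for $x,y\in\mathcal{M}$, with $\Omega_1$ the trace vector of $L^2(\mathcal{M}_1,\tau_1)$. $\widehat{\Phi}^{( *k)}$ is the $k$-fold convolution power of $\widehat{\Phi}$, where convolution on $\mathcal{M}'\cap\mathcal{M}_2$ is the operation corresponding to composition of bimodule maps; thus $\widehat{\Phi}^{( *k)}=\widehat{\Phi^k}$, and for $k=0$ it is $\widehat{\mathrm{id}}=\lambda^{-3/2}e_2$.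
   Formalization: The equivalence of (ii) and (iii) is stated only when d, the dimension of M'∩M_2, is finite; otherwise the exponent d-1 in (iii) is undefined (e.g. N=M=L^∞[0,1], λ=1). The implication (i)⇒(ii) is stated without this restriction. *)

theory Defs
  imports "HOL-Analysis.Analysis"
begin

section \<open>Complex Hilbert spaces\<close>

class complex_vector = real_vector +
  fixes scaleC :: "complex \<Rightarrow> 'a \<Rightarrow> 'a"  (infixr \<open>*\<^sub>C\<close> 75)
  assumes scaleC_add_right: "a *\<^sub>C (x + y) = a *\<^sub>C x + a *\<^sub>C y"
    and scaleC_add_left: "(a + b) *\<^sub>C x = a *\<^sub>C x + b *\<^sub>C x"
    and scaleC_scaleC: "a *\<^sub>C b *\<^sub>C x = (a * b) *\<^sub>C x"
    and scaleC_one: "1 *\<^sub>C x = x"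
    and scaleR_scaleC: "r *\<^sub>R x = complex_of_real r *\<^sub>C x"

global_interpretation complex_vector: vector_space "scaleC :: complex \<Rightarrow> 'a \<Rightarrow> 'a::complex_vector"
  defines cspan_raw_def: cspan = complex_vector.span
    and cdim_raw_def: cdim = complex_vector.dim
  by unfold_locales (simp_all add: scaleC_add_right scaleC_add_left scaleC_scaleC scaleC_one)

text \<open>The inner product is linear in its first argument. Its real part is the real inner product
  of the library, so that norm and topology are the library's ones.\<close>

class chilbert_space = complex_vector + real_inner + complete_space +
  fixes cinner :: "'a \<Rightarrow> 'a \<Rightarrow> complex"
  assumes cinner_commute: "cinner x y = cnj (cinner y x)"
    and cinner_add_left: "cinner (x + y) z = cinner x z + cinner y z"
    and cinner_scaleC_left: "cinner (c *\<^sub>C x) y = c * cinner x y"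
    and inner_cinner: "inner x y = Re (cinner x y)"

instantiation complex :: chilbert_space
begin

definition scaleC_complex :: "complex \<Rightarrow> complex \<Rightarrow> complex" where "scaleC_complex c x = c * x"
definition cinner_complex :: "complex \<Rightarrow> complex \<Rightarrow> complex" where "cinner_complex x y = x * cnj y"

instance
  by standard
    (simp_all add: scaleC_complex_def cinner_complex_def algebra_simps inner_complex_def
      scaleR_conv_of_real)

end

lemma chilbert_norm_eq: "norm x = sqrt (Re (cinner x x))" for x :: "'a::chilbert_space"
  by (simp add: norm_eq_sqrt_inner inner_cinner)

lemma norm_scaleC: "norm (c *\<^sub>C x) = cmod c * norm x" for x :: "'a::chilbert_space"
proof -
  have "cinner (c *\<^sub>C x) (c *\<^sub>C x) = c * cnj (c * cinner x x)"
    by (metis cinner_commute cinner_scaleC_left)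
  also have "\<dots> = (c * cnj c) * cinner x x"
    by (simp add: mult.assoc cinner_commute[of x x, symmetric])
  finally have "Re (cinner (c *\<^sub>C x) (c *\<^sub>C x)) = (cmod c)\<^sup>2 * Re (cinner x x)"
    by (simp add: complex_norm_square[symmetric] del: of_real_power)
  then show ?thesis
    by (simp add: chilbert_norm_eq[where x = x] chilbert_norm_eq[where x = "c *\<^sub>C x"] real_sqrt_mult)
qed

lemma bounded_linear_scaleC: "bounded_linear (\<lambda>x::'a::chilbert_space. c *\<^sub>C x)"
  by (rule bounded_linear_intro[where K = "cmod c"])
    (simp_all add: scaleC_add_right scaleR_scaleC scaleC_scaleC norm_scaleC mult.commute)

instantiation blinfun :: (real_normed_vector, chilbert_space) complex_vector
begin

lift_definition scaleC_blinfun :: "complex \<Rightarrow> ('a \<Rightarrow>\<^sub>L 'b) \<Rightarrow> 'a \<Rightarrow>\<^sub>L 'b"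
  is "\<lambda>c T x. c *\<^sub>C T x"
  by (rule bounded_linear_compose[OF bounded_linear_scaleC])

instance
  by standard
    (transfer, simp add: fun_eq_iff scaleC_add_right scaleC_add_left scaleC_scaleC scaleC_one
      scaleR_scaleC)+

end

section \<open>Operators on a complex Hilbert space\<close>

text \<open>The type \<open>'h \<Rightarrow>\<^sub>L 'h\<close> consists of the bounded real-linear operators; \<open>B(H)\<close> is the following
  subset of it.\<close>

definition bop :: "('h::chilbert_space \<Rightarrow>\<^sub>L 'h) set" where
  "bop = {T :: 'h \<Rightarrow>\<^sub>L 'h. \<forall>c x. T (c *\<^sub>C x) = c *\<^sub>C T x}"

definition adj :: "('h::chilbert_space \<Rightarrow>\<^sub>L 'h) \<Rightarrow> 'h \<Rightarrow>\<^sub>L 'h" where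
  "adj T = (THE S. S \<in> bop \<and> (\<forall>x y. cinner (T x) y = cinner x (S y)))"

definition positive_op :: "('h::chilbert_space \<Rightarrow>\<^sub>L 'h) \<Rightarrow> bool" where
  "positive_op T \<longleftrightarrow> T \<in> bop \<and> (\<forall>x. cinner (T x) x \<in> \<real>\<^sub>\<ge>\<^sub>0)"

definition op_le :: "('h::chilbert_space \<Rightarrow>\<^sub>L 'h) \<Rightarrow> ('h \<Rightarrow>\<^sub>L 'h) \<Rightarrow> bool" where
  "op_le S T \<longleftrightarrow> positive_op (T - S)"

definition is_projection :: "('h::chilbert_space \<Rightarrow>\<^sub>L 'h) \<Rightarrow> bool" where
  "is_projection P \<longleftrightarrow> P \<in> bop \<and> P o\<^sub>L P = P \<and> adj P = P"

text \<open>Only meaningful for closed complex subspaces.\<close>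

definition projection_onto :: "'h::chilbert_space set \<Rightarrow> 'h \<Rightarrow>\<^sub>L 'h" where
  "projection_onto S = (THE P. is_projection P \<and> range (blinfun_apply P) = S)"

definition range_projection :: "('h::chilbert_space \<Rightarrow>\<^sub>L 'h) \<Rightarrow> 'h \<Rightarrow>\<^sub>L 'h" where
  "range_projection T = projection_onto (closure (range (blinfun_apply T)))"

definition projection_join :: "('h::chilbert_space \<Rightarrow>\<^sub>L 'h) set \<Rightarrow> 'h \<Rightarrow>\<^sub>L 'h" where
  "projection_join F = projection_onto (closure (cspan (\<Union>P\<in>F. range (blinfun_apply P))))"

section \<open>Von Neumann algebras and maps between them\<close>

definition commutant :: "('h::chilbert_space \<Rightarrow>\<^sub>L 'h) set \<Rightarrow> ('h \<Rightarrow>\<^sub>L 'h) set" where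
  "commutant S = {T \<in> bop. \<forall>A\<in>S. T o\<^sub>L A = A o\<^sub>L T}"

definition von_neumann_algebra :: "('h::chilbert_space \<Rightarrow>\<^sub>L 'h) set \<Rightarrow> bool" where
  "von_neumann_algebra A \<longleftrightarrow>
     A \<subseteq> bop \<and> adj ` A \<subseteq> A \<and> commutant (commutant A) = A"

definition finite_von_neumann_algebra :: "('h::chilbert_space \<Rightarrow>\<^sub>L 'h) set \<Rightarrow> bool" where
  "finite_von_neumann_algebra A \<longleftrightarrow> von_neumann_algebra A \<and>
     (\<forall>u\<in>A. adj u o\<^sub>L u = id_blinfun \<longrightarrow> u o\<^sub>L adj u = id_blinfun)"

definition vna_generated :: "('h::chilbert_space \<Rightarrow>\<^sub>L 'h) set \<Rightarrow> ('h \<Rightarrow>\<^sub>L 'h) set" where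
  "vna_generated S = commutant (commutant (S \<union> adj ` S))"

definition clinear_map_on :: "'a::complex_vector set \<Rightarrow> ('a \<Rightarrow> 'b::complex_vector) \<Rightarrow> bool" where
  "clinear_map_on A f \<longleftrightarrow>
     (\<forall>x\<in>A. \<forall>y\<in>A. f (x + y) = f x + f y) \<and> (\<forall>c. \<forall>x\<in>A. f (c *\<^sub>C x) = c *\<^sub>C f x)"

definition op_directed :: "('h::chilbert_space \<Rightarrow>\<^sub>L 'h) set \<Rightarrow> bool" where
  "op_directed D \<longleftrightarrow> D \<noteq> {} \<and> (\<forall>a\<in>D. \<forall>b\<in>D. \<exists>c\<in>D. op_le a c \<and> op_le b c)"

definition op_lub_in ::
  "('h::chilbert_space \<Rightarrow>\<^sub>L 'h) set \<Rightarrow> ('h \<Rightarrow>\<^sub>L 'h) set \<Rightarrow> ('h \<Rightarrow>\<^sub>L 'h) \<Rightarrow> bool" where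
  "op_lub_in A D s \<longleftrightarrow> s \<in> A \<and> (\<forall>a\<in>D. op_le a s) \<and>
     (\<forall>b\<in>A. (\<forall>a\<in>D. op_le a b) \<longrightarrow> op_le s b)"

text \<open>Normality of positive maps and of positive functionals: suprema of bounded increasing nets of
  positive elements are preserved.\<close>

definition normal_map ::
  "('h::chilbert_space \<Rightarrow>\<^sub>L 'h) set \<Rightarrow> (('h \<Rightarrow>\<^sub>L 'h) \<Rightarrow> ('h \<Rightarrow>\<^sub>L 'h)) \<Rightarrow> bool" where
  "normal_map A \<Phi> \<longleftrightarrow>
     (\<forall>D s. D \<subseteq> {a\<in>A. positive_op a} \<and> op_directed D \<and> op_lub_in A D s
        \<longrightarrow> op_lub_in A (\<Phi> ` D) (\<Phi> s))"

definition normal_functional ::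
  "('h::chilbert_space \<Rightarrow>\<^sub>L 'h) set \<Rightarrow> (('h \<Rightarrow>\<^sub>L 'h) \<Rightarrow> complex) \<Rightarrow> bool" where
  "normal_functional A \<phi> \<longleftrightarrow>
     (\<forall>D s. D \<subseteq> {a\<in>A. positive_op a} \<and> op_directed D \<and> op_lub_in A D s
        \<longrightarrow> Re (\<phi> s) = (SUP a\<in>D. Re (\<phi> a)))"

definition faithful_normal_tracial_state ::
  "('h::chilbert_space \<Rightarrow>\<^sub>L 'h) set \<Rightarrow> (('h \<Rightarrow>\<^sub>L 'h) \<Rightarrow> complex) \<Rightarrow> bool" where
  "faithful_normal_tracial_state A \<tau> \<longleftrightarrow>
     clinear_map_on A \<tau> \<and>
     (\<forall>x\<in>A. \<tau> (adj x o\<^sub>L x) \<in> \<real>\<^sub>\<ge>\<^sub>0) \<and>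
     \<tau> id_blinfun = 1 \<and>
     (\<forall>x\<in>A. \<forall>y\<in>A. \<tau> (x o\<^sub>L y) = \<tau> (y o\<^sub>L x)) \<and>
     (\<forall>x\<in>A. \<tau> (adj x o\<^sub>L x) = 0 \<longrightarrow> x = 0) \<and>
     normal_functional A \<tau>"

definition conditional_expectation ::
  "('h::chilbert_space \<Rightarrow>\<^sub>L 'h) set \<Rightarrow> ('h \<Rightarrow>\<^sub>L 'h) set \<Rightarrow> (('h \<Rightarrow>\<^sub>L 'h) \<Rightarrow> complex)
     \<Rightarrow> (('h \<Rightarrow>\<^sub>L 'h) \<Rightarrow> ('h \<Rightarrow>\<^sub>L 'h)) \<Rightarrow> bool" where
  "conditional_expectation N M \<tau> E \<longleftrightarrow>
     E ` M \<subseteq> N \<and> clinear_map_on M E \<and>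
     (\<forall>x\<in>M. positive_op x \<longrightarrow> positive_op (E x)) \<and>
     (\<forall>y\<in>N. E y = y) \<and>
     (\<forall>x\<in>M. \<forall>y\<^sub>1\<in>N. \<forall>y\<^sub>2\<in>N. E (y\<^sub>1 o\<^sub>L x o\<^sub>L y\<^sub>2) = y\<^sub>1 o\<^sub>L E x o\<^sub>L y\<^sub>2) \<and>
     (\<forall>x\<in>M. \<tau> (E x) = \<tau> x)"

definition bimodule_map ::
  "('h::chilbert_space \<Rightarrow>\<^sub>L 'h) set \<Rightarrow> ('h \<Rightarrow>\<^sub>L 'h) set
     \<Rightarrow> (('h \<Rightarrow>\<^sub>L 'h) \<Rightarrow> ('h \<Rightarrow>\<^sub>L 'h)) \<Rightarrow> bool" where
  "bimodule_map N M \<Phi> \<longleftrightarrow>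
     \<Phi> ` M \<subseteq> M \<and> clinear_map_on M \<Phi> \<and>
     (\<forall>x\<in>M. \<forall>y\<^sub>1\<in>N. \<forall>y\<^sub>2\<in>N. \<Phi> (y\<^sub>1 o\<^sub>L x o\<^sub>L y\<^sub>2) = y\<^sub>1 o\<^sub>L \<Phi> x o\<^sub>L y\<^sub>2)"

definition bounded_map_on :: "'a::real_normed_vector set \<Rightarrow> ('a \<Rightarrow> 'b::real_normed_vector) \<Rightarrow> bool"
  where "bounded_map_on A f \<longleftrightarrow> (\<exists>C. \<forall>x\<in>A. norm (f x) \<le> C * norm x)"

text \<open>An \<open>n \<times> n\<close> matrix of operators on \<open>H\<close> is regarded as an operator on \<open>H\<^sup>n\<close>.\<close>

definition positive_op_matrix :: "nat \<Rightarrow> (nat \<Rightarrow> nat \<Rightarrow> 'h::chilbert_space \<Rightarrow>\<^sub>L 'h) \<Rightarrow> bool" where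
  "positive_op_matrix n a \<longleftrightarrow>
     (\<forall>\<xi> :: nat \<Rightarrow> 'h. (\<Sum>i<n. \<Sum>j<n. cinner (a i j (\<xi> j)) (\<xi> i)) \<in> \<real>\<^sub>\<ge>\<^sub>0)"

definition completely_positive ::
  "('h::chilbert_space \<Rightarrow>\<^sub>L 'h) set \<Rightarrow> (('h \<Rightarrow>\<^sub>L 'h) \<Rightarrow> ('h \<Rightarrow>\<^sub>L 'h)) \<Rightarrow> bool" where
  "completely_positive A \<Phi> \<longleftrightarrow>
     (\<forall>n a. (\<forall>i<n. \<forall>j<n. a i j \<in> A) \<and> positive_op_matrix n a
        \<longrightarrow> positive_op_matrix n (\<lambda>i j. \<Phi> (a i j)))"

definition relatively_irreducible ::
  "('h::chilbert_space \<Rightarrow>\<^sub>L 'h) set \<Rightarrow> ('h \<Rightarrow>\<^sub>L 'h) set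
     \<Rightarrow> (('h \<Rightarrow>\<^sub>L 'h) \<Rightarrow> ('h \<Rightarrow>\<^sub>L 'h)) \<Rightarrow> bool" where
  "relatively_irreducible N M \<Phi> \<longleftrightarrow>
     (\<forall>p\<in>M. is_projection p \<and> (\<exists>c>0. op_le (\<Phi> p) (c *\<^sub>R p)) \<longrightarrow> p \<in> N)"

section \<open>The basic construction\<close>

text \<open>\<open>gns_representation M \<tau> \<pi> \<Omega>\<close>: the Hilbert space \<open>'g\<close> is \<open>L\<^sup>2(M,\<tau>)\<close>, with trace vector \<open>\<Omega>\<close>
  and with \<open>M\<close> acting by left multiplication \<open>\<pi>\<close>. These data are determined by \<open>(M,\<tau>)\<close> up to
  unitary equivalence.\<close>

definition gns_representation ::
  "('h::chilbert_space \<Rightarrow>\<^sub>L 'h) set \<Rightarrow> (('h \<Rightarrow>\<^sub>L 'h) \<Rightarrow> complex)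
     \<Rightarrow> (('h \<Rightarrow>\<^sub>L 'h) \<Rightarrow> ('g::chilbert_space \<Rightarrow>\<^sub>L 'g)) \<Rightarrow> 'g \<Rightarrow> bool" where
  "gns_representation M \<tau> \<pi> \<Omega> \<longleftrightarrow>
     \<pi> ` M \<subseteq> bop \<and> clinear_map_on M \<pi> \<and>
     (\<forall>x\<in>M. \<forall>y\<in>M. \<pi> (x o\<^sub>L y) = \<pi> x o\<^sub>L \<pi> y) \<and>
     (\<forall>x\<in>M. \<pi> (adj x) = adj (\<pi> x)) \<and>
     \<pi> id_blinfun = id_blinfun \<and>
     closure ((\<lambda>x. \<pi> x \<Omega>) ` M) = UNIV \<and>
     (\<forall>x\<in>M. cinner (\<pi> x \<Omega>) \<Omega> = \<tau> x)"

text \<open>The projection of \<open>L\<^sup>2(M,\<tau>)\<close> onto \<open>L\<^sup>2(N,\<tau>)\<close>.\<close>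

definition jones_projection ::
  "('h::chilbert_space \<Rightarrow>\<^sub>L 'h) set \<Rightarrow> (('h \<Rightarrow>\<^sub>L 'h) \<Rightarrow> ('g::chilbert_space \<Rightarrow>\<^sub>L 'g)) \<Rightarrow> 'g
     \<Rightarrow> 'g \<Rightarrow>\<^sub>L 'g" where
  "jones_projection N \<pi> \<Omega> = projection_onto (closure ((\<lambda>y. \<pi> y \<Omega>) ` N))"

definition basic_construction ::
  "('h::chilbert_space \<Rightarrow>\<^sub>L 'h) set \<Rightarrow> ('h \<Rightarrow>\<^sub>L 'h) set
     \<Rightarrow> (('h \<Rightarrow>\<^sub>L 'h) \<Rightarrow> ('g::chilbert_space \<Rightarrow>\<^sub>L 'g)) \<Rightarrow> 'g \<Rightarrow> ('g \<Rightarrow>\<^sub>L 'g) set" where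
  "basic_construction N M \<pi> \<Omega> = vna_generated (insert (jones_projection N \<pi> \<Omega>) (\<pi> ` M))"

definition lambda_extension ::
  "('h::chilbert_space \<Rightarrow>\<^sub>L 'h) set \<Rightarrow> ('h \<Rightarrow>\<^sub>L 'h) set \<Rightarrow> (('h \<Rightarrow>\<^sub>L 'h) \<Rightarrow> complex)
     \<Rightarrow> (('h \<Rightarrow>\<^sub>L 'h) \<Rightarrow> ('g::chilbert_space \<Rightarrow>\<^sub>L 'g)) \<Rightarrow> 'g \<Rightarrow> real
     \<Rightarrow> (('g \<Rightarrow>\<^sub>L 'g) \<Rightarrow> complex) \<Rightarrow> bool" where
  "lambda_extension N M \<tau> \<pi> \<Omega> lam \<tau>\<^sub>1 \<longleftrightarrow>
     lam > 0 \<and>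
     faithful_normal_tracial_state (basic_construction N M \<pi> \<Omega>) \<tau>\<^sub>1 \<and>
     (\<forall>x\<in>M. \<tau>\<^sub>1 (\<pi> x) = \<tau> x) \<and>
     (\<exists>E. conditional_expectation (\<pi> ` M) (basic_construction N M \<pi> \<Omega>) \<tau>\<^sub>1 E \<and>
        E (jones_projection N \<pi> \<Omega>) = lam *\<^sub>R id_blinfun)"

definition pimsner_popa_basis ::
  "('h::chilbert_space \<Rightarrow>\<^sub>L 'h) set \<Rightarrow> (('h \<Rightarrow>\<^sub>L 'h) \<Rightarrow> ('h \<Rightarrow>\<^sub>L 'h)) \<Rightarrow> nat
     \<Rightarrow> (nat \<Rightarrow> 'h \<Rightarrow>\<^sub>L 'h) \<Rightarrow> bool" where
  "pimsner_popa_basis M E m \<eta> \<longleftrightarrow>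
     \<eta> ` {1..m} \<subseteq> M \<and> (\<forall>x\<in>M. x = (\<Sum>j=1..m. E (x o\<^sub>L adj (\<eta> j)) o\<^sub>L \<eta> j))"

section \<open>Fourier multipliers and convolution\<close>

text \<open>In the following two definitions, \<open>Q\<close> is the relative commutant \<open>M' \<inter> M\<^sub>2\<close>, and
  \<open>v x y\<close> is the vector \<open>x e\<^sub>1 y \<Omega>\<^sub>1\<close> of \<open>L\<^sup>2(M\<^sub>1,\<tau>\<^sub>1)\<close>.\<close>

definition fourier_multiplier ::
  "('h::chilbert_space \<Rightarrow>\<^sub>L 'h) set \<Rightarrow> ('g::chilbert_space \<Rightarrow>\<^sub>L 'g) set
     \<Rightarrow> (('h \<Rightarrow>\<^sub>L 'h) \<Rightarrow> ('h \<Rightarrow>\<^sub>L 'h) \<Rightarrow> 'g) \<Rightarrow> real \<Rightarrow> nat \<Rightarrow> (nat \<Rightarrow> 'h \<Rightarrow>\<^sub>L 'h)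
     \<Rightarrow> (('h \<Rightarrow>\<^sub>L 'h) \<Rightarrow> ('h \<Rightarrow>\<^sub>L 'h)) \<Rightarrow> 'g \<Rightarrow>\<^sub>L 'g" where
  "fourier_multiplier M Q v lam m \<eta> \<Psi> =
     (THE T. T \<in> Q \<and> (\<forall>x\<in>M. \<forall>y\<in>M.
        T (v x y) = (lam powr (- 1 / 2)) *\<^sub>R (\<Sum>j=1..m. v (x o\<^sub>L adj (\<eta> j)) (\<Psi> (\<eta> j) o\<^sub>L y))))"

text \<open>Convolution is composition of bounded bimodule maps, transported along the Fourier multiplier
  map \<open>hat\<close>. The zeroth convolution power is the multiplier of the identity.\<close>

definition convolution ::
  "('h::chilbert_space \<Rightarrow>\<^sub>L 'h) set \<Rightarrow> ('h \<Rightarrow>\<^sub>L 'h) set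
     \<Rightarrow> ((('h \<Rightarrow>\<^sub>L 'h) \<Rightarrow> ('h \<Rightarrow>\<^sub>L 'h)) \<Rightarrow> ('g::chilbert_space \<Rightarrow>\<^sub>L 'g))
     \<Rightarrow> ('g \<Rightarrow>\<^sub>L 'g) \<Rightarrow> ('g \<Rightarrow>\<^sub>L 'g) \<Rightarrow> 'g \<Rightarrow>\<^sub>L 'g" where
  "convolution N M hat S T =
     (THE R. \<exists>\<Psi> \<Theta>. bimodule_map N M \<Psi> \<and> bounded_map_on M \<Psi> \<and>
        bimodule_map N M \<Theta> \<and> bounded_map_on M \<Theta> \<and>
        S = hat \<Psi> \<and> T = hat \<Theta> \<and> R = hat (\<Psi> \<circ> \<Theta>))"

primrec convolution_power ::
  "('h::chilbert_space \<Rightarrow>\<^sub>L 'h) set \<Rightarrow> ('h \<Rightarrow>\<^sub>L 'h) set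
     \<Rightarrow> ((('h \<Rightarrow>\<^sub>L 'h) \<Rightarrow> ('h \<Rightarrow>\<^sub>L 'h)) \<Rightarrow> ('g::chilbert_space \<Rightarrow>\<^sub>L 'g))
     \<Rightarrow> ('g \<Rightarrow>\<^sub>L 'g) \<Rightarrow> nat \<Rightarrow> 'g \<Rightarrow>\<^sub>L 'g" where
  "convolution_power N M hat T 0 = hat id"
| "convolution_power N M hat T (Suc k) = convolution N M hat T (convolution_power N M hat T k)"

definition finite_cdim :: "'a::complex_vector set \<Rightarrow> bool" where
  "finite_cdim V \<longleftrightarrow> (\<exists>b. finite b \<and> V \<subseteq> cspan b)"

end

theory Submission
  imports Defs
begin

text \<open>
  The Fourier multiplier of \<open>\<Psi>\<close> is \<open>x e\<^sub>1 y \<Omega>\<^sub>1 \<mapsto> \<lambda>\<^sup>-\<^sup>1\<^sup>/\<^sup>2 x V y \<Omega>\<^sub>1\<close> for the element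
  \<open>V = \<Sum>\<^sub>j \<eta>\<^sub>j\<^sup>* e\<^sub>1 \<Psi>(\<eta>\<^sub>j)\<close> of \<open>N' \<inter> M\<^sub>1\<close>, which determines \<open>\<Psi>\<close> through \<open>e\<^sub>1 z V = e\<^sub>1 \<Psi>(z)\<close>. It is
  unique because the vectors \<open>x e\<^sub>1 y \<Omega>\<^sub>1\<close> span a dense subspace; this is where normality of the
  trace on \<open>M\<^sub>1\<close> enters.

  If \<open>\<Phi>(p) \<le> c p\<close>, complete positivity gives \<open>(1 - p) \<Phi>\<^sup>k(p x) = 0\<close>, so that \<open>p e\<^sub>1 (1 - p) \<Omega>\<^sub>1\<close> is
  orthogonal to the ranges of all multipliers; if these ranges are total, then \<open>p\<close> commutes with
  \<open>e\<^sub>1\<close>, hence lies in \<open>N\<close>.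

  For the equivalence, the powers of \<open>\<Phi>\<close> embed linearly into
  the \<open>d\<close>-dimensional space \<open>Q\<close>, so \<open>\<Phi>\<^sup>d(p)\<close> is a linear combination of the lower powers, and
  \<open>T = (\<Phi> + id)\<^sup>d\<^sup>-\<^sup>1(p)\<close> satisfies \<open>\<Phi>(T) \<le> C T\<close>. By normality the range projection \<open>q\<close> of \<open>T\<close> then
  satisfies \<open>\<Phi>(q) \<le> c q\<close>. Conversely, if \<open>\<Phi>(p) \<le> c p\<close>, then \<open>p \<le> T \<le> (1 + c)\<^sup>d\<^sup>-\<^sup>1 p\<close>, so \<open>q = p\<close>.
\<close>

section \<open>Complex Hilbert spaces\<close>

text \<open>The delicate point is the totality of the vectors x e1 y \<Omega>1. M1 is a bicommutant
  on L^2(M), but the vectors live in L^2(M1), and the GNS data carry no continuity of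
  \<open>\<pi>1\<close> in a weak topology, so approximating elements of M1 by words in e1 and M
  does not transfer directly. The two spaces are linked instead by bounded intertwiners, built from
  effects that a vector functional dominates; through them an operator that commutes with the
  generators is pulled back to L^2(M), where the bicommutant applies. Sequences suffice for the
  exhaustion because the faithful trace measures its progress.

  The exponent d - 1 comes from counting: the d + 1 multipliers of the powers 0, ..., d are
  dependent, and a relation of lower degree is shifted by a power of \<Phi> until its top power is
  d. The passage from T to its range projection uses the polynomials 1 - (1 - t)^n. They are
  divisible by t, so the Schwarz inequality for \<Phi> makes the image of each of them vanish on the
  kernel of T.\<close>

lemma cinner_add_right: "cinner x (y + z) = cinner x y + cinner x z"
  by (metis cinner_add_left cinner_commute complex_cnj_add)

lemma cinner_scaleC_right: "cinner x (c *\<^sub>C y) = cnj c * cinner x y"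
  by (metis cinner_scaleC_left cinner_commute complex_cnj_mult)

lemma cinner_swap: "cinner x y = cinner u v \<Longrightarrow> cinner y x = cinner v u"
  for x y :: "'a::chilbert_space" and u v :: "'b::chilbert_space"
  by (simp add: cinner_commute[of y x] cinner_commute[of v u])

lemma scaleC_zero_left [simp]: "0 *\<^sub>C x = 0" for x :: "'a::complex_vector"
  by (rule complex_vector.scale_zero_left)

lemma scaleC_zero_right [simp]: "c *\<^sub>C 0 = (0 :: 'a::complex_vector)"
  by (rule complex_vector.scale_zero_right)

lemma cinner_zero_left [simp]: "cinner 0 y = 0"
  by (metis cinner_scaleC_left mult_zero_left scaleC_zero_left)

lemma cinner_zero_right [simp]: "cinner y 0 = 0"
  by (metis cinner_commute cinner_zero_left complex_cnj_zero)

lemma cinner_scaleR_left: "cinner (r *\<^sub>R x) y = of_real r * cinner x y"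
  by (simp add: scaleR_scaleC cinner_scaleC_left)

lemma cinner_scaleR_right: "cinner x (r *\<^sub>R y) = of_real r * cinner x y"
  by (simp add: scaleR_scaleC cinner_scaleC_right)

lemma cinner_minus_left: "cinner (- x) y = - cinner x y"
  using cinner_scaleR_left[of "-1" x y] by simp

lemma cinner_minus_right: "cinner x (- y) = - cinner x y"
  using cinner_scaleR_right[of x "-1" y] by simp

lemma cinner_diff_left: "cinner (x - y) z = cinner x z - cinner y z"
  using cinner_add_left[of x "- y" z] by (simp add: cinner_minus_left)

lemma cinner_diff_right: "cinner z (x - y) = cinner z x - cinner z y"
  using cinner_add_right[of z x "- y"] by (simp add: cinner_minus_right)

lemma cinner_sum_left: "cinner (\<Sum>i\<in>I. f i) y = (\<Sum>i\<in>I. cinner (f i) y)"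
  by (induction I rule: infinite_finite_induct) (simp_all add: cinner_add_left)

lemma cinner_self: "cinner x x = complex_of_real ((norm x)\<^sup>2)"
proof -
  have "Im (cinner x x) = 0"
    using cinner_commute[of x x] by (metis complex_cnj_cancel_iff complex_is_Real_iff Reals_cnj_iff)
  moreover have "Re (cinner x x) = (norm x)\<^sup>2"
    by (simp add: inner_cinner[symmetric] power2_norm_eq_inner)
  ultimately show ?thesis by (simp add: complex_eq_iff)
qed

lemma cinner_self_eq_zero [simp]: "cinner x x = 0 \<longleftrightarrow> x = 0"
  by (simp add: cinner_self)

text \<open>Multiplication by \<open>\<i>\<close> exchanges real and imaginary parts up to sign.
  Through this formula orthogonal decomposition and the Riesz theorem pass from the real to the
  complex inner product.\<close>

lemma cinner_expand: "cinner x y = Complex (inner x y) (- inner (\<i> *\<^sub>C x) y)"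
  by (simp add: complex_eq_iff inner_cinner cinner_scaleC_left)

lemma cinner_ext: "(\<And>y. cinner x y = cinner x' y) \<Longrightarrow> x = x'"
proof -
  assume "\<And>y. cinner x y = cinner x' y"
  then have "cinner (x - x') (x - x') = 0" by (simp add: cinner_diff_left)
  then show ?thesis by simp
qed

lemma norm_cinner_le: "cmod (cinner x y) \<le> norm x * norm y"
proof (cases "cinner x y = 0")
  case False
  \<comment> \<open>A phase that rotates \<open>cinner x y\<close> onto its modulus, so that the
    real Cauchy-Schwarz inequality applies.\<close>
  define c where "c = cnj (cinner x y) / cmod (cinner x y)"
  have c1: "cmod c = 1" using False by (simp add: c_def norm_divide)
  have "cinner (c *\<^sub>C x) y = complex_of_real (cmod (cinner x y))"
    using False by (simp add: c_def cinner_scaleC_left mult.commute[of "cnj (cinner x y)"]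
      complex_norm_square[symmetric] power2_eq_square del: of_real_power)
  then have "cmod (cinner x y) = inner (c *\<^sub>C x) y" by (simp add: inner_cinner)
  also have "\<dots> \<le> norm (c *\<^sub>C x) * norm y" by (rule norm_cauchy_schwarz)
  finally show ?thesis by (simp add: norm_scaleC c1)
qed simp

lemma bounded_bilinear_cinner: "bounded_bilinear (cinner :: 'a::chilbert_space \<Rightarrow> _)"
  by (standard) (auto simp: cinner_add_left cinner_add_right cinner_scaleR_left cinner_scaleR_right
    scaleR_conv_of_real intro!: exI[of _ 1] norm_cinner_le)

lemmas tendsto_cinner = bounded_bilinear.tendsto[OF bounded_bilinear_cinner]
lemmas continuous_on_cinner = bounded_bilinear.continuous_on[OF bounded_bilinear_cinner]

definition csubspace :: "'a::complex_vector set \<Rightarrow> bool" where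
  "csubspace S \<longleftrightarrow> 0 \<in> S \<and> (\<forall>x\<in>S. \<forall>y\<in>S. x + y \<in> S) \<and> (\<forall>c. \<forall>x\<in>S. c *\<^sub>C x \<in> S)"

lemma csubspace_iff: "csubspace S \<longleftrightarrow> complex_vector.subspace S"
  by (auto simp: csubspace_def complex_vector.subspace_def)

lemma csubspaceD:
  assumes "csubspace S"
  shows "0 \<in> S" "x \<in> S \<Longrightarrow> y \<in> S \<Longrightarrow> x + y \<in> S" "x \<in> S \<Longrightarrow> c *\<^sub>C x \<in> S" "x \<in> S \<Longrightarrow> r *\<^sub>R x \<in> S"
    "x \<in> S \<Longrightarrow> - x \<in> S" "x \<in> S \<Longrightarrow> y \<in> S \<Longrightarrow> x - y \<in> S"
proof -
  show 1: "0 \<in> S" "\<And>x y. x \<in> S \<Longrightarrow> y \<in> S \<Longrightarrow> x + y \<in> S" "\<And>c x. x \<in> S \<Longrightarrow> c *\<^sub>C x \<in> S"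
    using assms by (auto simp: csubspace_def)
  show 2: "\<And>x r. x \<in> S \<Longrightarrow> r *\<^sub>R x \<in> S" by (simp add: scaleR_scaleC 1)
  show 3: "\<And>x. x \<in> S \<Longrightarrow> - x \<in> S" using 2[of _ "-1"] by simp
  show "x \<in> S \<Longrightarrow> y \<in> S \<Longrightarrow> x - y \<in> S" using 1(2)[of x "-y"] 3 by simp
qed

lemma csubspace_sum: "csubspace S \<Longrightarrow> (\<And>i. i \<in> I \<Longrightarrow> f i \<in> S) \<Longrightarrow> (\<Sum>i\<in>I. f i) \<in> S"
  by (induction I rule: infinite_finite_induct) (auto simp: csubspaceD)

lemma csubspace_image:
  assumes "csubspace M" "clinear_map_on M f"
  shows "csubspace (f ` M)"
  unfolding csubspace_def
proof (intro conjI ballI allI)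
  have lin: "\<And>x y. x \<in> M \<Longrightarrow> y \<in> M \<Longrightarrow> f (x + y) = f x + f y" "\<And>c x. x \<in> M \<Longrightarrow> f (c *\<^sub>C x) = c *\<^sub>C f x"
    using assms(2) by (auto simp: clinear_map_on_def)
  note M = csubspaceD[OF assms(1)]
  show "0 \<in> f ` M" using lin(2)[OF M(1), of 0] M(1) by (metis image_eqI scaleC_zero_left)
  show "x + y \<in> f ` M" if "x \<in> f ` M" "y \<in> f ` M" for x y
    using that by (auto simp: lin(1)[symmetric] intro!: imageI M(2))
  show "c *\<^sub>C x \<in> f ` M" if "x \<in> f ` M" for c x
    using that by (auto simp: lin(2)[symmetric] intro!: imageI M(3))
qed

lemma csubspace_cspan: "csubspace (cspan X)"
  by (simp add: csubspace_iff)

lemma csubspace_closure: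
  fixes S :: "'a::chilbert_space set"
  assumes "csubspace S" shows "csubspace (closure S)"
  unfolding csubspace_def
proof (intro conjI ballI allI)
  show "0 \<in> closure S" using csubspaceD(1)[OF assms] closure_subset by blast
next
  fix x y assume "x \<in> closure S" "y \<in> closure S"
  then obtain f g where "\<And>n. f n \<in> S" "f \<longlonglongrightarrow> x" "\<And>n. g n \<in> S" "g \<longlonglongrightarrow> y"
    by (meson closure_sequential)
  then show "x + y \<in> closure S" unfolding closure_sequential
    by (intro exI[of _ "\<lambda>n. f n + g n"]) (auto intro: tendsto_add csubspaceD(2)[OF assms])
next
  fix c x assume "x \<in> closure S"
  then obtain f where "\<And>n. f n \<in> S" "f \<longlonglongrightarrow> x" by (meson closure_sequential)
  then show "c *\<^sub>C x \<in> closure S" unfolding closure_sequential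
    by (intro exI[of _ "\<lambda>n. c *\<^sub>C f n"])
      (auto intro: bounded_linear.tendsto[OF bounded_linear_scaleC] csubspaceD(3)[OF assms])
qed

text \<open>A minimizing sequence for the distance is Cauchy by the parallelogram law.\<close>

lemma orthogonal_decomposition_real:
  fixes S :: "'a::{real_inner,complete_space} set"
  assumes "closed S" "subspace S"
  shows "\<exists>s\<in>S. \<forall>t\<in>S. inner (x - s) t = 0"
proof -
  have ne: "S \<noteq> {}" using assms(2) subspace_0 by blast
  define d where "d = infdist x S"
  have dle: "d \<le> norm (x - s)" if "s \<in> S" for s
    using infdist_le[OF that, of x] by (simp add: d_def dist_norm)
  have d0: "0 \<le> d" by (simp add: d_def infdist_nonneg)
  have "\<exists>s\<in>S. norm (x - s) < d + inverse (Suc n)" for n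
  proof -
    have "(INF a\<in>S. dist x a) < d + inverse (Suc n)"
      using ne by (simp add: d_def infdist_def)
    moreover have "bdd_below (dist x ` S)" by (rule bdd_belowI[of _ 0]) auto
    ultimately show ?thesis
      using cINF_less_iff[of S "dist x" "d + inverse (Suc n)"] ne by (auto simp: dist_norm)
  qed
  then obtain f where f: "\<And>n. f n \<in> S" "\<And>n. norm (x - f n) < d + inverse (Suc n)" by metis
  have key: "(norm (u - v))\<^sup>2 \<le> 2 * (norm (x - u))\<^sup>2 + 2 * (norm (x - v))\<^sup>2 - 4 * d\<^sup>2"
    if "u \<in> S" "v \<in> S" for u v
  proof -
    have "(1/2) *\<^sub>R (u + v) \<in> S" using that assms(2) by (simp add: subspace_def)
    then have "d\<^sup>2 \<le> (norm (x - (1/2) *\<^sub>R (u + v)))\<^sup>2" using dle d0 power_mono by blast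
    moreover have "(norm (u - v))\<^sup>2 + 4 * (norm (x - (1/2) *\<^sub>R (u + v)))\<^sup>2
        = 2 * (norm (x - u))\<^sup>2 + 2 * (norm (x - v))\<^sup>2"
      by (simp add: power2_norm_eq_inner inner_diff_left inner_diff_right inner_add_left
        inner_add_right inner_commute algebra_simps)
    ultimately show ?thesis by simp
  qed
  \<comment> \<open>Inserting \<open>sq\<close> for both points into \<open>key\<close> cancels 4
    d^2 and leaves the factor 4 (2 d + 1) = 8 d + 4.\<close>
  have bound: "(norm (f m - f n))\<^sup>2 \<le> (8 * d + 4) * inverse (Suc k)" if "m \<ge> k" "n \<ge> k" for m n k
  proof -
    have sq: "(norm (x - f j))\<^sup>2 \<le> d\<^sup>2 + (2 * d + 1) * inverse (Suc k)" if "j \<ge> k" for j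
    proof -
      let ?e = "inverse (real (Suc k))"
      have "inverse (real (Suc j)) \<le> ?e" using that by (simp add: field_simps)
      then have "norm (x - f j) \<le> d + ?e" using f(2)[of j] by linarith
      then have "(norm (x - f j))\<^sup>2 \<le> (d + ?e)\<^sup>2" by (intro power_mono) auto
      also have "\<dots> = d\<^sup>2 + (2 * d + ?e) * ?e" by (simp add: power2_eq_square algebra_simps)
      also have "\<dots> \<le> d\<^sup>2 + (2 * d + 1) * ?e"
        by (intro add_left_mono mult_right_mono) (auto simp: field_simps)
      finally show ?thesis .
    qed
    show ?thesis using key[OF f(1)[of m] f(1)[of n]] sq[OF that(1)] sq[OF that(2)]
      by (simp add: algebra_simps)
  qed
  have "Cauchy f"
  proof (rule metric_CauchyI)
    fix e :: real assume e: "e > 0"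
    have "(\<lambda>k. (8 * d + 4) * inverse (real (Suc k))) \<longlonglongrightarrow> (8 * d + 4) * 0"
      by (intro tendsto_mult tendsto_const LIMSEQ_inverse_real_of_nat)
    then have "\<forall>\<^sub>F k in sequentially. (8 * d + 4) * inverse (real (Suc k)) < e\<^sup>2"
      using e by (intro order_tendstoD(2)) auto
    then obtain k where k: "(8 * d + 4) * inverse (real (Suc k)) < e\<^sup>2"
      using eventually_sequentially by auto
    show "\<exists>M. \<forall>m\<ge>M. \<forall>n\<ge>M. dist (f m) (f n) < e"
    proof (intro exI allI impI)
      fix m n assume "k \<le> m" "k \<le> n"
      then have "(norm (f m - f n))\<^sup>2 < e\<^sup>2" using bound[of k m n] k by simp
      then show "dist (f m) (f n) < e" using e by (simp add: dist_norm power_less_imp_less_base)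
    qed
  qed
  then obtain s where s: "f \<longlonglongrightarrow> s" using Cauchy_convergent convergent_def by blast
  have sS: "s \<in> S" using closed_sequentially[OF assms(1)] f(1) s by blast
  have "(\<lambda>n. norm (x - f n)) \<longlonglongrightarrow> norm (x - s)" using s by (intro tendsto_intros)
  moreover have "(\<lambda>n. d + inverse (real (Suc n))) \<longlonglongrightarrow> d + 0"
    by (intro tendsto_add tendsto_const LIMSEQ_inverse_real_of_nat)
  ultimately have "norm (x - s) \<le> d + 0"
    by (rule LIMSEQ_le) (use f(2) less_imp_le in blast)
  then have sd: "norm (x - s) = d" using dle[OF sS] by simp
  have "inner (x - s) t = 0" if t: "t \<in> S" for t
  proof (cases "t = 0")
    case False
    \<comment> \<open>The step along t that minimises the distance from x; it would shorten the
      distance unless the inner product vanishes.\<close>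
    define r where "r = inner (x - s) t / inner t t"
    have tt: "inner t t > 0" using False by simp
    have "s + r *\<^sub>R t \<in> S" using sS t assms(2) by (simp add: subspace_def)
    then have "(norm (x - s))\<^sup>2 \<le> (norm (x - (s + r *\<^sub>R t)))\<^sup>2"
      using dle sd by (metis norm_ge_zero power_mono)
    also have "(norm (x - (s + r *\<^sub>R t)))\<^sup>2
        = (norm (x - s))\<^sup>2 - 2 * r * inner (x - s) t + r\<^sup>2 * inner t t"
      unfolding power2_norm_eq_inner
      by (simp add: inner_diff_left inner_diff_right inner_add_left
        inner_add_right inner_commute power2_eq_square algebra_simps)
    also have "\<dots> = (norm (x - s))\<^sup>2 - (inner (x - s) t)\<^sup>2 / inner t t"
      using tt by (simp add: r_def power2_eq_square field_simps)
    finally have "(inner (x - s) t)\<^sup>2 / inner t t \<le> 0" by simp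
    then show ?thesis using tt by (simp add: divide_le_0_iff)
  qed simp
  then show ?thesis using sS by blast
qed

lemma csubspace_imp_subspace: "csubspace S \<Longrightarrow> subspace S"
  by (simp add: subspace_def csubspaceD)

text \<open>S is stable under \<open>\<i>\<close>, so real orthogonality, tested at t and at -i t,
  kills both the real and the imaginary part.\<close>

lemma orthogonal_decomposition:
  fixes S :: "'a::chilbert_space set"
  assumes "closed S" "csubspace S"
  obtains s where "s \<in> S" "\<And>t. t \<in> S \<Longrightarrow> cinner (x - s) t = 0"
proof -
  obtain s where s: "s \<in> S" "\<And>t. t \<in> S \<Longrightarrow> inner (x - s) t = 0"
    using orthogonal_decomposition_real[OF assms(1) csubspace_imp_subspace[OF assms(2)]] by metis
  have "cinner (x - s) t = 0" if t: "t \<in> S" for t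
  proof -
    have "inner (\<i> *\<^sub>C (x - s)) t = inner (x - s) (- \<i> *\<^sub>C t)"
      by (simp add: inner_cinner cinner_scaleC_left cinner_scaleC_right del: complex_vector.scale_minus_left)
    then show ?thesis
      using s(2)[OF t] s(2)[OF csubspaceD(3)[OF assms(2) t, of "- \<i>"]]
      by (simp add: cinner_expand complex_eq_iff)
  qed
  with s(1) show ?thesis using that by blast
qed

section \<open>Riesz representation and adjoints\<close>

lemma riesz_representation:
  fixes f :: "'a::{real_inner,complete_space} \<Rightarrow> real"
  assumes "bounded_linear f"
  obtains y where "\<And>x. f x = inner x y"
proof (cases "\<forall>x. f x = 0")
  case True
  then show ?thesis using that[of 0] by simp
next
  case False
  interpret f: bounded_linear f by fact
  obtain x where x: "f x \<noteq> 0" using False by blast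
  let ?S = "{x. f x = 0}"
  have "closed ?S" by (intro closed_Collect_eq f.continuous_on continuous_on_id continuous_on_const)
  moreover have "subspace ?S" by (simp add: subspace_def f.add f.scaleR f.zero)
  ultimately obtain s where s: "f s = 0" "\<And>t. f t = 0 \<Longrightarrow> inner (x - s) t = 0"
    using orthogonal_decomposition_real[of ?S x] by auto
  let ?z = "x - s"
  have fz: "f ?z \<noteq> 0" using x s(1) by (simp add: f.diff)
  then have zz: "inner ?z ?z \<noteq> 0" by (metis f.zero inner_eq_zero_iff)
  have "f u = inner u ((f ?z / inner ?z ?z) *\<^sub>R ?z)" for u
  proof -
    have "f (u - (f u / f ?z) *\<^sub>R ?z) = 0" using fz by (simp add: f.diff f.scaleR)
    then have "inner ?z (u - (f u / f ?z) *\<^sub>R ?z) = 0" by (rule s(2))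
    then have "inner ?z u = (f u / f ?z) * inner ?z ?z"
      by (simp add: inner_diff_right)
    then have "f u = (f ?z / inner ?z ?z) * inner ?z u" using fz zz by simp
    then show ?thesis by (metis inner_commute inner_scaleR_right)
  qed
  then show ?thesis using that by blast
qed

text \<open>\<open>bop\<close> covers only operators of a space into itself; intertwiners and their
  adjoints go between two spaces.\<close>

definition clinear_op :: "('a::chilbert_space \<Rightarrow>\<^sub>L 'b::chilbert_space) \<Rightarrow> bool" where
  "clinear_op T \<longleftrightarrow> (\<forall>c x. T (c *\<^sub>C x) = c *\<^sub>C T x)"

lemma bop_iff: "T \<in> bop \<longleftrightarrow> clinear_op T"
  by (simp add: bop_def clinear_op_def)

lemma clinear_opD: "clinear_op T \<Longrightarrow> T (c *\<^sub>C x) = c *\<^sub>C T x"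
  by (simp add: clinear_op_def)

lemma bopD: "T \<in> bop \<Longrightarrow> T (c *\<^sub>C x) = c *\<^sub>C T x"
  by (simp add: bop_def)

text \<open>Riesz yields the adjoint for the real inner product; it is the complex adjoint because T
  commutes with multiplication by \<open>\<i>\<close>.\<close>

lemma adjoint_exists:
  fixes T :: "'a::chilbert_space \<Rightarrow>\<^sub>L 'b::chilbert_space"
  assumes T: "clinear_op T"
  obtains S where "clinear_op S" "\<And>x y. cinner (T x) y = cinner x (S y)"
proof -
  have "\<exists>z. \<forall>x. inner (T x) y = inner x z" for y
  proof -
    have "bounded_linear (\<lambda>x. inner (T x) y)"
      by (intro bounded_linear_compose[OF bounded_linear_inner_left] blinfun.bounded_linear_right)
    then show ?thesis using riesz_representation by metis
  qed
  then obtain S where S: "\<And>x y. inner (T x) y = inner x (S y)" by metis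
  have cS: "cinner (T x) y = cinner x (S y)" for x y
    by (simp add: cinner_expand S clinear_opD[OF T, symmetric])
  have S': "cinner (S y) x = cinner y (T x)" for x y
    by (rule cinner_swap) (simp add: cS)
  have add: "S (x + y) = S x + S y" for x y
    by (rule cinner_ext) (simp add: S' cinner_add_left)
  have sc: "S (c *\<^sub>C x) = c *\<^sub>C S x" for c x
    by (rule cinner_ext) (simp add: S' cinner_scaleC_left)
  have "norm (S y) \<le> norm y * norm T" for y
  proof (cases "S y = 0")
    case False
    have "norm (S y) * norm (S y) = inner (S y) (S y)" by (simp add: power2_norm_eq_inner[symmetric] power2_eq_square)
    also have "\<dots> = inner (T (S y)) y" by (simp add: S)
    also have "\<dots> \<le> norm (T (S y)) * norm y" by (rule norm_cauchy_schwarz)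
    also have "\<dots> \<le> (norm T * norm (S y)) * norm y" by (intro mult_right_mono norm_blinfun) simp
    finally show ?thesis using False by (simp add: mult.commute mult.left_commute)
  qed simp
  then have "bounded_linear S"
    by (intro bounded_linear_intro[where K = "norm T"]) (auto simp: add sc scaleR_scaleC)
  then have "blinfun_apply (Blinfun S) = S" by (rule bounded_linear_Blinfun_apply)
  then show ?thesis using that[of "Blinfun S"] by (simp add: clinear_op_def sc cS)
qed

lemma
  assumes "T \<in> bop"
  shows adj_bop: "adj T \<in> bop" and cinner_adj_right: "cinner x (adj T y) = cinner (T x) y"
    and cinner_adj_left: "cinner (adj T x) y = cinner x (T y)"
proof -
  obtain S where S: "S \<in> bop" "\<And>x y. cinner (T x) y = cinner x (S y)"
    using adjoint_exists[of T] assms unfolding bop_iff by blast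
  have "adj T \<in> bop \<and> (\<forall>x y. cinner (T x) y = cinner x (adj T y))"
    unfolding adj_def
  proof (rule theI[where a = S])
    fix S' assume S': "S' \<in> bop \<and> (\<forall>x y. cinner (T x) y = cinner x (S' y))"
    have "cinner (S' y) x = cinner (S y) x" for x y
      by (rule cinner_swap) (metis S' S(2))
    then show "S' = S" by - (rule blinfun_eqI, rule cinner_ext)
  qed (use S in auto)
  then show 1: "adj T \<in> bop" "\<And>x y. cinner x (adj T y) = cinner (T x) y" by simp_all
  show "cinner (adj T x) y = cinner x (T y)" by (rule cinner_swap) (simp add: 1(2))
qed

lemma adj_eqI:
  fixes S T :: "'a::chilbert_space \<Rightarrow>\<^sub>L 'a"
  assumes "T \<in> bop" and "\<And>x y. cinner (T x) y = cinner x (S y)"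
  shows "adj T = S"
proof (rule blinfun_eqI, rule cinner_ext)
  fix x y
  have "cinner (S x) y = cinner x (T y)" by (rule cinner_swap) (simp add: assms(2))
  then show "cinner (adj T x) y = cinner (S x) y" by (simp add: cinner_adj_left[OF assms(1)])
qed

lemma adj_adj: "T \<in> bop \<Longrightarrow> adj (adj T) = T"
  by (intro adj_eqI adj_bop) (simp_all add: cinner_adj_left)

lemma bop_id [simp]: "id_blinfun \<in> bop" and bop_zero [simp]: "0 \<in> bop"
  by (simp_all add: bop_def)

lemma bop_compose: "S \<in> bop \<Longrightarrow> T \<in> bop \<Longrightarrow> S o\<^sub>L T \<in> bop"
  by (simp add: bop_def)

lemma bop_add: "S \<in> bop \<Longrightarrow> T \<in> bop \<Longrightarrow> S + T \<in> bop"
  by (simp add: bop_def blinfun.add_left scaleC_add_right)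

lemma scaleC_blinfun_apply: "blinfun_apply (c *\<^sub>C T) x = c *\<^sub>C T x"
  by transfer simp

lemma scaleC_commute: "a *\<^sub>C b *\<^sub>C x = b *\<^sub>C a *\<^sub>C (x :: 'a::complex_vector)"
  by (simp add: scaleC_scaleC mult.commute)

lemma bop_scaleC: "T \<in> bop \<Longrightarrow> c *\<^sub>C T \<in> bop"
  by (simp add: bop_def scaleC_blinfun_apply scaleC_commute)

lemma csubspace_bop: "csubspace bop"
  by (simp add: csubspace_def bop_add bop_scaleC)

lemmas bop_scaleR = csubspaceD(4)[OF csubspace_bop]
lemmas bop_diff = csubspaceD(6)[OF csubspace_bop]

lemma adj_id [simp]: "adj id_blinfun = id_blinfun"
  by (rule adj_eqI) simp_all

lemma adj_compose: "S \<in> bop \<Longrightarrow> T \<in> bop \<Longrightarrow> adj (S o\<^sub>L T) = adj T o\<^sub>L adj S"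
  by (rule adj_eqI) (simp_all add: bop_compose cinner_adj_right)

lemma adj_add: "S \<in> bop \<Longrightarrow> T \<in> bop \<Longrightarrow> adj (S + T) = adj S + adj T"
  by (rule adj_eqI)
    (simp_all add: bop_add cinner_adj_right blinfun.add_left cinner_add_left cinner_add_right)

lemma adj_scaleC: "T \<in> bop \<Longrightarrow> adj (c *\<^sub>C T) = cnj c *\<^sub>C adj T"
  by (rule adj_eqI)
    (simp_all add: bop_scaleC cinner_adj_right scaleC_blinfun_apply cinner_scaleC_left cinner_scaleC_right)

lemma adj_diff: "S \<in> bop \<Longrightarrow> T \<in> bop \<Longrightarrow> adj (S - T) = adj S - adj T"
  by (rule adj_eqI)
    (simp_all add: bop_diff cinner_adj_right blinfun.diff_left cinner_diff_left cinner_diff_right)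

lemma blinfun_compose_scaleC_left: "(c *\<^sub>C S) o\<^sub>L T = c *\<^sub>C (S o\<^sub>L T)"
  by (intro blinfun_eqI) (simp add: scaleC_blinfun_apply)

section \<open>Projections\<close>

abbreviation ran :: "('a::chilbert_space \<Rightarrow>\<^sub>L 'b::chilbert_space) \<Rightarrow> 'b set" where
  "ran T \<equiv> range (blinfun_apply T)"

lemma is_projection_apply:
  assumes "is_projection P"
  shows "P \<in> bop" "P (P x) = P x" "cinner (P x) y = cinner x (P y)"
proof -
  have P: "P \<in> bop" "P o\<^sub>L P = P" "adj P = P" using assms by (auto simp: is_projection_def)
  then show "P \<in> bop" by simp
  show "P (P x) = P x" using arg_cong[OF P(2), of "\<lambda>T. blinfun_apply T x"] by simp
  show "cinner (P x) y = cinner x (P y)" using cinner_adj_left[OF P(1)] P(3) by simp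
qed

lemma is_projection_range_iff: "x \<in> ran P \<longleftrightarrow> P x = x"
  if P: "is_projection P"
proof
  assume "x \<in> ran P"
  then show "P x = x" using is_projection_apply(2)[OF P] by auto
qed (metis rangeI)

lemma is_projection_unique:
  assumes "is_projection P" "is_projection Q" "ran P = ran Q"
  shows "P = Q"
proof (rule blinfun_eqI, rule cinner_ext)
  fix x y
  have QP: "Q (P z) = P z" for z
    using is_projection_range_iff[OF assms(2), of "P z"] assms(3)[symmetric] by simp
  have PQ: "P (Q z) = Q z" for z
    using is_projection_range_iff[OF assms(1), of "Q z"] assms(3) by simp
  have "cinner (P x) y = cinner (Q (P x)) y" by (simp add: QP)
  also have "\<dots> = cinner x (P (Q y))" by (simp add: assms is_projection_apply)
  also have "\<dots> = cinner (Q x) y" by (simp add: assms is_projection_apply PQ)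
  finally show "cinner (P x) y = cinner (Q x) y" .
qed

lemma projection_exists:
  fixes S :: "'a::chilbert_space set"
  assumes "closed S" "csubspace S"
  obtains P where "is_projection P" "ran P = S"
proof -
  have "\<exists>s. s \<in> S \<and> (\<forall>t\<in>S. cinner (x - s) t = 0)" for x
    using orthogonal_decomposition[OF assms, of x] by metis
  then obtain p where p: "\<And>x. p x \<in> S" "\<And>x t. t \<in> S \<Longrightarrow> cinner (x - p x) t = 0" by metis
  have uniq: "p x = s" if s: "s \<in> S" "\<And>t. t \<in> S \<Longrightarrow> cinner (x - s) t = 0" for x s
  proof -
    have "cinner (p x - s) (p x - s) = cinner (x - s) (p x - s) - cinner (x - p x) (p x - s)"
      by (simp add: cinner_diff_left)
    also have "\<dots> = 0" using s p csubspaceD(6)[OF assms(2)] by simp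
    finally show ?thesis by simp
  qed
  have add: "p (x + y) = p x + p y" for x y
  proof (rule uniq)
    show "p x + p y \<in> S" by (simp add: p csubspaceD[OF assms(2)])
    fix t assume "t \<in> S"
    then show "cinner (x + y - (p x + p y)) t = 0"
      using p(2)[of t x] p(2)[of t y] by (simp add: cinner_diff_left cinner_add_left)
  qed
  have sc: "p (c *\<^sub>C x) = c *\<^sub>C p x" for c x
  proof (rule uniq)
    show "c *\<^sub>C p x \<in> S" by (simp add: p csubspaceD[OF assms(2)])
    fix t assume "t \<in> S"
    then show "cinner (c *\<^sub>C x - c *\<^sub>C p x) t = 0"
      using p(2)[of t x] by (simp add: cinner_diff_left cinner_scaleC_left)
  qed
  have pid: "p s = s" if "s \<in> S" for s using that by (intro uniq) auto
  have sa: "cinner (p x) y = cinner x (p y)" for x y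
  proof -
    have "cinner (p x) (y - p y) = 0" using p by (simp add: cinner_commute[of "p x"])
    moreover have "cinner (x - p x) (p y) = 0" using p by simp
    ultimately show ?thesis by (simp add: cinner_diff_left cinner_diff_right)
  qed
  have nrm: "norm (p x) \<le> norm x * 1" for x
  proof (cases "p x = 0")
    case False
    have "norm (p x) * norm (p x) = inner (p x) (p x)" by (simp add: power2_norm_eq_inner[symmetric] power2_eq_square)
    also have "\<dots> = inner x (p x)" by (simp add: inner_cinner sa p(1) pid)
    also have "\<dots> \<le> norm x * norm (p x)" by (rule norm_cauchy_schwarz)
    finally show ?thesis using False by simp
  qed simp
  have "bounded_linear p"
    by (intro bounded_linear_intro[where K = 1]) (use nrm in \<open>auto simp: add sc scaleR_scaleC\<close>)
  then have P: "blinfun_apply (Blinfun p) = p" by (rule bounded_linear_Blinfun_apply)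
  have Pb: "Blinfun p \<in> bop" by (simp add: bop_def P sc)
  have "is_projection (Blinfun p)"
    unfolding is_projection_def
    by (intro conjI Pb adj_eqI blinfun_eqI) (simp_all add: P p pid sa)
  moreover have "ran (Blinfun p) = S"
    unfolding P
  proof
    show "S \<subseteq> range p" using pid by (metis rangeI subsetI)
  qed (use p(1) in blast)
  ultimately show ?thesis by (rule that)
qed

lemma
  fixes S :: "'a::chilbert_space set"
  assumes "closed S" "csubspace S"
  shows is_projection_projection_onto: "is_projection (projection_onto S)"
    and range_projection_onto: "ran (projection_onto S) = S"
proof -
  obtain P where P: "is_projection P" "ran P = S"
    using projection_exists[OF assms] .
  have "is_projection (projection_onto S) \<and> ran (projection_onto S) = S"
    unfolding projection_onto_def
    by (rule theI[where a = P]) (use P is_projection_unique in auto)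
  then show "is_projection (projection_onto S)" "ran (projection_onto S) = S"
    by auto
qed

lemma csubspace_range:
  assumes T: "clinear_op T"
  shows "csubspace (ran T)"
  unfolding csubspace_def
proof (intro conjI ballI allI)
  show "0 \<in> ran T" by (metis blinfun.zero_right rangeI)
next
  fix x y assume "x \<in> ran T" "y \<in> ran T"
  then obtain u v where "x = T u" "y = T v" by blast
  then have "x + y = T (u + v)" by (simp add: blinfun.add_right)
  then show "x + y \<in> ran T" by blast
next
  fix c x assume "x \<in> ran T"
  then obtain y where "x = T y" by blast
  then have "c *\<^sub>C x = T (c *\<^sub>C y)" by (simp add: clinear_opD[OF T])
  then show "c *\<^sub>C x \<in> ran T" by blast
qed

text \<open>Lets Jones and range projections be computed from orthogonality alone, without opening
  the definite description.\<close>

lemma projection_onto_eqI: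
  fixes S :: "'a::chilbert_space set"
  assumes "closed S" "csubspace S" "s \<in> S" "\<And>t. t \<in> S \<Longrightarrow> cinner (x - s) t = 0"
  shows "projection_onto S x = s"
proof -
  let ?P = "projection_onto S"
  note P = is_projection_projection_onto[OF assms(1,2)] range_projection_onto[OF assms(1,2)]
  have Ps: "?P s = s" using is_projection_range_iff[OF P(1)] P(2) assms(3) by blast
  have "cinner (?P (x - s)) (?P (x - s)) = cinner (x - s) (?P (x - s))"
    by (simp add: is_projection_apply[OF P(1)])
  also have "\<dots> = 0" using P(2) assms(4) by blast
  finally have "?P (x - s) = 0" by simp
  then show ?thesis by (simp add: blinfun.diff_right Ps)
qed

lemma orthogonal_closure:
  assumes "\<And>t. t \<in> S \<Longrightarrow> cinner w t = 0" "t \<in> closure S"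
  shows "cinner w t = 0"
proof -
  have "closed {t. cinner w t = 0}"
    by (intro closed_Collect_eq continuous_on_cinner continuous_on_const continuous_on_id)
  then have "closure S \<subseteq> {t. cinner w t = 0}" using assms(1) by (intro closure_minimal) auto
  then show ?thesis using assms(2) by blast
qed

lemma orthogonal_cspan:
  assumes "\<And>t. t \<in> S \<Longrightarrow> cinner w t = 0" "t \<in> cspan S"
  shows "cinner w t = 0"
  using assms(2) by (induction rule: complex_vector.span_induct_alt)
    (auto simp: cinner_add_right cinner_scaleC_right assms(1))

lemma orthogonal_closure_cspan:
  assumes "\<And>t. t \<in> S \<Longrightarrow> cinner w t = 0" "t \<in> closure (cspan S)"
  shows "cinner w t = 0"
  using orthogonal_closure[OF _ assms(2)] orthogonal_cspan[OF assms(1)] by blast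

section \<open>Operators determined by their values on a subspace\<close>

lemma eq_on_closure_cspan:
  fixes S T :: "'a::chilbert_space \<Rightarrow>\<^sub>L 'b::chilbert_space"
  assumes "clinear_op S" "clinear_op T" "\<And>x. x \<in> X \<Longrightarrow> S x = T x" "x \<in> closure (cspan X)"
  shows "S x = T x"
proof -
  have "S x = T x" if "x \<in> cspan X" for x
    using that by (induction rule: complex_vector.span_induct_alt)
      (auto simp: blinfun.add_right clinear_opD assms(1-3))
  moreover have "closed {x. S x = T x}"
    by (intro closed_Collect_eq blinfun.continuous_on continuous_on_const continuous_on_id)
  ultimately have "closure (cspan X) \<subseteq> {x. S x = T x}" by (intro closure_minimal) auto
  then show ?thesis using assms(4) by blast
qed

text \<open>L is Lipschitz, hence extends continuously to the closure of S; composition with the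
  projection onto that closure extends it by zero. The vanishing on the orthogonal complement is
  recorded because the intertwining relation is checked separately there.\<close>

lemma extend_bounded_clinear:
  fixes S :: "'a::chilbert_space set" and L :: "'a \<Rightarrow> 'b::chilbert_space"
  assumes S: "csubspace S" and L: "clinear_map_on S L" and K: "\<And>x. x \<in> S \<Longrightarrow> norm (L x) \<le> K * norm x"
  obtains W :: "'a \<Rightarrow>\<^sub>L 'b" where "clinear_op W" "\<And>x. x \<in> S \<Longrightarrow> W x = L x"
    "\<And>x. (\<And>s. s \<in> S \<Longrightarrow> cinner x s = 0) \<Longrightarrow> W x = 0"
proof -
  have Ladd: "L (x + y) = L x + L y" if "x \<in> S" "y \<in> S" for x y
    using L that by (simp add: clinear_map_on_def)
  have Lsc: "L (c *\<^sub>C x) = c *\<^sub>C L x" if "x \<in> S" for c x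
    using L that by (simp add: clinear_map_on_def)
  have Ldiff: "L (x - y) = L x - L y" if "x \<in> S" "y \<in> S" for x y
    using Ladd[of "x - y" y] that csubspaceD[OF S] by (simp add: algebra_simps)
  \<comment> \<open>A Lipschitz constant must be nonnegative, and K may be negative when S is
    trivial.\<close>
  define K' where "K' = max K 0"
  have K'0: "0 \<le> K'" by (simp add: K'_def)
  have K': "norm (L x) \<le> K' * norm x" if "x \<in> S" for x
    by (rule order_trans[OF K[OF that] mult_right_mono]) (simp_all add: K'_def)
  have "K'-lipschitz_on S L"
    by (rule lipschitz_onI)
      (simp_all add: dist_norm Ldiff[symmetric] K' csubspaceD(6)[OF S] K'0)
  then have "uniformly_continuous_on S L" by (rule lipschitz_on_uniformly_continuous)
  then obtain g where g: "uniformly_continuous_on (closure S) g" "\<And>x. x \<in> S \<Longrightarrow> L x = g x"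
    using uniformly_continuous_on_extension_on_closure[of S L] by metis
  have gc: "continuous_on (closure S) g" using g(1) by (rule uniformly_continuous_imp_continuous)
  have lim: "(\<lambda>n. L (f n)) \<longlonglongrightarrow> g x" if "\<And>n. f n \<in> S" "f \<longlonglongrightarrow> x" for f x
  proof -
    have "x \<in> closure S" using that closure_sequential by blast
    then have "(\<lambda>n. g (f n)) \<longlonglongrightarrow> g x"
      using continuous_on_tendsto_compose[OF gc that(2)] that(1) closure_subset
      by (metis (no_types, lifting) always_eventually subsetD)
    then show ?thesis using that(1) by (simp add: g(2))
  qed
  have gadd: "g (x + y) = g x + g y" if xy: "x \<in> closure S" "y \<in> closure S" for x y
  proof -
    obtain f h where f: "\<And>n. f n \<in> S" "f \<longlonglongrightarrow> x" and h: "\<And>n. h n \<in> S" "h \<longlonglongrightarrow> y"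
      using xy by (meson closure_sequential)
    have "(\<lambda>n. L (f n + h n)) \<longlonglongrightarrow> g (x + y)"
      using f h by (intro lim csubspaceD[OF S] tendsto_add)
    moreover have "(\<lambda>n. L (f n + h n)) \<longlonglongrightarrow> g x + g y"
      using tendsto_add[OF lim[OF f] lim[OF h]] by (simp add: Ladd f h)
    ultimately show ?thesis by (rule LIMSEQ_unique)
  qed
  have gsc: "g (c *\<^sub>C x) = c *\<^sub>C g x" if xy: "x \<in> closure S" for c x
  proof -
    obtain f where f: "\<And>n. f n \<in> S" "f \<longlonglongrightarrow> x" using xy by (meson closure_sequential)
    have "(\<lambda>n. L (c *\<^sub>C f n)) \<longlonglongrightarrow> g (c *\<^sub>C x)"
      using f by (intro lim csubspaceD[OF S] bounded_linear.tendsto[OF bounded_linear_scaleC])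
    moreover have "(\<lambda>n. L (c *\<^sub>C f n)) \<longlonglongrightarrow> c *\<^sub>C g x"
      using bounded_linear.tendsto[OF bounded_linear_scaleC lim[OF f]] by (simp add: Lsc f)
    ultimately show ?thesis by (rule LIMSEQ_unique)
  qed
  have gnorm: "norm (g x) \<le> K' * norm x" if x: "x \<in> closure S" for x
  proof -
    obtain f where f: "\<And>n. f n \<in> S" "f \<longlonglongrightarrow> x" using x by (meson closure_sequential)
    have "(\<lambda>n. norm (L (f n))) \<longlonglongrightarrow> norm (g x)" by (rule tendsto_norm[OF lim[OF f]])
    moreover have "(\<lambda>n. K' * norm (f n)) \<longlonglongrightarrow> K' * norm x"
      by (rule tendsto_mult_left[OF tendsto_norm[OF f(2)]])
    ultimately show ?thesis by (rule LIMSEQ_le) (use K'[OF f(1)] in blast)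
  qed
  define P where "P = projection_onto (closure S)"
  note cl = closed_closure[of S] csubspace_closure[OF S]
  have P: "is_projection P" "ran P = closure S"
    unfolding P_def using is_projection_projection_onto[OF cl] range_projection_onto[OF cl] by auto
  have Pin: "P x \<in> closure S" for x using P(2) by blast
  have Pb: "P \<in> bop" using is_projection_apply[OF P(1)] by simp
  obtain KP where KP: "\<And>x. norm (P x) \<le> norm x * KP" "KP > 0"
    using bounded_linear.pos_bounded[OF blinfun.bounded_linear_right[of P]] by blast
  have "bounded_linear (\<lambda>x. g (P x))"
  proof (rule bounded_linear_intro[where K = "K' * KP"])
    show "norm (g (P x)) \<le> norm x * (K' * KP)" for x
      using order_trans[OF gnorm[OF Pin] mult_left_mono[OF KP(1)]] K'0 by (simp add: mult_ac)
  qed (auto simp: blinfun.add_right scaleR_scaleC bopD[OF Pb] gadd gsc Pin)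
  then have W: "blinfun_apply (Blinfun (\<lambda>x. g (P x))) = (\<lambda>x. g (P x))"
    by (rule bounded_linear_Blinfun_apply)
  show ?thesis
  proof (rule that[of "Blinfun (\<lambda>x. g (P x))"])
    show "clinear_op (Blinfun (\<lambda>x. g (P x)))"
      by (simp add: clinear_op_def W bopD[OF Pb] gsc Pin)
    fix x assume "x \<in> S"
    then have "P x = x" using P is_projection_range_iff closure_subset by blast
    then show "Blinfun (\<lambda>x. g (P x)) x = L x" using \<open>x \<in> S\<close> by (simp add: W g(2))
  next
    fix x assume x: "\<And>s. s \<in> S \<Longrightarrow> cinner x s = 0"
    have "P x = 0" unfolding P_def
      using orthogonal_closure[OF x] csubspaceD(1)[OF cl(2)] by (intro projection_onto_eqI cl) auto
    moreover have "g 0 = 0" using gsc[of 0 0] csubspaceD(1)[OF cl(2)] by simp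
    ultimately show "Blinfun (\<lambda>x. g (P x)) x = 0" by (simp add: W)
  qed
qed

lemma invariant_closure_cspan:
  fixes T :: "'a::chilbert_space \<Rightarrow>\<^sub>L 'b::chilbert_space"
  assumes "clinear_op T" "closed S" "csubspace S" "\<And>x. x \<in> X \<Longrightarrow> T x \<in> S" "x \<in> closure (cspan X)"
  shows "T x \<in> S"
proof -
  have "T x \<in> S" if "x \<in> cspan X" for x
    using that by (induction rule: complex_vector.span_induct_alt)
      (simp_all add: blinfun.add_right clinear_opD[OF assms(1)] assms(4) csubspaceD(1-3)[OF assms(3)])
  moreover have "closed {x. T x \<in> S}"
    using closed_vimage[OF assms(2), of "blinfun_apply T"]
    by (simp add: vimage_def blinfun.continuous_on)
  ultimately have "closure (cspan X) \<subseteq> {x. T x \<in> S}" by (intro closure_minimal) auto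
  then show ?thesis using assms(5) by blast
qed

lemma closure_cspan_superset: "x \<in> X \<Longrightarrow> x \<in> closure (cspan X)"
  using complex_vector.span_base closure_subset by blast

lemma blinfun_compose_id [simp]: "id_blinfun o\<^sub>L T = T" "T o\<^sub>L id_blinfun = T"
  by (auto intro: blinfun_eqI)

lemma blinfun_compose_assoc: "(R o\<^sub>L S) o\<^sub>L T = R o\<^sub>L (S o\<^sub>L T)"
  by (rule blinfun_eqI) simp

section \<open>Hermitian and positive operators\<close>

definition hermitian_op :: "('a::chilbert_space \<Rightarrow>\<^sub>L 'a) \<Rightarrow> bool" where
  "hermitian_op T \<longleftrightarrow> T \<in> bop \<and> adj T = T"

text \<open>For hermitian operators the form takes real values anyway, so that \<open>op_le\<close>
  becomes a pointwise inequality between real functions.\<close>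

definition quad_form :: "('a::chilbert_space \<Rightarrow>\<^sub>L 'a) \<Rightarrow> 'a \<Rightarrow> real" where
  "quad_form T x = Re (cinner (T x) x)"

lemma quad_form_simps [simp]:
  "quad_form (S + T) x = quad_form S x + quad_form T x"
  "quad_form (S - T) x = quad_form S x - quad_form T x"
  "quad_form (r *\<^sub>R T) x = r * quad_form T x"
  "quad_form 0 x = 0"
  "quad_form id_blinfun x = (norm x)\<^sup>2"
  by (simp_all add: quad_form_def blinfun.add_left blinfun.diff_left blinfun.scaleR_left
    cinner_add_left cinner_diff_left cinner_scaleR_left cinner_self)

lemma hermitian_opD:
  assumes "hermitian_op T"
  shows "T \<in> bop" "adj T = T" "cinner (T x) y = cinner x (T y)"
  using assms cinner_adj_left[of T x y] by (auto simp: hermitian_op_def)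

lemma hermitian_opI: "T \<in> bop \<Longrightarrow> (\<And>x y. cinner (T x) y = cinner x (T y)) \<Longrightarrow> hermitian_op T"
  by (simp add: hermitian_op_def adj_eqI)

lemma adj_scaleR: "T \<in> bop \<Longrightarrow> adj (r *\<^sub>R T) = r *\<^sub>R adj T"
  using adj_scaleC[of T "complex_of_real r"] by (simp add: scaleR_scaleC)

lemma hermitian_op_simps [simp]:
  "hermitian_op 0" "hermitian_op id_blinfun"
  "hermitian_op S \<Longrightarrow> hermitian_op T \<Longrightarrow> hermitian_op (S + T)"
  "hermitian_op S \<Longrightarrow> hermitian_op T \<Longrightarrow> hermitian_op (S - T)"
  "hermitian_op S \<Longrightarrow> hermitian_op (r *\<^sub>R S)"
  by (auto simp: hermitian_op_def adj_add adj_diff adj_scaleR bop_add bop_diff bop_scaleR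
    intro: adj_eqI)

lemma quad_form_Im: "hermitian_op T \<Longrightarrow> Im (cinner (T x) x) = 0"
  using hermitian_opD(3)[of T x x] cinner_commute[of x "T x"] by (simp add: complex_eq_iff)

text \<open>Over complex scalars positivity already forces self-adjointness: polarise the vanishing
  imaginary part at x + y and at x + i y.\<close>

lemma positive_op_iff: "positive_op T \<longleftrightarrow> hermitian_op T \<and> (\<forall>x. 0 \<le> quad_form T x)"
proof
  assume T: "positive_op T"
  then have Tb: "T \<in> bop" and im: "\<And>x. Im (cinner (T x) x) = 0" and re: "\<And>x. 0 \<le> Re (cinner (T x) x)"
    by (auto simp: positive_op_def complex_nonneg_Reals_iff)
  have "cinner (T x) y = cinner x (T y)" for x y
  proof -
    have "Im (cinner (T x) y) = - Im (cinner (T y) x)"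
      using im[of "x + y"] im[of x] im[of y]
      by (simp add: blinfun.add_right cinner_add_left cinner_add_right)
    moreover have "Re (cinner (T x) y) = Re (cinner (T y) x)"
      using im[of "x + \<i> *\<^sub>C y"] im[of x] im[of "\<i> *\<^sub>C y"]
      by (simp add: blinfun.add_right cinner_add_left cinner_add_right bopD[OF Tb]
        cinner_scaleC_left cinner_scaleC_right)
    ultimately have "cinner (T x) y = cnj (cinner (T y) x)" by (simp add: complex_eq_iff)
    also have "\<dots> = cinner x (T y)" by (rule cinner_commute[symmetric])
    finally show ?thesis .
  qed
  then show "hermitian_op T \<and> (\<forall>x. 0 \<le> quad_form T x)"
    using Tb re by (auto simp: quad_form_def intro: hermitian_opI)
next
  assume "hermitian_op T \<and> (\<forall>x. 0 \<le> quad_form T x)"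
  then show "positive_op T"
    by (auto simp: positive_op_def complex_nonneg_Reals_iff quad_form_def quad_form_Im
      dest: hermitian_opD(1))
qed

lemma positive_opD:
  assumes "positive_op T" shows "hermitian_op T" "0 \<le> quad_form T x" "T \<in> bop"
  using assms hermitian_opD(1) by (auto simp: positive_op_iff)

lemma op_le_iff: "op_le S T \<longleftrightarrow> hermitian_op (T - S) \<and> (\<forall>x. quad_form S x \<le> quad_form T x)"
  by (simp add: op_le_def positive_op_iff)

lemma op_leI: "hermitian_op S \<Longrightarrow> hermitian_op T \<Longrightarrow> (\<And>x. quad_form S x \<le> quad_form T x) \<Longrightarrow> op_le S T"
  by (simp add: op_le_iff)

lemma op_leD: "op_le S T \<Longrightarrow> quad_form S x \<le> quad_form T x"
  by (simp add: op_le_iff)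

lemma op_le_hermitian: "op_le S T \<Longrightarrow> hermitian_op S \<Longrightarrow> hermitian_op T"
  using hermitian_op_simps(3)[of "T - S" S] by (simp add: op_le_iff)

lemma op_le_trans: "op_le R S \<Longrightarrow> op_le S T \<Longrightarrow> op_le R T"
  using hermitian_op_simps(3)[of "T - S" "S - R"] order_trans by (fastforce simp: op_le_iff)

lemma op_le_refl [simp]: "op_le T T"
  by (simp add: op_le_iff)

lemma op_le_add: "op_le A B \<Longrightarrow> op_le A' B' \<Longrightarrow> op_le (A + A') (B + B')"
  using hermitian_op_simps(3)[of "B - A" "B' - A'"]
  by (auto simp: op_le_iff add_diff_add[symmetric] intro: add_mono)

lemma positive_op_zero_le: "positive_op T \<longleftrightarrow> op_le 0 T"
  by (simp add: op_le_def)

section \<open>Cauchy-Schwarz for positive operators, and effects\<close>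

lemma discriminant_le:
  fixes a b c :: real
  assumes "\<And>r. 0 \<le> a + 2 * r * b + r\<^sup>2 * c" and c: "0 \<le> c"
  shows "b\<^sup>2 \<le> a * c"
proof (cases "c = 0")
  case True
  have "b = 0"
  proof (rule ccontr)
    assume "b \<noteq> 0"
    \<comment> \<open>For c = 0 this r makes the affine function equal to -1.\<close>
    then show False using assms(1)[of "- (a + 1) / (2 * b)"] True by (simp add: field_simps)
  qed
  then show ?thesis using True by simp
next
  case False
  then have "c > 0" using c by simp
  then have "a + 2 * (- b / c) * b + (- b / c)\<^sup>2 * c = a - b\<^sup>2 / c"
    by (simp add: power2_eq_square field_simps)
  then have "b\<^sup>2 / c \<le> a" using assms(1)[of "- b / c"] by simp
  then show ?thesis using \<open>c > 0\<close> by (simp add: field_simps)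
qed

lemma positive_op_cauchy_schwarz:
  assumes T: "positive_op T"
  shows "(Re (cinner (T x) y))\<^sup>2 \<le> quad_form T x * quad_form T y"
proof (rule discriminant_le)
  note TD = positive_opD[OF T]
  fix r :: real
  have "Re (cinner (T y) x) = Re (cinner (T x) y)"
    using hermitian_opD(3)[OF TD(1), of y x] cinner_commute[of y "T x"] by simp
  then have "quad_form T (x + r *\<^sub>R y) = quad_form T x + 2 * r * Re (cinner (T x) y) + r\<^sup>2 * quad_form T y"
    by (simp add: quad_form_def blinfun.add_right blinfun.scaleR_right cinner_add_left cinner_add_right
      cinner_scaleR_left cinner_scaleR_right power2_eq_square algebra_simps)
  then show "0 \<le> quad_form T x + 2 * r * Re (cinner (T x) y) + r\<^sup>2 * quad_form T y"
    using TD(2) by metis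
qed (rule positive_opD[OF T])

lemma quad_form_le_norm: "quad_form T x \<le> norm T * (norm x)\<^sup>2"
proof -
  have "quad_form T x \<le> cmod (cinner (T x) x)" by (simp add: quad_form_def complex_Re_le_cmod)
  also have "\<dots> \<le> norm (T x) * norm x" by (rule norm_cinner_le)
  also have "\<dots> \<le> (norm T * norm x) * norm x" by (intro mult_right_mono norm_blinfun) simp
  finally show ?thesis by (simp add: power2_eq_square mult.assoc)
qed

text \<open>Cauchy-Schwarz at y = T x bounds the fourth power of the norm of T x by K times its
  square times the form at x; then cancel. This is how convergence of forms becomes strong
  convergence.\<close>

lemma norm_square_le_quad_form:
  assumes T: "positive_op T" and K: "\<And>x. quad_form T x \<le> K * (norm x)\<^sup>2"
  shows "(norm (T x))\<^sup>2 \<le> K * quad_form T x"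
proof (cases "T x = 0")
  case True
  then show ?thesis by (simp add: quad_form_def)
next
  case False
  have "((norm (T x))\<^sup>2)\<^sup>2 \<le> quad_form T x * quad_form T (T x)"
    using positive_op_cauchy_schwarz[OF T, of x "T x"] by (simp add: cinner_self)
  also have "\<dots> \<le> quad_form T x * (K * (norm (T x))\<^sup>2)"
    by (intro mult_left_mono K positive_opD(2)[OF T])
  finally have "(norm (T x))\<^sup>2 * (norm (T x))\<^sup>2 \<le> (K * quad_form T x) * (norm (T x))\<^sup>2"
    by (simp only: power2_eq_square mult_ac)
  then show ?thesis by (rule mult_right_le_imp_le) (use False in simp)
qed

lemma positive_op_quad_form_zero: "positive_op T \<Longrightarrow> quad_form T x = 0 \<Longrightarrow> T x = 0"
  using norm_square_le_quad_form[of T "norm T" x] quad_form_le_norm[of T] by simp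

lemma positive_op_eq_zero: "positive_op T \<Longrightarrow> (\<And>x. quad_form T x = 0) \<Longrightarrow> T = 0"
  by (intro blinfun_eqI) (simp add: positive_op_quad_form_zero)

text \<open>Between 0 and 1 all estimates hold with constant 1, and the difference of two comparable
  effects is again an effect.\<close>

definition effect_op :: "('a::chilbert_space \<Rightarrow>\<^sub>L 'a) \<Rightarrow> bool" where
  "effect_op T \<longleftrightarrow> positive_op T \<and> op_le T id_blinfun"

lemma effect_op_iff: "effect_op T \<longleftrightarrow> hermitian_op T \<and> (\<forall>x. 0 \<le> quad_form T x \<and> quad_form T x \<le> (norm x)\<^sup>2)"
  unfolding effect_op_def positive_op_iff op_le_iff
  using hermitian_op_simps(4)[of id_blinfun T] by auto

lemma effect_opD:
  assumes "effect_op T"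
  shows "positive_op T" "hermitian_op T" "T \<in> bop" "op_le T id_blinfun" "adj T = T"
    "quad_form T x \<le> (norm x)\<^sup>2" "0 \<le> quad_form T x" "(norm (T x))\<^sup>2 \<le> quad_form T x" "norm (T x) \<le> norm x"
proof -
  show 1: "positive_op T" "hermitian_op T" "op_le T id_blinfun" "\<And>x. quad_form T x \<le> (norm x)\<^sup>2"
      "0 \<le> quad_form T x"
    using assms assms[unfolded effect_op_iff] unfolding effect_op_def by blast+
  show "T \<in> bop" "adj T = T" using hermitian_opD[OF 1(2)] by auto
  show 2: "(norm (T x))\<^sup>2 \<le> quad_form T x" using norm_square_le_quad_form[OF 1(1), of 1] 1(4) by simp
  show "norm (T x) \<le> norm x" by (rule power2_le_imp_le[OF order_trans[OF 2 1(4)]]) simp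
qed

lemma effect_op_diff: "effect_op S \<Longrightarrow> effect_op T \<Longrightarrow> op_le S T \<Longrightarrow> effect_op (T - S)"
proof -
  assume *: "effect_op S" "effect_op T" "op_le S T"
  have "0 \<le> quad_form T x - quad_form S x \<and> quad_form T x - quad_form S x \<le> (norm x)\<^sup>2" for x
    using op_leD[OF *(3), of x] effect_opD(7)[OF *(1), of x] effect_opD(6)[OF *(2), of x] by simp
  then show ?thesis using *(3) by (auto simp: effect_op_iff op_le_iff)
qed

lemma effect_op_zero [simp]: "effect_op 0" and effect_op_id [simp]: "effect_op id_blinfun"
  by (simp_all add: effect_op_iff)

lemma effect_op_le: "positive_op S \<Longrightarrow> op_le S T \<Longrightarrow> effect_op T \<Longrightarrow> effect_op S"
  by (auto simp: effect_op_def intro: op_le_trans)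

lemma op_le_square: "effect_op x \<Longrightarrow> op_le (adj x o\<^sub>L x) x"
proof (rule op_leI)
  assume x: "effect_op x"
  show "hermitian_op (adj x o\<^sub>L x)"
    using effect_opD[OF x] by (simp add: hermitian_op_def bop_compose adj_compose)
  show "hermitian_op x" using x by (rule effect_opD)
  show "quad_form (adj x o\<^sub>L x) h \<le> quad_form x h" for h
    using effect_opD(8)[OF x, of h] effect_opD(3)[OF x]
    by (simp add: quad_form_def cinner_adj_left cinner_self)
qed

lemma positive_op_square: "x \<in> bop \<Longrightarrow> positive_op (adj x o\<^sub>L x)"
  by (simp add: positive_op_def bop_compose adj_bop cinner_adj_left cinner_self del: of_real_power)

lemma positive_op_projection: "is_projection p \<Longrightarrow> positive_op p"
  using positive_op_square[of p] by (simp add: is_projection_def)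

section \<open>Increasing sequences\<close>

text \<open>Only a strong limit in \<open>bop\<close> is demanded; that the limit is an effect and
  an upper bound is derived in \<open>increasing_toD\<close>.\<close>

definition increasing_to :: "(nat \<Rightarrow> 'a::chilbert_space \<Rightarrow>\<^sub>L 'a) \<Rightarrow> ('a \<Rightarrow>\<^sub>L 'a) \<Rightarrow> bool" where
  "increasing_to a s \<longleftrightarrow> (\<forall>n. effect_op (a n)) \<and> (\<forall>n. op_le (a n) (a (Suc n))) \<and> s \<in> bop
     \<and> (\<forall>x. (\<lambda>n. a n x) \<longlonglongrightarrow> s x)"

lemma op_le_lift: "(\<And>n. op_le (a n) (a (Suc n))) \<Longrightarrow> m \<le> n \<Longrightarrow> op_le (a m) (a n)"
proof (induction n)
  case (Suc n)
  then show ?case by (cases "m = Suc n") (auto intro: op_le_trans)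
qed simp

lemma quad_form_tendsto:
  fixes a :: "nat \<Rightarrow> 'a::chilbert_space \<Rightarrow>\<^sub>L 'a" and s :: "'a \<Rightarrow>\<^sub>L 'a"
  shows "(\<lambda>n. a n x) \<longlonglongrightarrow> s x \<Longrightarrow> (\<lambda>n. quad_form (a n) x) \<longlonglongrightarrow> quad_form s x"
  unfolding quad_form_def by (intro tendsto_Re tendsto_cinner tendsto_const)

lemma increasing_toD:
  assumes "increasing_to a s"
  shows "effect_op (a n)" "op_le (a n) (a (Suc n))" "m \<le> n \<Longrightarrow> op_le (a m) (a n)" "(\<lambda>n. a n x) \<longlonglongrightarrow> s x"
    "effect_op s" "op_le (a n) s" "(\<lambda>n. quad_form (a n) x) \<longlonglongrightarrow> quad_form s x"
proof -
  show 1: "\<And>n. effect_op (a n)" and 2: "\<And>n. op_le (a n) (a (Suc n))"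
    and 3: "m \<le> n \<Longrightarrow> op_le (a m) (a n)" and 4: "\<And>x. (\<lambda>n. a n x) \<longlonglongrightarrow> s x"
    using assms op_le_lift[of a m n] by (auto simp: increasing_to_def)
  show 5: "\<And>x. (\<lambda>n. quad_form (a n) x) \<longlonglongrightarrow> quad_form s x" by (rule quad_form_tendsto[OF 4])
  have h: "hermitian_op s"
  proof (rule hermitian_opI)
    show "s \<in> bop" using assms by (simp add: increasing_to_def)
    fix x y
    have "(\<lambda>n. cinner (a n x) y) \<longlonglongrightarrow> cinner (s x) y" by (intro tendsto_cinner 4 tendsto_const)
    moreover have "(\<lambda>n. cinner (a n x) y) \<longlonglongrightarrow> cinner x (s y)"
      unfolding hermitian_opD(3)[OF effect_opD(2)[OF 1]] by (intro tendsto_cinner 4 tendsto_const)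
    ultimately show "cinner (s x) y = cinner x (s y)" by (rule LIMSEQ_unique)
  qed
  have inc: "incseq (\<lambda>n. quad_form (a n) x)" for x
    by (rule incseq_SucI) (rule op_leD[OF 2])
  have le: "quad_form (a n) x \<le> quad_form s x" for n x
    by (rule incseq_le[OF inc 5])
  show "op_le (a n) s" by (intro op_leI le h effect_opD(2)[OF 1])
  have "quad_form s x \<le> (norm x)\<^sup>2" for x
    by (rule LIMSEQ_le_const2[OF 5]) (use effect_opD(6)[OF 1] in blast)
  then show "effect_op s"
    using h le effect_opD(7)[OF 1] by (meson effect_op_iff order_trans)
qed

text \<open>Vigier's theorem for sequences: a n - a m is an effect for m \<le> n, so the squared
  norm of its value at x is at most a difference of the forms, which are monotone and bounded, hence
  Cauchy.\<close>

lemma increasing_converges: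
  fixes a :: "nat \<Rightarrow> 'a::chilbert_space \<Rightarrow>\<^sub>L 'a"
  assumes eff: "\<And>n. effect_op (a n)" and inc: "\<And>n. op_le (a n) (a (Suc n))"
  obtains s where "increasing_to a s"
proof -
  have "Cauchy (\<lambda>n. a n x)" for x
  proof -
    have "incseq (\<lambda>n. quad_form (a n) x)" by (rule incseq_SucI) (rule op_leD[OF inc])
    moreover have "\<forall>n. quad_form (a n) x \<le> (norm x)\<^sup>2" by (simp add: effect_opD(6)[OF eff])
    ultimately obtain L where "(\<lambda>n. quad_form (a n) x) \<longlonglongrightarrow> L" by (rule incseq_convergent)
    then have "convergent (\<lambda>n. quad_form (a n) x)" by (rule convergentI)
    then have C: "Cauchy (\<lambda>n. quad_form (a n) x)" by (rule convergent_Cauchy)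
    show ?thesis
    proof (rule metric_CauchyI)
      fix e :: real assume e: "e > 0"
      then obtain N where N: "\<And>m n. m \<ge> N \<Longrightarrow> n \<ge> N \<Longrightarrow> dist (quad_form (a m) x) (quad_form (a n) x) < e\<^sup>2"
        using metric_CauchyD[OF C, of "e\<^sup>2"] by auto
      have "dist (a m x) (a n x) < e" if "m \<ge> N" "n \<ge> m" for m n
      proof -
        have "effect_op (a n - a m)"
          using that by (intro effect_op_diff eff op_le_lift[of a, OF inc])
        then have "(norm ((a n - a m) x))\<^sup>2 \<le> quad_form (a n - a m) x" by (rule effect_opD(8))
        also have "\<dots> < e\<^sup>2" using N[of n m] that by (simp add: dist_real_def)
        finally have "norm ((a n - a m) x) < e" using e by (simp add: power_less_imp_less_base)
        then show ?thesis by (simp add: dist_norm blinfun.diff_left norm_minus_commute)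
      qed
      then show "\<exists>N. \<forall>m\<ge>N. \<forall>n\<ge>N. dist (a m x) (a n x) < e"
        by (metis dist_commute nle_le)
    qed
  qed
  then have "\<exists>l. (\<lambda>n. a n x) \<longlonglongrightarrow> l" for x
    using Cauchy_convergent convergent_def by blast
  then obtain f where f: "\<And>x. (\<lambda>n. a n x) \<longlonglongrightarrow> f x" by metis
  have add: "f (x + y) = f x + f y" for x y
    using LIMSEQ_unique[OF f[of "x + y"]] tendsto_add[OF f[of x] f[of y]]
    by (simp add: blinfun.add_right)
  have sc: "f (c *\<^sub>C x) = c *\<^sub>C f x" for c x
    using LIMSEQ_unique[OF f[of "c *\<^sub>C x"]] bounded_linear.tendsto[OF bounded_linear_scaleC f[of x], of c]
    by (simp add: bopD[OF effect_opD(3)[OF eff]])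
  have "norm (f x) \<le> norm x * 1" for x
    using LIMSEQ_le_const2[OF tendsto_norm[OF f[of x]]] effect_opD(9)[OF eff] by auto
  then have "bounded_linear f"
    by (intro bounded_linear_intro[where K = 1]) (auto simp: add sc scaleR_scaleC)
  then have "blinfun_apply (Blinfun f) = f" by (rule bounded_linear_Blinfun_apply)
  then show ?thesis using that[of "Blinfun f"] eff inc f sc by (simp add: increasing_to_def bop_def)
qed

section \<open>Commutants\<close>

lemma commutantI:
  fixes T :: "'a::chilbert_space \<Rightarrow>\<^sub>L 'a" and A :: "('a \<Rightarrow>\<^sub>L 'a) set"
  shows "T \<in> bop \<Longrightarrow> (\<And>S x. S \<in> A \<Longrightarrow> T (S x) = S (T x)) \<Longrightarrow> T \<in> commutant A"
  by (auto simp: commutant_def intro!: blinfun_eqI)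

lemma commutantD:
  fixes T :: "'a::chilbert_space \<Rightarrow>\<^sub>L 'a" and A :: "('a \<Rightarrow>\<^sub>L 'a) set"
  shows "T \<in> commutant A \<Longrightarrow> S \<in> A \<Longrightarrow> T (S x) = S (T x)"
  by (metis (mono_tags, lifting) blinfun_apply_blinfun_compose commutant_def mem_Collect_eq)

lemma commutant_bop: "T \<in> commutant A \<Longrightarrow> T \<in> bop"
  by (simp add: commutant_def)

lemma commutant_commutant: "A \<subseteq> bop \<Longrightarrow> A \<subseteq> commutant (commutant A)"
  by (auto simp: commutant_def)

lemma commutant_compose: "S \<in> commutant A \<Longrightarrow> T \<in> commutant A \<Longrightarrow> S o\<^sub>L T \<in> commutant A"
  by (rule commutantI) (simp_all add: commutant_bop bop_compose commutantD)

lemma commutant_id [simp]: "id_blinfun \<in> commutant A"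
  by (rule commutantI) simp_all

lemma csubspace_commutant:
  assumes "A \<subseteq> bop" shows "csubspace (commutant A)"
  unfolding csubspace_def
proof (intro conjI ballI allI)
  show "0 \<in> commutant A" by (rule commutantI) simp_all
next
  fix S T assume "S \<in> commutant A" "T \<in> commutant A"
  then show "S + T \<in> commutant A"
    by (intro commutantI) (simp_all add: commutant_bop bop_add commutantD blinfun.add_left blinfun.add_right)
next
  fix c S assume "S \<in> commutant A"
  then show "c *\<^sub>C S \<in> commutant A"
    using assms by (intro commutantI)
      (auto simp: commutant_bop bop_scaleC commutantD scaleC_blinfun_apply bopD)
qed

lemma commutant_limit:
  fixes A :: "('a::chilbert_space \<Rightarrow>\<^sub>L 'a) set"
  assumes "A \<subseteq> bop" "\<And>n. a n \<in> commutant A" "s \<in> bop" "\<And>x. (\<lambda>n. a n x) \<longlonglongrightarrow> s x"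
  shows "s \<in> commutant A"
proof (rule commutantI[OF assms(3)])
  fix S x assume S: "S \<in> A"
  have "(\<lambda>n. a n (S x)) \<longlonglongrightarrow> S (s x)"
    unfolding commutantD[OF assms(2) S]
    by (rule bounded_linear.tendsto[OF blinfun.bounded_linear_right assms(4)])
  then show "s (S x) = S (s x)" using assms(4)[of "S x"] LIMSEQ_unique by blast
qed

section \<open>Closure properties of von Neumann algebras\<close>

lemma von_neumann_algebraD:
  fixes A :: "('a::chilbert_space \<Rightarrow>\<^sub>L 'a) set" and s :: "'a \<Rightarrow>\<^sub>L 'a"
  assumes "von_neumann_algebra A"
  shows "A \<subseteq> bop" "x \<in> A \<Longrightarrow> x \<in> bop" "x \<in> A \<Longrightarrow> adj x \<in> A" "csubspace A" "id_blinfun \<in> A"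
    "x \<in> A \<Longrightarrow> y \<in> A \<Longrightarrow> x o\<^sub>L y \<in> A"
    "(\<And>n. a n \<in> A) \<Longrightarrow> s \<in> bop \<Longrightarrow> (\<And>x. (\<lambda>n. a n x) \<longlonglongrightarrow> s x) \<Longrightarrow> s \<in> A"
proof -
  have A: "A \<subseteq> bop" "adj ` A \<subseteq> A" "commutant (commutant A) = A"
    using assms by (auto simp: von_neumann_algebra_def)
  have cb: "commutant A \<subseteq> bop" by (auto simp: commutant_def)
  show "A \<subseteq> bop" "x \<in> A \<Longrightarrow> x \<in> bop" "x \<in> A \<Longrightarrow> adj x \<in> A" using A by auto
  show "csubspace A" using csubspace_commutant[OF cb] A(3) by simp
  show "id_blinfun \<in> A" using commutant_id[of "commutant A"] A(3) by simp
  show "x \<in> A \<Longrightarrow> y \<in> A \<Longrightarrow> x o\<^sub>L y \<in> A" using commutant_compose[of x "commutant A" y] A(3) by simp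
  show "(\<And>n. a n \<in> A) \<Longrightarrow> s \<in> bop \<Longrightarrow> (\<And>x. (\<lambda>n. a n x) \<longlonglongrightarrow> s x) \<Longrightarrow> s \<in> A"
    using commutant_limit[OF cb, of a s] A(3) by simp
qed

locale vna_carrier =
  fixes M :: "('h::chilbert_space \<Rightarrow>\<^sub>L 'h) set"
  assumes vna: "von_neumann_algebra M"
begin

lemmas M_bop = von_neumann_algebraD(2)[OF vna]
lemmas M_adj = von_neumann_algebraD(3)[OF vna]
lemmas M_csubspace = von_neumann_algebraD(4)[OF vna]
lemmas M_id = von_neumann_algebraD(5)[OF vna]
lemmas M_compose = von_neumann_algebraD(6)[OF vna]
lemmas M_limit = von_neumann_algebraD(7)[OF vna]
lemmas M_linear = csubspaceD[OF M_csubspace]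
lemmas M_intros = M_adj M_id M_compose M_linear

lemma M_sum: "(\<And>i. i \<in> I \<Longrightarrow> f i \<in> M) \<Longrightarrow> (\<Sum>i\<in>I. f i) \<in> M"
  by (rule csubspace_sum[OF M_csubspace])

end

lemma vna_generated_superset: "S \<subseteq> bop \<Longrightarrow> S \<subseteq> vna_generated S"
  unfolding vna_generated_def using adj_bop by (intro order_trans[OF _ commutant_commutant]) auto

text \<open>The order is tested by quadratic forms, which pass to strong limits. This makes
  increasing sequences instances of the nets in the definition of normality.\<close>

lemma op_lub_in_increasing:
  assumes "increasing_to a s" "s \<in> A"
  shows "op_lub_in A (range a) s"
  unfolding op_lub_in_def
proof (intro conjI ballI impI assms(2))
  note D = increasing_toD[OF assms(1)]
  show "op_le x s" if "x \<in> range a" for x using that D(6) by auto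
  fix b assume b: "\<forall>x\<in>range a. op_le x b"
  show "op_le s b"
  proof (rule op_leI)
    show "hermitian_op s" using D(5) by (rule effect_opD)
    show "hermitian_op b" using op_le_hermitian[of "a 0" b] b effect_opD(2)[OF D(1)] by blast
    show "quad_form s x \<le> quad_form b x" for x
      by (rule LIMSEQ_le_const2[OF D(7)]) (use b op_leD in blast)
  qed
qed

lemma op_directed_increasing: "increasing_to a s \<Longrightarrow> op_directed (range a)"
  using increasing_toD(3)[of a s] unfolding op_directed_def by simp (metis nle_le op_le_refl)

section \<open>The trace in its GNS representation\<close>

locale tracial_gns = vna_carrier M
  for M :: "('h::chilbert_space \<Rightarrow>\<^sub>L 'h) set" +
  fixes \<tau> :: "('h \<Rightarrow>\<^sub>L 'h) \<Rightarrow> complex"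
    and \<pi> :: "('h \<Rightarrow>\<^sub>L 'h) \<Rightarrow> ('g::chilbert_space \<Rightarrow>\<^sub>L 'g)" and \<Omega> :: 'g
  assumes trace: "faithful_normal_tracial_state M \<tau>"
    and gns: "gns_representation M \<tau> \<pi> \<Omega>"
begin

lemma tau_add: "x \<in> M \<Longrightarrow> y \<in> M \<Longrightarrow> \<tau> (x + y) = \<tau> x + \<tau> y"
  and tau_scaleC: "x \<in> M \<Longrightarrow> \<tau> (c *\<^sub>C x) = c *\<^sub>C \<tau> x"
  and tau_id: "\<tau> id_blinfun = 1"
  and tau_faithful: "x \<in> M \<Longrightarrow> \<tau> (adj x o\<^sub>L x) = 0 \<Longrightarrow> x = 0"
  and tau_normal: "normal_functional M \<tau>"
  using trace by (auto simp: faithful_normal_tracial_state_def clinear_map_on_def)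

lemma tau_scaleR: "x \<in> M \<Longrightarrow> \<tau> (r *\<^sub>R x) = of_real r * \<tau> x"
  by (simp add: scaleR_scaleC tau_scaleC scaleC_complex_def)

lemma tau_zero [simp]: "\<tau> 0 = 0"
  using tau_scaleR[of 0 0] M_linear(1) by simp

lemma tau_diff: "x \<in> M \<Longrightarrow> y \<in> M \<Longrightarrow> \<tau> (x - y) = \<tau> x - \<tau> y"
  using tau_add[of "x - y" y] M_linear by simp

lemma rep_bop: "x \<in> M \<Longrightarrow> \<pi> x \<in> bop"
  and rep_add: "x \<in> M \<Longrightarrow> y \<in> M \<Longrightarrow> \<pi> (x + y) = \<pi> x + \<pi> y"
  and rep_scaleC: "x \<in> M \<Longrightarrow> \<pi> (c *\<^sub>C x) = c *\<^sub>C \<pi> x"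
  and rep_compose: "x \<in> M \<Longrightarrow> y \<in> M \<Longrightarrow> \<pi> (x o\<^sub>L y) = \<pi> x o\<^sub>L \<pi> y"
  and rep_adj: "x \<in> M \<Longrightarrow> \<pi> (adj x) = adj (\<pi> x)"
  and rep_id: "\<pi> id_blinfun = id_blinfun"
  and rep_dense: "closure ((\<lambda>x. \<pi> x \<Omega>) ` M) = UNIV"
  and rep_trace: "x \<in> M \<Longrightarrow> cinner (\<pi> x \<Omega>) \<Omega> = \<tau> x"
  using gns by (auto simp: gns_representation_def clinear_map_on_def)

lemma rep_clinear_op: "x \<in> M \<Longrightarrow> clinear_op (\<pi> x)"
  using rep_bop by (simp add: bop_iff)

lemma rep_zero: "\<pi> 0 = 0"
  using rep_add[of 0 0] M_linear(1) by simp

lemma rep_diff: "x \<in> M \<Longrightarrow> y \<in> M \<Longrightarrow> \<pi> (x - y) = \<pi> x - \<pi> y"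
  using rep_add[of "x - y" y] M_linear by (simp add: algebra_simps)

lemma rep_sum: "(\<And>i. i \<in> I \<Longrightarrow> f i \<in> M) \<Longrightarrow> \<pi> (\<Sum>i\<in>I. f i) = (\<Sum>i\<in>I. \<pi> (f i))"
  by (induction I rule: infinite_finite_induct) (simp_all add: rep_zero rep_add M_sum)

lemma rep_inner: "x \<in> M \<Longrightarrow> y \<in> M \<Longrightarrow> cinner (\<pi> x \<Omega>) (\<pi> y \<Omega>) = \<tau> (adj y o\<^sub>L x)"
  by (simp add: rep_trace[symmetric] M_intros rep_compose rep_adj cinner_adj_left rep_bop)

lemma rep_norm: "x \<in> M \<Longrightarrow> (norm (\<pi> x \<Omega>))\<^sup>2 = Re (\<tau> (adj x o\<^sub>L x))"
  using rep_inner[of x x] cinner_self[of "\<pi> x \<Omega>"] by (metis Re_complex_of_real)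

lemma rep_separating: "x \<in> M \<Longrightarrow> \<pi> x \<Omega> = 0 \<Longrightarrow> x = 0"
  using rep_inner[of x x] tau_faithful by simp

lemma tau_adj: "x \<in> M \<Longrightarrow> \<tau> (adj x) = cnj (\<tau> x)"
  using rep_inner[of id_blinfun x] rep_inner[of x id_blinfun] M_id
    cinner_commute[of "\<pi> id_blinfun \<Omega>" "\<pi> x \<Omega>"] by simp

lemma rep_eqI: "x \<in> M \<Longrightarrow> y \<in> M \<Longrightarrow> \<pi> x \<Omega> = \<pi> y \<Omega> \<Longrightarrow> x = y"
  using rep_separating[of "x - y"] by (simp add: M_linear rep_diff blinfun.diff_left)

text \<open>Normality applied to the two-element net \<open>0 \<le> x\<close>.\<close>

lemma tau_positive:
  assumes "x \<in> M" "positive_op x" shows "0 \<le> Re (\<tau> x)"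
proof -
  have x0: "op_le 0 x" using assms(2) by (simp add: positive_op_zero_le)
  have "positive_op 0" by (simp add: positive_op_zero_le)
  then have "Re (\<tau> x) = (SUP a\<in>{0, x}. Re (\<tau> a))"
    using tau_normal[unfolded normal_functional_def, rule_format, of "{0, x}" x] assms x0 M_linear(1)
    by (auto simp: op_directed_def op_lub_in_def)
  then have "Re (\<tau> x) = max 0 (Re (\<tau> x))" by (simp add: cSup_insert_If sup_max)
  then show ?thesis by simp
qed

lemma tau_mono:
  assumes "x \<in> M" "y \<in> M" "op_le x y" shows "Re (\<tau> x) \<le> Re (\<tau> y)"
  using tau_positive[of "y - x"] assms by (simp add: M_linear tau_diff op_le_def)

lemma tau_effect_le: "x \<in> M \<Longrightarrow> effect_op x \<Longrightarrow> Re (\<tau> x) \<le> 1"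
  using tau_mono[of x id_blinfun] M_id tau_id by (simp add: effect_op_def)

lemma effect_norm: "x \<in> M \<Longrightarrow> effect_op x \<Longrightarrow> (norm (\<pi> x \<Omega>))\<^sup>2 \<le> Re (\<tau> x)"
  using tau_mono[of "adj x o\<^sub>L x" x] op_le_square[of x] by (simp add: rep_norm M_intros)

lemma effect_trace_zero: "x \<in> M \<Longrightarrow> effect_op x \<Longrightarrow> Re (\<tau> x) = 0 \<Longrightarrow> x = 0"
  using effect_norm[of x] by (intro rep_separating) simp_all

text \<open>Since s - a n is an effect, its square lies below it, so its squared L^2 norm is at most
  its trace. Normality of the trace thus supplies the continuity at \<Omega> that is not among the
  GNS data.\<close>

lemma tau_increasing:
  assumes a: "increasing_to a s" and M: "\<And>n. a n \<in> M"
  shows "s \<in> M" "(\<lambda>n. Re (\<tau> (a n))) \<longlonglongrightarrow> Re (\<tau> s)" "(\<lambda>n. \<pi> (a n) \<Omega>) \<longlonglongrightarrow> \<pi> s \<Omega>"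
proof -
  note D = increasing_toD[OF a]
  show sM: "s \<in> M" by (rule M_limit[OF M _ D(4)]) (rule effect_opD(3)[OF D(5)])
  have "range a \<subseteq> {a \<in> M. positive_op a}" using M effect_opD(1)[OF D(1)] by auto
  then have sup: "Re (\<tau> s) = (SUP n. Re (\<tau> (a n)))"
    using tau_normal[unfolded normal_functional_def, rule_format, of "range a" s]
      op_directed_increasing[OF a] op_lub_in_increasing[OF a sM] by (simp add: image_image)
  have inc: "incseq (\<lambda>n. Re (\<tau> (a n)))" by (intro incseq_SucI tau_mono M D(2))
  have "bdd_above (range (\<lambda>n. Re (\<tau> (a n))))"
    by (rule bdd_aboveI[of _ "Re (\<tau> s)"]) (auto intro: tau_mono M sM D(6))
  then show lim: "(\<lambda>n. Re (\<tau> (a n))) \<longlonglongrightarrow> Re (\<tau> s)"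
    unfolding sup using inc by (intro LIMSEQ_incseq_SUP)
  have "(\<lambda>n. norm (\<pi> s \<Omega> - \<pi> (a n) \<Omega>)) \<longlonglongrightarrow> 0"
  proof (rule tendsto_sandwich[of "\<lambda>_. 0" _ _ "\<lambda>n. sqrt (Re (\<tau> s) - Re (\<tau> (a n)))"])
    have "(norm (\<pi> s \<Omega> - \<pi> (a n) \<Omega>))\<^sup>2 \<le> Re (\<tau> s) - Re (\<tau> (a n))" for n
      using effect_norm[OF M_linear(6)[OF sM M] effect_op_diff[OF D(1) D(5) D(6)], of n]
      by (simp add: rep_diff tau_diff M sM blinfun.diff_left)
    then show "\<forall>\<^sub>F n in sequentially. norm (\<pi> s \<Omega> - \<pi> (a n) \<Omega>) \<le> sqrt (Re (\<tau> s) - Re (\<tau> (a n)))"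
      by (simp add: real_le_rsqrt)
    have "(\<lambda>n. sqrt (Re (\<tau> s) - Re (\<tau> (a n)))) \<longlonglongrightarrow> sqrt (Re (\<tau> s) - Re (\<tau> s))"
      by (intro tendsto_intros lim)
    then show "(\<lambda>n. sqrt (Re (\<tau> s) - Re (\<tau> (a n)))) \<longlonglongrightarrow> 0" by simp
  qed simp_all
  then have "(\<lambda>n. \<pi> s \<Omega> - \<pi> (a n) \<Omega>) \<longlonglongrightarrow> 0" by (rule tendsto_norm_zero_cancel)
  then have "(\<lambda>n. \<pi> s \<Omega> - (\<pi> s \<Omega> - \<pi> (a n) \<Omega>)) \<longlonglongrightarrow> \<pi> s \<Omega> - 0" by (intro tendsto_diff tendsto_const)
  then show "(\<lambda>n. \<pi> (a n) \<Omega>) \<longlonglongrightarrow> \<pi> s \<Omega>" by simp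
qed

text \<open>Exhaustion: a sequence that increases the trace greedily converges to a maximal element.\<close>

lemma maximal_effect:
  assumes sub: "\<And>a. a \<in> \<A> \<Longrightarrow> a \<in> M \<and> effect_op a" and ne: "\<A> \<noteq> {}"
    and closed: "\<And>a s. (\<And>n. a n \<in> \<A>) \<Longrightarrow> increasing_to a s \<Longrightarrow> s \<in> \<A>"
  obtains s where "s \<in> \<A>" "\<And>b. b \<in> \<A> \<Longrightarrow> op_le s b \<Longrightarrow> b = s"
proof -
  \<comment> \<open>The traces of effects are at most 1, so the supremum over the elements above a
    is finite and can be approached within 1/(n+1).\<close>
  have step: "\<exists>c. c \<in> \<A> \<and> op_le a c \<and> (\<forall>b\<in>\<A>. op_le a b \<longrightarrow> Re (\<tau> b) \<le> Re (\<tau> c) + inverse (Suc n))"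
    if a: "a \<in> \<A>" for a and n :: nat
  proof -
    let ?U = "{b \<in> \<A>. op_le a b}"
    have bdd: "bdd_above ((\<lambda>b. Re (\<tau> b)) ` ?U)"
      by (rule bdd_aboveI[of _ 1]) (use sub tau_effect_le in auto)
    have aU: "?U \<noteq> {}" using a by auto
    have "(SUP b\<in>?U. Re (\<tau> b)) - inverse (Suc n) < (SUP b\<in>?U. Re (\<tau> b))" by simp
    then obtain c where c: "c \<in> ?U" "(SUP b\<in>?U. Re (\<tau> b)) - inverse (Suc n) < Re (\<tau> c)"
      using less_cSUP_iff[OF aU bdd] by blast
    have "Re (\<tau> b) \<le> Re (\<tau> c) + inverse (Suc n)" if "b \<in> ?U" for b
      using cSUP_upper[OF that bdd] c(2) by simp
    then show ?thesis using c(1) by blast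
  qed
  obtain a0 where "a0 \<in> \<A>" using ne by blast
  then obtain a where a: "\<And>n. a n \<in> \<A>"
    and inc: "\<And>n. op_le (a n) (a (Suc n)) \<and>
      (\<forall>b\<in>\<A>. op_le (a n) b \<longrightarrow> Re (\<tau> b) \<le> Re (\<tau> (a (Suc n))) + inverse (Suc n))"
    using dependent_nat_choice[of "\<lambda>_ a. a \<in> \<A>" "\<lambda>n a c. op_le a c \<and>
      (\<forall>b\<in>\<A>. op_le a b \<longrightarrow> Re (\<tau> b) \<le> Re (\<tau> c) + inverse (Suc n))"] step by metis
  obtain s where s: "increasing_to a s"
    using increasing_converges[of a] sub[OF a] inc by blast
  note D = increasing_toD[OF s]
  have sA: "s \<in> \<A>" by (rule closed[OF a s])
  show ?thesis
  proof (rule that[OF sA])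
    fix b assume b: "b \<in> \<A>" "op_le s b"
    \<comment> \<open>b lies above every a n, so the choice of the next term leaves it at most
      1/(n+1) more trace. In the limit b - s has trace zero, and faithfulness gives b = s.\<close>
    have "Re (\<tau> b) \<le> Re (\<tau> s) + inverse (Suc n)" for n
    proof -
      have "Re (\<tau> b) \<le> Re (\<tau> (a (Suc n))) + inverse (Suc n)"
        using inc b op_le_trans[OF D(6) b(2)] by blast
      moreover have "Re (\<tau> (a (Suc n))) \<le> Re (\<tau> s)" using sub a sA D(6) by (intro tau_mono) auto
      ultimately show ?thesis by simp
    qed
    moreover have "(\<lambda>n. Re (\<tau> s) + inverse (real (Suc n))) \<longlonglongrightarrow> Re (\<tau> s) + 0"
      by (intro tendsto_add tendsto_const LIMSEQ_inverse_real_of_nat)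
    ultimately have "Re (\<tau> b) \<le> Re (\<tau> s) + 0" by (intro LIMSEQ_le_const) auto
    then have "Re (\<tau> (b - s)) = 0"
      using tau_mono[of s b] sub sA b by (simp add: tau_diff)
    then have "b - s = 0" using sub sA b by (intro effect_trace_zero effect_op_diff M_linear) auto
    then show "b = s" by simp
  qed
qed

section \<open>Intertwiners from the given Hilbert space to the GNS space\<close>

text \<open>Bicommutants are taken on the space where M acts, but the trace vector lives in the GNS
  space; intertwiners carry commutation relations from one to the other.\<close>

definition intertwiner :: "('h \<Rightarrow>\<^sub>L 'g) \<Rightarrow> bool" where
  "intertwiner W \<longleftrightarrow> clinear_op W \<and> (\<forall>x\<in>M. \<forall>h. W (blinfun_apply x h) = \<pi> x (W h))"

text \<open>The bound makes z c \<xi> \<mapsto> \<pi>(z c) \<Omega> well defined and continuous on M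
  c \<xi>. Extended by zero it intertwines everywhere, because M is closed under adjoints and
  therefore preserves the orthogonal complement.\<close>

lemma bounded_intertwiner:
  assumes K: "\<And>z. z \<in> M \<Longrightarrow> norm (\<pi> (z o\<^sub>L c) \<Omega>) \<le> K * norm (blinfun_apply z (c \<xi>))" and c: "c \<in> M"
  obtains W where "intertwiner W" "W (c \<xi>) = \<pi> c \<Omega>"
proof -
  define S where "S = (\<lambda>z. blinfun_apply z (c \<xi>)) ` M"
  \<comment> \<open>Different z may give the same vector z (c \<xi>); \<open>eq\<close> shows that
    the chosen representative does not matter.\<close>
  define L where "L x = \<pi> ((SOME z. z \<in> M \<and> blinfun_apply z (c \<xi>) = x) o\<^sub>L c) \<Omega>" for x
  have eq: "\<pi> (z o\<^sub>L c) \<Omega> = \<pi> (z' o\<^sub>L c) \<Omega>" if "z \<in> M" "z' \<in> M" "z (c \<xi>) = z' (c \<xi>)" for z z'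
  proof -
    have "norm (\<pi> ((z - z') o\<^sub>L c) \<Omega>) \<le> 0"
      using K[OF M_linear(6)[OF that(1,2)]] that(3) by (simp add: blinfun.diff_left)
    moreover have "(z - z') o\<^sub>L c = (z o\<^sub>L c) - (z' o\<^sub>L c)"
      by (rule blinfun_eqI) (simp add: blinfun.diff_left)
    ultimately show ?thesis using that c by (simp add: rep_diff M_compose blinfun.diff_left)
  qed
  have L: "L (z (c \<xi>)) = \<pi> (z o\<^sub>L c) \<Omega>" if z: "z \<in> M" for z
  proof -
    let ?w = "SOME w. w \<in> M \<and> blinfun_apply w (c \<xi>) = z (c \<xi>)"
    have "?w \<in> M \<and> ?w (c \<xi>) = z (c \<xi>)" by (rule someI[of _ z]) (simp add: z)
    then show ?thesis unfolding L_def by (intro eq z) auto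
  qed
  have add: "(y + z) o\<^sub>L c = (y o\<^sub>L c) + (z o\<^sub>L c)" for y z :: "'h \<Rightarrow>\<^sub>L 'h"
    by (rule blinfun_eqI) (simp add: blinfun.add_left)
  have S: "csubspace S"
    unfolding S_def
    by (rule csubspace_image[OF M_csubspace]) (simp add: clinear_map_on_def blinfun.add_left scaleC_blinfun_apply)
  have Llin: "clinear_map_on S L"
    unfolding clinear_map_on_def
  proof (intro conjI ballI allI)
    fix x y assume "x \<in> S" "y \<in> S"
    then obtain z w where *: "z \<in> M" "w \<in> M" "x = z (c \<xi>)" "y = w (c \<xi>)" by (auto simp: S_def)
    then have "x + y = (z + w) (c \<xi>)" by (simp add: blinfun.add_left)
    then have "L (x + y) = \<pi> ((z + w) o\<^sub>L c) \<Omega>" using * by (simp only: L M_linear)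
    then show "L (x + y) = L x + L y" using * c by (simp add: L add rep_add M_compose blinfun.add_left)
  next
    fix k x assume "x \<in> S"
    then obtain z where *: "z \<in> M" "x = z (c \<xi>)" by (auto simp: S_def)
    then have "k *\<^sub>C x = (k *\<^sub>C z) (c \<xi>)" by (simp add: scaleC_blinfun_apply)
    then have "L (k *\<^sub>C x) = \<pi> ((k *\<^sub>C z) o\<^sub>L c) \<Omega>" using * by (simp only: L M_linear)
    then show "L (k *\<^sub>C x) = k *\<^sub>C L x"
      using * c by (simp add: L blinfun_compose_scaleC_left rep_scaleC M_compose scaleC_blinfun_apply)
  qed
  have bd: "norm (L x) \<le> K * norm x" if "x \<in> S" for x
    using that K by (auto simp: S_def L)
  obtain W where W: "clinear_op W" "\<And>x. x \<in> S \<Longrightarrow> W x = L x"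
      "\<And>x. (\<And>s. s \<in> S \<Longrightarrow> cinner x s = 0) \<Longrightarrow> W x = 0"
    using extend_bounded_clinear[OF S Llin bd] by blast
  have "W (x h) = \<pi> x (W h)" if x: "x \<in> M" for x h
  proof -
    obtain s where s: "s \<in> closure S" "\<And>t. t \<in> closure S \<Longrightarrow> cinner (h - s) t = 0"
      using orthogonal_decomposition[OF closed_closure csubspace_closure[OF S], of h] by blast
    have "(W o\<^sub>L x) s = (\<pi> x o\<^sub>L W) s"
    proof (rule eq_on_closure_cspan)
      show "clinear_op (W o\<^sub>L x)" "clinear_op (\<pi> x o\<^sub>L W)"
        using W(1) rep_clinear_op[OF x] M_bop[OF x] by (simp_all add: clinear_op_def bopD)
      show "s \<in> closure (cspan S)"
        using s(1) closure_mono[OF complex_vector.span_superset[of S]] by (auto simp: cspan_raw_def)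
      fix y assume "y \<in> S"
      then obtain z where z: "z \<in> M" "y = z (c \<xi>)" by (auto simp: S_def)
      have xy: "x y = (x o\<^sub>L z) (c \<xi>)" using z by simp
      have "x y \<in> S" unfolding S_def xy using x z(1) by (intro imageI M_compose)
      then have "W (x y) = L (x y)" by (rule W(2))
      also have "\<dots> = \<pi> (x o\<^sub>L (z o\<^sub>L c)) \<Omega>"
        unfolding xy using z x by (simp only: L M_compose blinfun_compose_assoc)
      also have "\<dots> = \<pi> x (W y)"
        using z x c W(2)[OF \<open>y \<in> S\<close>] by (simp add: rep_compose M_compose L)
      finally show "(W o\<^sub>L x) y = (\<pi> x o\<^sub>L W) y" by simp
    qed
    moreover have "W (h - s) = 0"
      using s(2) closure_subset by (intro W(3)) blast
    \<comment> \<open>x maps the complement of S into itself because \<open>adj x\<close> maps S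
      into itself.\<close>
    moreover have "W (x (h - s)) = 0"
    proof (rule W(3))
      fix t assume "t \<in> S"
      then obtain z where z: "z \<in> M" "t = z (c \<xi>)" by (auto simp: S_def)
      have "adj x t \<in> S"
        unfolding S_def z(2) using x z by (intro image_eqI[of _ _ "adj x o\<^sub>L z"]) (simp_all add: M_intros)
      then show "cinner (x (h - s)) t = 0"
        using s(2)[of "adj x t"] closure_subset[of S] by (auto simp: cinner_adj_right M_bop[OF x])
    qed
    ultimately show ?thesis by (simp add: blinfun.diff_right)
  qed
  then have "intertwiner W" using W(1) by (simp add: intertwiner_def)
  moreover have "W (c \<xi>) = \<pi> c \<Omega>"
  proof -
    have id: "c \<xi> = id_blinfun (c \<xi>)" by simp
    have "c \<xi> \<in> S" unfolding S_def using M_id by (rule rev_image_eqI) simp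
    then have "W (c \<xi>) = L (id_blinfun (c \<xi>))" using W(2) by simp
    also have "\<dots> = \<pi> (id_blinfun o\<^sub>L c) \<Omega>" by (rule L[OF M_id])
    also have "id_blinfun o\<^sub>L c = c" by simp
    finally show ?thesis .
  qed
  ultimately show ?thesis by (rule that)
qed

text \<open>The map \<open>z c \<xi> \<mapsto> \<pi>(z c) \<Omega>\<close> is bounded because \<open>c z\<^sup>* z c \<le> \<parallel>z\<parallel>\<^sup>2 c\<close>.\<close>

lemma dominated_intertwiner:
  assumes c: "c \<in> M" "effect_op c" and C: "0 \<le> C"
    and dom: "\<And>b. b \<in> M \<Longrightarrow> positive_op b \<Longrightarrow> op_le b c \<Longrightarrow> Re (\<tau> b) \<le> C * quad_form b \<xi>"
  obtains W where "intertwiner W" "W (c \<xi>) = \<pi> c \<Omega>"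
proof (rule bounded_intertwiner[OF _ c(1)])
  fix z assume z: "z \<in> M"
  note zb = M_bop[OF z] and cb = M_bop[OF c(1)] and cD = effect_opD[OF c(2)]
  \<comment> \<open>The added 1 permits division by k when z = 0.\<close>
  define k where "k = (norm z)\<^sup>2 + 1"
  have k: "k > 0" by (simp add: k_def add_nonneg_pos)
  define b where "b = adj (z o\<^sub>L c) o\<^sub>L (z o\<^sub>L c)"
  have bM: "b \<in> M" using z c(1) by (simp add: b_def M_intros)
  have bq: "quad_form b h = (norm (z (c h)))\<^sup>2" for h
    using bop_compose[OF zb cb] by (simp add: b_def quad_form_def cinner_adj_left cinner_self)
  have bh: "hermitian_op b"
    unfolding b_def by (rule positive_opD(1)[OF positive_op_square[OF bop_compose[OF zb cb]]])
  have le: "quad_form ((1 / k) *\<^sub>R b) h \<le> quad_form c h" for h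
  proof -
    have "(norm (z (c h)))\<^sup>2 \<le> (norm z * norm (c h))\<^sup>2" by (intro power_mono norm_blinfun) simp
    also have "\<dots> \<le> k * (norm (c h))\<^sup>2" by (simp add: k_def power_mult_distrib mult_right_mono)
    also have "\<dots> \<le> k * quad_form c h" using k cD(8) by simp
    finally show ?thesis using k by (simp add: bq field_simps)
  qed
  have "Re (\<tau> ((1 / k) *\<^sub>R b)) \<le> C * quad_form ((1 / k) *\<^sub>R b) \<xi>"
  proof (rule dom)
    show "(1 / k) *\<^sub>R b \<in> M" by (simp add: bM M_linear)
    show "positive_op ((1 / k) *\<^sub>R b)" using k by (simp add: positive_op_iff bh bq)
    show "op_le ((1 / k) *\<^sub>R b) c" by (intro op_leI le) (simp_all add: bh cD)
  qed
  then have "Re (\<tau> b) / k \<le> (C * quad_form b \<xi>) / k" by (simp add: tau_scaleR bM)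
  then have "Re (\<tau> b) \<le> C * quad_form b \<xi>" using k by (simp add: divide_le_cancel)
  moreover have "Re (\<tau> b) = (norm (\<pi> (z o\<^sub>L c) \<Omega>))\<^sup>2" using z c(1) by (simp add: b_def rep_norm M_compose)
  ultimately have "(norm (\<pi> (z o\<^sub>L c) \<Omega>))\<^sup>2 \<le> (sqrt C * norm (z (c \<xi>)))\<^sup>2"
    using C by (simp add: bq power_mult_distrib)
  then show "norm (\<pi> (z o\<^sub>L c) \<Omega>) \<le> sqrt C * norm (z (c \<xi>))"
    by (rule power2_le_imp_le) (simp add: C)
qed (use that in blast)

text \<open>Take a maximal effect \<open>s\<close> with \<open>s \<Omega>\<close> in the closed span. If \<open>s \<noteq> 1\<close>, choose \<open>\<xi>\<close> and \<open>C\<close> with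
  \<open>\<tau>(1 - s) < C \<langle>(1 - s) \<xi>, \<xi>\<rangle>\<close> and remove from \<open>1 - s\<close> a maximal part on which \<open>\<tau> \<ge> C \<langle>\<cdot> \<xi>, \<xi>\<rangle>\<close>.
  The remainder is nonzero and dominated by the vector functional, so it enlarges \<open>s\<close>.\<close>

theorem intertwiners_total: "closure (cspan {blinfun_apply W h | W h. intertwiner W}) = UNIV"
proof -
  let ?X = "{blinfun_apply W h | W h. intertwiner W}"
  define H1 where "H1 = closure (cspan ?X)"
  have H1: "closed H1" "csubspace H1" by (simp_all add: H1_def csubspace_closure csubspace_cspan)
  have inv: "\<pi> x v \<in> H1" if x: "x \<in> M" and v: "v \<in> H1" for x v
  proof (rule invariant_closure_cspan[OF rep_clinear_op[OF x] H1])
    show "v \<in> closure (cspan ?X)" using v by (simp add: H1_def)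
    fix u assume "u \<in> ?X"
    then obtain W h where W: "intertwiner W" "u = W h" by blast
    then have "\<pi> x u = W (x h)" using x by (simp add: intertwiner_def)
    then have "\<pi> x u \<in> ?X" using W(1) by blast
    then show "\<pi> x u \<in> H1"
      unfolding H1_def by (rule closure_cspan_superset)
  qed
  define F where "F = {s \<in> M. effect_op s \<and> \<pi> s \<Omega> \<in> H1}"
  obtain s where s: "s \<in> F" "\<And>b. b \<in> F \<Longrightarrow> op_le s b \<Longrightarrow> b = s"
  proof (rule maximal_effect[of F])
    show "F \<noteq> {}" using M_linear(1) csubspaceD(1)[OF H1(2)] by (auto simp: F_def rep_zero intro!: exI[of _ 0])
    fix a t assume a: "\<And>n::nat. a n \<in> F" "increasing_to a t"
    have aM: "\<And>n. a n \<in> M" "\<And>n. \<pi> (a n) \<Omega> \<in> H1" using a(1) by (auto simp: F_def)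
    note lim = tau_increasing[OF a(2) aM(1)]
    show "t \<in> F"
      using lim(1) increasing_toD(5)[OF a(2)] closed_sequentially[OF H1(1) aM(2) lim(3)]
      by (simp add: F_def)
  next
    show "b \<in> M \<and> effect_op b" if "b \<in> F" for b using that by (simp add: F_def)
  qed blast
  have sM: "s \<in> M" and se: "effect_op s" and sO: "\<pi> s \<Omega> \<in> H1" using s(1) by (auto simp: F_def)
  define r where "r = id_blinfun - s"
  have rM: "r \<in> M" by (simp add: r_def M_intros sM)
  have re: "effect_op r" unfolding r_def by (intro effect_op_diff se effect_opD(4)) simp
  have "r = 0"
  proof (rule ccontr)
    assume "r \<noteq> 0"
    then obtain \<xi> where "quad_form r \<xi> \<noteq> 0" using positive_op_eq_zero effect_opD(1)[OF re] by blast
    then have \<xi>: "quad_form r \<xi> > 0" using effect_opD(7)[OF re, of \<xi>] by simp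
    \<comment> \<open>With this C the form of r at \<xi>, scaled by C, is 2, while the trace of r is
      at most 1. So the whole of r is not in \<A>, and the remainder c will be nonzero.\<close>
    define C where "C = 2 / quad_form r \<xi>"
    have C: "0 \<le> C" "C * quad_form r \<xi> = 2" using \<xi> by (auto simp: C_def)
    define \<A> where "\<A> = {a \<in> M. positive_op a \<and> op_le a r \<and> C * quad_form a \<xi> \<le> Re (\<tau> a)}"
    obtain a where a: "a \<in> \<A>" "\<And>b. b \<in> \<A> \<Longrightarrow> op_le a b \<Longrightarrow> b = a"
    proof (rule maximal_effect[of \<A>])
      show "b \<in> M \<and> effect_op b" if "b \<in> \<A>" for b
        using that re by (auto simp: \<A>_def intro: effect_op_le)
      have "0 \<in> \<A>" using M_linear(1) effect_opD(1)[OF re] by (auto simp: \<A>_def positive_op_zero_le)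
        then show "\<A> \<noteq> {}" by blast
      fix b t assume b: "\<And>n::nat. b n \<in> \<A>" "increasing_to b t"
      note D = increasing_toD[OF b(2)]
      have bM: "\<And>n. b n \<in> M" and br: "\<And>n. op_le (b n) r"
        and bC: "\<And>n. C * quad_form (b n) \<xi> \<le> Re (\<tau> (b n))" using b(1) by (auto simp: \<A>_def)
      note lim = tau_increasing[OF b(2) bM]
      have "op_le t r"
        by (rule op_leI) (use D effect_opD(2)[OF re] effect_opD(2)[OF D(5)] LIMSEQ_le_const2[OF D(7)] op_leD[OF br] in auto)
      moreover have "C * quad_form t \<xi> \<le> Re (\<tau> t)"
        by (rule LIMSEQ_le[OF tendsto_mult_left[OF D(7)] lim(2)]) (use bC in auto)
      ultimately show "t \<in> \<A>" using lim(1) effect_opD(1)[OF D(5)] by (simp add: \<A>_def)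
    qed blast
    have aM: "a \<in> M" and ap: "positive_op a" and ar: "op_le a r" and aC: "C * quad_form a \<xi> \<le> Re (\<tau> a)"
      using a(1) by (auto simp: \<A>_def)
    define c where "c = r - a"
    have cM: "c \<in> M" by (simp add: c_def M_linear rM aM)
    have ce: "effect_op c" unfolding c_def by (rule effect_op_diff[OF effect_op_le[OF ap ar re] re ar])
    \<comment> \<open>A violating b could be added to a within \<A>; maximality would make it zero,
      and zero violates nothing.\<close>
    have "Re (\<tau> b) \<le> C * quad_form b \<xi>" if b: "b \<in> M" "positive_op b" "op_le b c" for b
    proof (rule ccontr)
      assume neg: "\<not> ?thesis"
      have "a + b \<in> \<A>"
        unfolding \<A>_def
      proof (intro CollectI conjI)
        show "a + b \<in> M" by (simp add: aM b M_linear)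
        show "positive_op (a + b)" using ap b(2) by (simp add: positive_op_iff)
        show "op_le (a + b) r" using b(3) by (simp add: op_le_def c_def algebra_simps)
        show "C * quad_form (a + b) \<xi> \<le> Re (\<tau> (a + b))"
          using aC neg by (simp add: tau_add aM b distrib_left)
      qed
      moreover have "op_le a (a + b)" using b(2) by (simp add: op_le_def)
      ultimately have "a + b = a" by (rule a(2))
      then have "b = 0" by simp
      then show False using neg by simp
    qed
    then obtain W where W: "intertwiner W" "W (c \<xi>) = \<pi> c \<Omega>"
      using dominated_intertwiner[OF cM ce C(1)] by metis
    have "\<pi> c \<Omega> \<in> H1"
      unfolding H1_def W(2)[symmetric] using W(1) by (intro closure_cspan_superset) blast
    then have "\<pi> (s + c) \<Omega> \<in> H1" using sO csubspaceD(2)[OF H1(2)] by (simp add: rep_add sM cM blinfun.add_left)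
    moreover have "effect_op (s + c)"
    proof -
      have "s + c = id_blinfun - a" by (simp add: c_def r_def)
      moreover have "effect_op a" by (rule effect_op_le[OF ap ar re])
      ultimately show ?thesis by (simp add: effect_op_diff effect_opD(4))
    qed
    ultimately have "s + c \<in> F" by (simp add: F_def sM cM M_linear)
    moreover have "op_le s (s + c)" using effect_opD(1)[OF ce] by (simp add: op_le_def)
    ultimately have "s + c = s" by (rule s(2))
    then have "a = r" by (simp add: c_def)
    then show False using aC C(2) tau_effect_le[OF rM re] by simp
  qed
  then have "\<Omega> \<in> H1" using sO by (simp add: r_def rep_id)
  then have "(\<lambda>x. \<pi> x \<Omega>) ` M \<subseteq> H1" using inv by blast
  then have "closure ((\<lambda>x. \<pi> x \<Omega>) ` M) \<subseteq> H1" using H1(1) by (rule closure_minimal)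
  then show ?thesis using rep_dense by (auto simp: H1_def)
qed

end

lemma scaleC_sum_left_apply: "blinfun_apply (\<Sum>i\<in>I. c i *\<^sub>C T i) x = (\<Sum>i\<in>I. c i *\<^sub>C T i x)"
  for T :: "'i \<Rightarrow> 'a::chilbert_space \<Rightarrow>\<^sub>L 'b::chilbert_space"
  by (simp add: blinfun.sum_left scaleC_blinfun_apply)

lemma scaleC_scaleR_commute: "c *\<^sub>C r *\<^sub>R x = r *\<^sub>R c *\<^sub>C x" for x :: "'a::complex_vector"
  by (simp add: scaleR_scaleC scaleC_scaleC mult.commute)

lemma projection_onto_commute:
  fixes S :: "'a::chilbert_space set"
  assumes S: "closed S" "csubspace S" and T: "T \<in> bop"
    and inv: "\<And>x. x \<in> S \<Longrightarrow> T x \<in> S" "\<And>x. x \<in> S \<Longrightarrow> adj T x \<in> S"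
  shows "projection_onto S (T x) = T (projection_onto S x)"
proof (rule projection_onto_eqI[OF S])
  note P = is_projection_projection_onto[OF S] and R = range_projection_onto[OF S]
  have Px: "projection_onto S x \<in> S" using R by blast
  then show "T (projection_onto S x) \<in> S" by (rule inv)
  fix t assume "t \<in> S"
  then have "adj T t \<in> S" by (rule inv)
  then have fix': "projection_onto S (adj T t) = adj T t"
    using is_projection_range_iff[OF P] R by blast
  have "cinner (T x - T (projection_onto S x)) t = cinner (x - projection_onto S x) (adj T t)"
    by (simp add: cinner_adj_right[OF T] blinfun.diff_right)
  also have "\<dots> = 0"
    using is_projection_apply(3)[OF P, of x "adj T t"] fix' by (simp add: cinner_diff_left)
  finally show "cinner (T x - T (projection_onto S x)) t = 0" .
qed

section \<open>Jones projections\<close>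

lemma (in tracial_gns) rep_vector: "x \<in> M \<Longrightarrow> y \<in> M \<Longrightarrow> \<pi> x (\<pi> y \<Omega>) = \<pi> (x o\<^sub>L y) \<Omega>"
  by (simp add: rep_compose)

lemma (in tracial_gns) rep_dense_eqI:
  assumes "clinear_op S" "clinear_op T" "\<And>x. x \<in> M \<Longrightarrow> S (\<pi> x \<Omega>) = T (\<pi> x \<Omega>)"
  shows "S = (T :: 'g \<Rightarrow>\<^sub>L 'c::chilbert_space)"
proof (rule blinfun_eqI)
  fix h
  have "closure ((\<lambda>x. \<pi> x \<Omega>) ` M) \<subseteq> closure (cspan ((\<lambda>x. \<pi> x \<Omega>) ` M))"
    by (intro closure_mono) (auto intro: complex_vector.span_base)
  then have "h \<in> closure (cspan ((\<lambda>x. \<pi> x \<Omega>) ` M))" using rep_dense by auto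
  then show "S h = T h" using eq_on_closure_cspan[OF assms(1,2), of "(\<lambda>x. \<pi> x \<Omega>) ` M" h] assms(3) by blast
qed

text \<open>N is described by a few closure properties so that the locale applies twice: to N in M,
  and to the image of M under \<pi> in M1.\<close>

locale trace_expectation = tracial_gns M \<tau> \<pi> \<Omega>
  for M :: "('h::chilbert_space \<Rightarrow>\<^sub>L 'h) set" and \<tau>
    and \<pi> :: "('h \<Rightarrow>\<^sub>L 'h) \<Rightarrow> ('g::chilbert_space \<Rightarrow>\<^sub>L 'g)" and \<Omega> +
  fixes N :: "('h \<Rightarrow>\<^sub>L 'h) set" and E :: "('h \<Rightarrow>\<^sub>L 'h) \<Rightarrow> ('h \<Rightarrow>\<^sub>L 'h)"
  assumes N_sub: "N \<subseteq> M" and N_adj: "x \<in> N \<Longrightarrow> adj x \<in> N" and N_csubspace: "csubspace N"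
    and N_id: "id_blinfun \<in> N" and expectation: "conditional_expectation N M \<tau> E"
begin

lemma N_M: "x \<in> N \<Longrightarrow> x \<in> M"
  using N_sub by blast

lemma E_N: "x \<in> M \<Longrightarrow> E x \<in> N"
  and E_fix: "y \<in> N \<Longrightarrow> E y = y"
  and E_bimodule: "x \<in> M \<Longrightarrow> y \<in> N \<Longrightarrow> z \<in> N \<Longrightarrow> E (y o\<^sub>L x o\<^sub>L z) = y o\<^sub>L E x o\<^sub>L z"
  and E_trace: "x \<in> M \<Longrightarrow> \<tau> (E x) = \<tau> x"
  using expectation by (auto simp: conditional_expectation_def clinear_map_on_def)

lemma E_M: "x \<in> M \<Longrightarrow> E x \<in> M"
  using E_N N_M by blast

lemma E_left: "x \<in> M \<Longrightarrow> y \<in> N \<Longrightarrow> E (y o\<^sub>L x) = y o\<^sub>L E x"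
  and E_right: "x \<in> M \<Longrightarrow> y \<in> N \<Longrightarrow> E (x o\<^sub>L y) = E x o\<^sub>L y"
  using E_bimodule[of x y id_blinfun] E_bimodule[of x id_blinfun y] N_id by simp_all

text \<open>Both sides lie in N and have the same trace pairing with elements of N. Pairing with
  their own difference and using faithfulness shows that they agree.\<close>

lemma E_adj:
  assumes x: "x \<in> M" shows "E (adj x) = adj (E x)"
proof -
  let ?y = "E (adj x) - adj (E x)"
  have yN: "?y \<in> N" by (simp add: x E_N M_adj N_adj csubspaceD[OF N_csubspace])
  have aN: "adj ?y \<in> N" using N_adj[OF yN] .
  have 1: "\<tau> (adj ?y o\<^sub>L E (adj x)) = \<tau> (adj ?y o\<^sub>L adj x)"
    using E_left[OF M_adj[OF x] aN] E_trace[OF M_compose[OF N_M[OF aN] M_adj[OF x]]] by simp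
  have "\<tau> (adj ?y o\<^sub>L adj (E x)) = cnj (\<tau> (E x o\<^sub>L ?y))"
    using tau_adj[OF M_compose[OF E_M[OF x] N_M[OF yN]]] adj_compose[of "E x" ?y]
      M_bop[OF E_M[OF x]] M_bop[OF N_M[OF yN]] by simp
  also have "\<tau> (E x o\<^sub>L ?y) = \<tau> (x o\<^sub>L ?y)"
    using E_right[OF x yN] E_trace[OF M_compose[OF x N_M[OF yN]]] by simp
  also have "cnj (\<tau> (x o\<^sub>L ?y)) = \<tau> (adj ?y o\<^sub>L adj x)"
    using tau_adj[OF M_compose[OF x N_M[OF yN]]] adj_compose[of x ?y] M_bop[OF x] M_bop[OF N_M[OF yN]]
    by simp
  finally have 2: "\<tau> (adj ?y o\<^sub>L adj (E x)) = \<tau> (adj ?y o\<^sub>L adj x)" .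
  have "adj ?y o\<^sub>L ?y = (adj ?y o\<^sub>L E (adj x)) - (adj ?y o\<^sub>L adj (E x))"
    by (rule blinfun_eqI) (simp add: blinfun.diff_left blinfun.diff_right)
  then have "\<tau> (adj ?y o\<^sub>L ?y) = 0"
    using 1 2 by (simp add: tau_diff M_compose N_M[OF aN] E_M M_adj x)
  then have "?y = 0" by (intro tau_faithful N_M[OF yN])
  then show ?thesis by simp
qed

abbreviation e where "e \<equiv> jones_projection N \<pi> \<Omega>"

lemma closed_csubspace_L2N: "closed (closure ((\<lambda>y. \<pi> y \<Omega>) ` N))" "csubspace (closure ((\<lambda>y. \<pi> y \<Omega>) ` N))"
proof -
  have "csubspace ((\<lambda>y. \<pi> y \<Omega>) ` N)"
    by (rule csubspace_image[OF N_csubspace])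
      (simp add: clinear_map_on_def rep_add rep_scaleC N_M blinfun.add_left scaleC_blinfun_apply)
  then show "csubspace (closure ((\<lambda>y. \<pi> y \<Omega>) ` N))" by (rule csubspace_closure)
qed simp

lemma is_projection_jones: "is_projection e"
  unfolding jones_projection_def by (rule is_projection_projection_onto[OF closed_csubspace_L2N])

lemmas jones_bop = is_projection_apply(1)[OF is_projection_jones]
lemmas jones_selfadjoint = is_projection_apply(3)[OF is_projection_jones]

text \<open>For y in N the trace does not distinguish \<open>adj y o\<^sub>L E x\<close> from
  \<open>adj y o\<^sub>L x\<close>, so x - E x is orthogonal to L^2(N).\<close>

lemma jones_apply:
  assumes x: "x \<in> M" shows "e (\<pi> x \<Omega>) = \<pi> (E x) \<Omega>"
  unfolding jones_projection_def
proof (rule projection_onto_eqI[OF closed_csubspace_L2N])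
  show "\<pi> (E x) \<Omega> \<in> closure ((\<lambda>y. \<pi> y \<Omega>) ` N)" using E_N[OF x] by (intro subsetD[OF closure_subset] imageI)
  fix t assume t: "t \<in> closure ((\<lambda>y. \<pi> y \<Omega>) ` N)"
  show "cinner (\<pi> x \<Omega> - \<pi> (E x) \<Omega>) t = 0"
  proof (rule orthogonal_closure[OF _ t])
    fix s assume "s \<in> (\<lambda>y. \<pi> y \<Omega>) ` N"
    then obtain y where y: "y \<in> N" "s = \<pi> y \<Omega>" by auto
    have "\<tau> (adj y o\<^sub>L E x) = \<tau> (adj y o\<^sub>L x)"
      using E_left[OF x N_adj[OF y(1)]] E_trace[OF M_compose[OF N_M[OF N_adj[OF y(1)]] x]] by simp
    then show "cinner (\<pi> x \<Omega> - \<pi> (E x) \<Omega>) s = 0"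
      by (simp add: cinner_diff_left rep_inner y x E_M N_M)
  qed
qed

lemma jones_vector: "e \<Omega> = \<Omega>"
  using jones_apply[OF M_id] E_fix[OF N_id] by (simp add: rep_id)

lemma jones_commute: "y \<in> N \<Longrightarrow> e (\<pi> y h) = \<pi> y (e h)"
proof -
  assume y: "y \<in> N"
  have "e o\<^sub>L \<pi> y = \<pi> y o\<^sub>L e"
  proof (rule rep_dense_eqI)
    show "clinear_op (e o\<^sub>L \<pi> y)" "clinear_op (\<pi> y o\<^sub>L e)"
      by (simp_all add: bop_iff[symmetric] bop_compose jones_bop rep_bop N_M y)
    fix x assume x: "x \<in> M"
    show "(e o\<^sub>L \<pi> y) (\<pi> x \<Omega>) = (\<pi> y o\<^sub>L e) (\<pi> x \<Omega>)"
      by (simp add: jones_apply M_compose N_M y x E_left rep_vector E_M)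
  qed
  then show ?thesis by (metis blinfun_apply_blinfun_compose)
qed

lemma jones_compress: "x \<in> M \<Longrightarrow> e (\<pi> x (e h)) = \<pi> (E x) (e h)"
proof -
  assume x: "x \<in> M"
  have "e o\<^sub>L (\<pi> x o\<^sub>L e) = \<pi> (E x) o\<^sub>L e"
  proof (rule rep_dense_eqI)
    show "clinear_op (e o\<^sub>L (\<pi> x o\<^sub>L e))" "clinear_op (\<pi> (E x) o\<^sub>L e)"
      by (simp_all add: bop_iff[symmetric] bop_compose jones_bop rep_bop x E_M)
    fix z assume z: "z \<in> M"
    show "(e o\<^sub>L (\<pi> x o\<^sub>L e)) (\<pi> z \<Omega>) = (\<pi> (E x) o\<^sub>L e) (\<pi> z \<Omega>)"
      by (simp add: jones_apply M_compose z x E_right E_N rep_vector E_M)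
  qed
  then show ?thesis by (metis blinfun_apply_blinfun_compose)
qed

text \<open>e fixes \<Omega>, so e x = 0 makes \<open>adj x\<close> annihilate \<Omega>, which is
  separating. This recovers \<Psi>(z) from e \<Psi>(z).\<close>

lemma jones_separating: "x \<in> M \<Longrightarrow> (\<And>h. e (\<pi> x h) = 0) \<Longrightarrow> x = 0"
proof -
  assume x: "x \<in> M" and 0: "\<And>h. e (\<pi> x h) = 0"
  have "cinner (\<pi> (adj x) \<Omega>) h = 0" for h
  proof -
    have "cinner (\<pi> (adj x) \<Omega>) h = cinner (e \<Omega>) (\<pi> x h)"
      by (simp add: rep_adj x cinner_adj_left rep_bop jones_vector)
    also have "\<dots> = 0" by (simp add: jones_selfadjoint 0)
    finally show ?thesis .
  qed
  then have "\<pi> (adj x) \<Omega> = 0" using cinner_self_eq_zero by blast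
  then have "adj x = 0" using rep_separating M_adj x by blast
  then have "adj (adj x) = adj (0 :: 'h \<Rightarrow>\<^sub>L 'h)" by simp
  moreover have "adj (0 :: 'h \<Rightarrow>\<^sub>L 'h) = 0" by (rule adj_eqI) simp_all
  ultimately show "x = 0" using adj_adj[OF M_bop[OF x]] by simp
qed

end

section \<open>The tower\<close>

locale jones_tower =
  trace_expectation M \<tau> \<pi> \<Omega> N E + up: trace_expectation M1 \<tau>1 \<pi>1 \<Omega>1 "\<pi> ` M" E1
  for M N :: "('k::chilbert_space \<Rightarrow>\<^sub>L 'k) set" and \<tau> and \<pi> :: "('k \<Rightarrow>\<^sub>L 'k) \<Rightarrow> ('h::chilbert_space \<Rightarrow>\<^sub>L 'h)"
    and \<Omega> E and M1 :: "('h \<Rightarrow>\<^sub>L 'h) set" and \<tau>1 and \<pi>1 :: "('h \<Rightarrow>\<^sub>L 'h) \<Rightarrow> ('g::chilbert_space \<Rightarrow>\<^sub>L 'g)"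
    and \<Omega>1 E1 +
  fixes lam :: real and m :: nat and \<eta> :: "nat \<Rightarrow> 'k \<Rightarrow>\<^sub>L 'k"
  assumes M1_def: "M1 = basic_construction N M \<pi> \<Omega>"
    and lam_pos: "lam > 0" and E1_jones: "E1 e = lam *\<^sub>R id_blinfun"
    and basis: "pimsner_popa_basis M E m \<eta>"
begin

lemma gen_bop: "insert e (\<pi> ` M) \<subseteq> bop"
  using jones_bop rep_bop by auto

lemma e_M1: "e \<in> M1" and rep_M1: "x \<in> M \<Longrightarrow> \<pi> x \<in> M1"
  using vna_generated_superset[OF gen_bop] by (auto simp: M1_def basic_construction_def)

lemma eta_M: "j \<in> {1..m} \<Longrightarrow> \<eta> j \<in> M"
  and basis_expand: "x \<in> M \<Longrightarrow> (\<Sum>j=1..m. E (x o\<^sub>L adj (\<eta> j)) o\<^sub>L \<eta> j) = x"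
  using basis by (auto simp: pimsner_popa_basis_def)

lemma M_adj_sum: "(\<And>i. i \<in> I \<Longrightarrow> f i \<in> M) \<Longrightarrow> adj (\<Sum>i\<in>I. f i) = (\<Sum>i\<in>I. adj (f i))"
proof (induction I rule: infinite_finite_induct)
  case (insert i I)
  then show ?case by (simp add: adj_add M_bop M_sum)
qed (auto intro: adj_eqI)

lemma basis_expand_adj:
  assumes x: "x \<in> M" shows "(\<Sum>j=1..m. adj (\<eta> j) o\<^sub>L E (\<eta> j o\<^sub>L x)) = x"
proof -
  have "adj (adj x) = (\<Sum>j=1..m. adj (E (adj x o\<^sub>L adj (\<eta> j)) o\<^sub>L \<eta> j))"
    using arg_cong[OF basis_expand[OF M_adj[OF x]], of adj]
    by (subst (asm) M_adj_sum) (simp_all add: M_intros E_M x eta_M)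
  also have "\<dots> = (\<Sum>j=1..m. adj (\<eta> j) o\<^sub>L E (\<eta> j o\<^sub>L x))"
  proof (rule sum.cong[OF refl])
    fix j assume j: "j \<in> {1..m}"
    have "adj x o\<^sub>L adj (\<eta> j) = adj (\<eta> j o\<^sub>L x)"
      by (simp add: adj_compose M_bop eta_M[OF j] x)
    then have "E (adj x o\<^sub>L adj (\<eta> j)) = adj (E (\<eta> j o\<^sub>L x))"
      using E_adj[OF M_compose[OF eta_M[OF j] x]] by simp
    moreover have "E (\<eta> j o\<^sub>L x) \<in> bop" by (intro M_bop E_M M_compose eta_M[OF j] x)
    ultimately show "adj (E (adj x o\<^sub>L adj (\<eta> j)) o\<^sub>L \<eta> j) = adj (\<eta> j) o\<^sub>L E (\<eta> j o\<^sub>L x)"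
      using M_bop[OF eta_M[OF j]] by (simp add: adj_compose adj_bop adj_adj)
  qed
  finally show ?thesis by (simp add: adj_adj M_bop x)
qed

text \<open>A partition of unity built from the basis. It puts \<Omega>1 into the span of the
  vectors \<open>vec x y\<close>, and it reduces an identity between operators V to the identities
  for e \<eta>_j V.\<close>

lemma basis_resolution: "(\<Sum>j=1..m. \<pi> (adj (\<eta> j)) (e (\<pi> (\<eta> j) h))) = h"
proof -
  let ?S = "\<Sum>j=1..m. \<pi> (adj (\<eta> j)) o\<^sub>L (e o\<^sub>L \<pi> (\<eta> j))"
  have "?S = id_blinfun"
  proof (rule rep_dense_eqI)
    have "?S \<in> bop"
      by (intro csubspace_sum[OF csubspace_bop] bop_compose jones_bop rep_bop)
        (simp_all add: eta_M M_adj)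
    then show "clinear_op ?S" by (simp add: bop_iff)
    show "clinear_op id_blinfun" by (simp add: clinear_op_def)
    fix x assume x: "x \<in> M"
    have "\<pi> (adj (\<eta> j)) (e (\<pi> (\<eta> j) (\<pi> x \<Omega>))) = \<pi> (adj (\<eta> j) o\<^sub>L E (\<eta> j o\<^sub>L x)) \<Omega>"
      if j: "j \<in> {1..m}" for j
      using eta_M[OF j] x by (simp add: jones_apply rep_vector M_intros E_M)
    then have "?S (\<pi> x \<Omega>)
        = (\<Sum>j=1..m. \<pi> (adj (\<eta> j) o\<^sub>L E (\<eta> j o\<^sub>L x))) \<Omega>"
      by (simp add: blinfun.sum_left)
    also have "(\<Sum>j=1..m. \<pi> (adj (\<eta> j) o\<^sub>L E (\<eta> j o\<^sub>L x))) = \<pi> (\<Sum>j=1..m. adj (\<eta> j) o\<^sub>L E (\<eta> j o\<^sub>L x))"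
      by (rule rep_sum[symmetric]) (simp add: M_intros E_M eta_M x)
    finally show "?S (\<pi> x \<Omega>) = id_blinfun (\<pi> x \<Omega>)"
      by (simp add: basis_expand_adj x del: One_nat_def)
  qed
  then have "?S h = h" by simp
  then show ?thesis by (simp add: blinfun.sum_left)
qed

definition vec where "vec x y = \<pi>1 (\<pi> x o\<^sub>L e o\<^sub>L \<pi> y) \<Omega>1"

lemma vec_M1: "x \<in> M \<Longrightarrow> y \<in> M \<Longrightarrow> \<pi> x o\<^sub>L e o\<^sub>L \<pi> y \<in> M1"
  by (intro up.M_compose e_M1 rep_M1)

lemma adj_e: "adj e = e"
  using is_projection_jones by (simp add: is_projection_def)

lemma rep_vec: "z \<in> M \<Longrightarrow> x \<in> M \<Longrightarrow> y \<in> M \<Longrightarrow> \<pi>1 (\<pi> z) (vec x y) = vec (z o\<^sub>L x) y"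
  unfolding vec_def
  by (simp add: up.rep_vector[OF rep_M1 vec_M1]) (simp add: rep_compose blinfun_compose_assoc)

lemma e_vec: "x \<in> M \<Longrightarrow> y \<in> M \<Longrightarrow> \<pi>1 e (vec x y) = vec (E x) y"
proof -
  assume xy: "x \<in> M" "y \<in> M"
  have "e o\<^sub>L (\<pi> x o\<^sub>L e o\<^sub>L \<pi> y) = \<pi> (E x) o\<^sub>L e o\<^sub>L \<pi> y"
    by (rule blinfun_eqI) (simp add: jones_compress xy)
  moreover have "\<pi>1 e (vec x y) = \<pi>1 (e o\<^sub>L (\<pi> x o\<^sub>L e o\<^sub>L \<pi> y)) \<Omega>1"
    unfolding vec_def up.rep_compose[OF e_M1 vec_M1[OF xy]] by simp
  ultimately show ?thesis by (simp add: vec_def)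
qed

text \<open>The projection \<open>P\<close> onto the closed span of the vectors \<open>x e\<^sub>1 y \<Omega>\<^sub>1\<close> commutes with \<open>\<pi>\<^sub>1(M)\<close> and
  \<open>\<pi>\<^sub>1(e\<^sub>1)\<close>. Compressed by intertwiners it becomes an operator on \<open>L\<^sup>2(M)\<close> in the commutant of
  \<open>M\<^sub>1\<close>; since intertwiners are total, \<open>P\<close> itself commutes with \<open>\<pi>\<^sub>1(M\<^sub>1)\<close>.\<close>

theorem vec_total: "closure (cspan {vec x y | x y. x \<in> M \<and> y \<in> M}) = UNIV"
proof -
  let ?X = "{vec x y | x y. x \<in> M \<and> y \<in> M}"
  define G where "G = closure (cspan ?X)"
  have G: "closed G" "csubspace G" by (simp_all add: G_def csubspace_closure csubspace_cspan)
  have vecG: "vec x y \<in> G" if "x \<in> M" "y \<in> M" for x y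
    unfolding G_def using that by (intro closure_cspan_superset) blast
  define P where "P = projection_onto G"
  have P: "is_projection P" "ran P = G"
    unfolding P_def using is_projection_projection_onto[OF G] range_projection_onto[OF G] by auto
  let ?T = "insert e (\<pi> ` M)"
  have TM1: "t \<in> M1" if "t \<in> ?T" for t using that e_M1 rep_M1 by auto
  have Tadj: "adj t \<in> ?T" if "t \<in> ?T" for t
    using that adj_e rep_adj[symmetric] M_adj by auto
  have inv: "\<pi>1 t v \<in> G" if t: "t \<in> ?T" and v: "v \<in> G" for t v
  proof (rule invariant_closure_cspan[OF up.rep_clinear_op[OF TM1[OF t]] G])
    show "v \<in> closure (cspan ?X)" using v by (simp add: G_def)
    fix u assume "u \<in> ?X"
    then obtain x y where xy: "x \<in> M" "y \<in> M" "u = vec x y" by blast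
    show "\<pi>1 t u \<in> G"
    proof (cases "t = e")
      case True
      then show ?thesis using xy by (simp add: e_vec vecG E_M)
    next
      case False
      then obtain z where "z \<in> M" "t = \<pi> z" using t by auto
      then show ?thesis using xy by (simp add: rep_vec vecG M_compose)
    qed
  qed
  have comm: "P (\<pi>1 t v) = \<pi>1 t (P v)" if t: "t \<in> ?T" for t v
    unfolding P_def
  proof (rule projection_onto_commute[OF G up.rep_bop[OF TM1[OF t]]])
    show "\<pi>1 t x \<in> G" if "x \<in> G" for x using inv t that by blast
    show "adj (\<pi>1 t) x \<in> G" if "x \<in> G" for x
      using inv[OF Tadj[OF t] that] by (simp add: up.rep_adj TM1[OF t])
  qed
  have key: "cinner (P (\<pi>1 s (W h)) - \<pi>1 s (P (W h))) (W' k) = 0"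
    if s: "s \<in> M1" and W: "up.intertwiner W" and W': "up.intertwiner W'" for s W W' h k
  proof -
    obtain U where U: "clinear_op U" "\<And>x y. cinner (W' x) y = cinner x (U y)"
      using adjoint_exists[of W'] W' unfolding up.intertwiner_def by blast
    have Uc: "cinner (U y) x = cinner y (W' x)" for x y by (rule cinner_swap) (simp add: U(2))
    have Us: "U (\<pi>1 t v) = t (U v)" if t: "t \<in> M1" for t v
    proof (rule cinner_ext)
      fix k
      have "cinner (U (\<pi>1 t v)) k = cinner v (\<pi>1 (adj t) (W' k))"
        by (simp add: Uc up.rep_adj t cinner_adj_right up.rep_bop)
      also have "\<pi>1 (adj t) (W' k) = W' (adj t k)"
        using W' up.M_adj[OF t] by (simp add: up.intertwiner_def)
      also have "cinner v (W' (adj t k)) = cinner (t (U v)) k"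
        by (simp add: Uc[symmetric] cinner_adj_right up.M_bop t)
      finally show "cinner (U (\<pi>1 t v)) k = cinner (t (U v)) k" .
    qed
    \<comment> \<open>U, the adjoint of W', intertwines in the opposite direction. So R acts on
      L^2(M) and commutes with the generators of M1 because P does.\<close>
    define R where "R = U o\<^sub>L P o\<^sub>L W"
    have Wi: "W (t h) = \<pi>1 t (W h)" if "t \<in> M1" for t h using W that by (simp add: up.intertwiner_def)
    have Rb: "R \<in> bop"
      using U(1) is_projection_apply(1)[OF P(1)] W
      by (simp add: R_def bop_def clinear_op_def up.intertwiner_def)
    have "R \<in> commutant (?T \<union> adj ` ?T)"
    proof (rule commutantI[OF Rb])
      fix t h assume "t \<in> ?T \<union> adj ` ?T"
      then have t: "t \<in> ?T" using Tadj by blast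
      show "R (t h) = t (R h)"
        by (simp add: R_def Wi[OF TM1[OF t]] comm[OF t] Us[OF TM1[OF t]])
    qed
    moreover have "s \<in> commutant (commutant (?T \<union> adj ` ?T))"
      using s by (simp add: M1_def basic_construction_def vna_generated_def)
    ultimately have "s (R h) = R (s h)" by (rule commutantD[rotated])
    then have "U (P (\<pi>1 s (W h)) - \<pi>1 s (P (W h))) = 0"
      by (simp add: R_def Wi[OF s] Us[OF s] blinfun.diff_right)
    then show ?thesis using Uc[of "P (\<pi>1 s (W h)) - \<pi>1 s (P (W h))" k] by simp
  qed
  let ?Y = "{blinfun_apply W h | W h. up.intertwiner W}"
  have total: "v \<in> closure (cspan ?Y)" for v using up.intertwiners_total by simp
  have PG: "\<pi>1 s \<Omega>1 \<in> G" if s: "s \<in> M1" for s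
  proof -
    have W0: "P (\<pi>1 s (W h)) - \<pi>1 s (P (W h)) = 0" if W: "up.intertwiner W" for W h
    proof -
      let ?v = "P (\<pi>1 s (W h)) - \<pi>1 s (P (W h))"
      have "cinner ?v ?v = 0"
        by (rule orthogonal_closure_cspan[OF _ total]) (use key[OF s W] in blast)
      then show ?thesis by simp
    qed
    have "(P o\<^sub>L \<pi>1 s) \<Omega>1 = (\<pi>1 s o\<^sub>L P) \<Omega>1"
    proof (rule eq_on_closure_cspan[OF _ _ _ total])
      show "clinear_op (P o\<^sub>L \<pi>1 s)" "clinear_op (\<pi>1 s o\<^sub>L P)"
        using bop_compose is_projection_apply(1)[OF P(1)] up.rep_bop[OF s] by (simp_all add: bop_iff[symmetric])
      show "(P o\<^sub>L \<pi>1 s) x = (\<pi>1 s o\<^sub>L P) x" if "x \<in> ?Y" for x using that W0 by auto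
    qed
    \<comment> \<open>Apply \<pi>1 to the partition of unity of \<open>basis_resolution\<close>;
      every summand is one of the spanning vectors.\<close>
    moreover have "\<Omega>1 \<in> G"
    proof -
      have "(\<Sum>j=1..m. \<pi> (adj (\<eta> j)) o\<^sub>L e o\<^sub>L \<pi> (\<eta> j)) = id_blinfun"
        by (rule blinfun_eqI) (simp add: blinfun.sum_left basis_resolution del: One_nat_def)
      then have "\<Omega>1 = \<pi>1 (\<Sum>j=1..m. \<pi> (adj (\<eta> j)) o\<^sub>L e o\<^sub>L \<pi> (\<eta> j)) \<Omega>1"
        by (simp add: up.rep_id)
      also have "\<dots> = (\<Sum>j=1..m. vec (adj (\<eta> j)) (\<eta> j))"
        by (subst up.rep_sum) (simp_all add: vec_M1 M_adj eta_M blinfun.sum_left vec_def)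
      also have "\<dots> \<in> G" by (intro csubspace_sum[OF G(2)] vecG M_adj eta_M)
      finally show ?thesis .
    qed
    ultimately have "P (\<pi>1 s \<Omega>1) = \<pi>1 s \<Omega>1"
      using is_projection_range_iff[OF P(1)] P(2) by simp
    then show ?thesis using P(2) by (metis rangeI)
  qed
  then have "closure ((\<lambda>s. \<pi>1 s \<Omega>1) ` M1) \<subseteq> G" using G(1) by (intro closure_minimal) auto
  then show ?thesis using up.rep_dense by (auto simp: G_def)
qed

end

section \<open>Fourier multipliers\<close>

lemma bimodule_mapD:
  assumes "bimodule_map N M \<Psi>" "id_blinfun \<in> N"
  shows "x \<in> M \<Longrightarrow> \<Psi> x \<in> M" "x \<in> M \<Longrightarrow> y \<in> M \<Longrightarrow> \<Psi> (x + y) = \<Psi> x + \<Psi> y"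
    "x \<in> M \<Longrightarrow> \<Psi> (c *\<^sub>C x) = c *\<^sub>C \<Psi> x" "x \<in> M \<Longrightarrow> y \<in> N \<Longrightarrow> \<Psi> (y o\<^sub>L x) = y o\<^sub>L \<Psi> x"
    "x \<in> M \<Longrightarrow> y \<in> N \<Longrightarrow> \<Psi> (x o\<^sub>L y) = \<Psi> x o\<^sub>L y"
proof -
  have *: "\<Psi> (y1 o\<^sub>L x o\<^sub>L y2) = y1 o\<^sub>L \<Psi> x o\<^sub>L y2" if "x \<in> M" "y1 \<in> N" "y2 \<in> N" for x y1 y2
    using assms(1) that by (simp add: bimodule_map_def)
  show "x \<in> M \<Longrightarrow> y \<in> N \<Longrightarrow> \<Psi> (y o\<^sub>L x) = y o\<^sub>L \<Psi> x" "x \<in> M \<Longrightarrow> y \<in> N \<Longrightarrow> \<Psi> (x o\<^sub>L y) = \<Psi> x o\<^sub>L y"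
    using *[of x y id_blinfun] *[of x id_blinfun y] assms(2) by simp_all
qed (use assms(1) in \<open>auto simp: bimodule_map_def clinear_map_on_def\<close>)

lemma bimodule_map_funpow:
  assumes "bimodule_map N M \<Phi>" "id_blinfun \<in> N" "csubspace M"
    "\<And>x y. x \<in> M \<Longrightarrow> y \<in> N \<Longrightarrow> y o\<^sub>L x \<in> M" "\<And>x y. x \<in> M \<Longrightarrow> y \<in> N \<Longrightarrow> x o\<^sub>L y \<in> M"
  shows "bimodule_map N M (\<Phi> ^^ k)"
proof (induction k)
  case 0
  show ?case by (simp add: bimodule_map_def clinear_map_on_def)
next
  case (Suc k)
  note S = bimodule_mapD[OF Suc assms(2)] and D = bimodule_mapD[OF assms(1,2)]
  have "(\<Phi> ^^ k) (y1 o\<^sub>L x o\<^sub>L y2) = y1 o\<^sub>L (\<Phi> ^^ k) x o\<^sub>L y2"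
    "\<Phi> (y1 o\<^sub>L x o\<^sub>L y2) = y1 o\<^sub>L \<Phi> x o\<^sub>L y2" if "x \<in> M" "y1 \<in> N" "y2 \<in> N" for x y1 y2
    using Suc assms(1) that by (auto simp: bimodule_map_def)
  then show ?case using S D by (auto simp: bimodule_map_def clinear_map_on_def)
qed

context jones_tower
begin

lemmas bimodD = bimodule_mapD[OF _ N_id]

lemma bimodule_map_sum:
  assumes "bimodule_map N M \<Psi>" "finite I" "\<And>i. i \<in> I \<Longrightarrow> f i \<in> M"
  shows "\<Psi> (\<Sum>i\<in>I. f i) = (\<Sum>i\<in>I. \<Psi> (f i))"
  using assms(2,3)
proof (induction rule: finite_induct)
  case empty
  then show ?case
    using bimodD(3)[OF assms(1) M_linear(1), of 0] by simp
next
  case (insert i I)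
  then show ?case by (simp add: bimodD(2)[OF assms(1)] M_sum)
qed

lemma bimodule_map_expand:
  assumes \<Psi>: "bimodule_map N M \<Psi>" and z: "z \<in> M"
  shows "(\<Sum>j=1..m. E (z o\<^sub>L adj (\<eta> j)) o\<^sub>L \<Psi> (\<eta> j)) = \<Psi> z"
proof -
  have "\<Psi> z = \<Psi> (\<Sum>j=1..m. E (z o\<^sub>L adj (\<eta> j)) o\<^sub>L \<eta> j)" by (subst basis_expand[OF z]) simp
  also have "\<dots> = (\<Sum>j=1..m. \<Psi> (E (z o\<^sub>L adj (\<eta> j)) o\<^sub>L \<eta> j))"
    by (rule bimodule_map_sum[OF \<Psi>]) (simp_all add: M_intros E_M eta_M z)
  also have "\<dots> = (\<Sum>j=1..m. E (z o\<^sub>L adj (\<eta> j)) o\<^sub>L \<Psi> (\<eta> j))"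
    by (intro sum.cong refl bimodD(4)[OF \<Psi> eta_M]
        E_N[OF M_compose[OF z M_adj[OF eta_M]]])
  finally show ?thesis by (rule sym)
qed

text \<open>The element V of the overview. It is the analogue of a Choi matrix, with the basis in
  place of matrix units and e in place of the rank-one projection.\<close>

definition choi where "choi \<Psi> = (\<Sum>j=1..m. \<pi> (adj (\<eta> j)) o\<^sub>L e o\<^sub>L \<pi> (\<Psi> (\<eta> j)))"

lemma choi_apply: "choi \<Psi> h = (\<Sum>j=1..m. \<pi> (adj (\<eta> j)) (e (\<pi> (\<Psi> (\<eta> j)) h)))"
  by (simp add: choi_def blinfun.sum_left)

lemma choi_M1:
  assumes \<Psi>: "bimodule_map N M \<Psi>" shows "choi \<Psi> \<in> M1"
  unfolding choi_def
  by (intro up.M_sum vec_M1 M_adj eta_M bimodD(1)[OF \<Psi>])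

lemma rep_apply: "x \<in> M \<Longrightarrow> y \<in> M \<Longrightarrow> \<pi> x (\<pi> y h) = \<pi> (x o\<^sub>L y) h"
  by (simp add: rep_compose)

lemma rep_sum_apply: "(\<And>i. i \<in> I \<Longrightarrow> f i \<in> M) \<Longrightarrow> (\<Sum>i\<in>I. \<pi> (f i) h) = \<pi> (\<Sum>i\<in>I. f i) h"
  by (simp add: rep_sum blinfun.sum_left)

lemma choi_jones:
  assumes \<Psi>: "bimodule_map N M \<Psi>" and z: "z \<in> M"
  shows "e (\<pi> z (choi \<Psi> h)) = e (\<pi> (\<Psi> z) h)"
proof -
  note D = bimodD[OF \<Psi>]
  have "e (\<pi> z (\<pi> (adj (\<eta> j)) (e (\<pi> (\<Psi> (\<eta> j)) h))))
      = e (\<pi> (E (z o\<^sub>L adj (\<eta> j)) o\<^sub>L \<Psi> (\<eta> j)) h)" if j: "j \<in> {1..m}" for j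
  proof -
    have zj: "z o\<^sub>L adj (\<eta> j) \<in> M" by (intro M_compose M_adj eta_M[OF j] z)
    have "e (\<pi> z (\<pi> (adj (\<eta> j)) (e (\<pi> (\<Psi> (\<eta> j)) h))))
        = \<pi> (E (z o\<^sub>L adj (\<eta> j))) (e (\<pi> (\<Psi> (\<eta> j)) h))"
      by (simp add: rep_apply z M_adj eta_M[OF j] jones_compress zj)
    also have "\<dots> = e (\<pi> (E (z o\<^sub>L adj (\<eta> j))) (\<pi> (\<Psi> (\<eta> j)) h))"
      by (rule jones_commute[symmetric]) (rule E_N[OF zj])
    finally show ?thesis by (simp add: rep_apply E_M zj D(1) eta_M[OF j])
  qed
  then have "e (\<pi> z (choi \<Psi> h)) = e (\<Sum>j=1..m. \<pi> (E (z o\<^sub>L adj (\<eta> j)) o\<^sub>L \<Psi> (\<eta> j)) h)"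
    by (simp add: choi_apply blinfun.sum_right)
  also have "(\<Sum>j=1..m. \<pi> (E (z o\<^sub>L adj (\<eta> j)) o\<^sub>L \<Psi> (\<eta> j)) h) = \<pi> (\<Psi> z) h"
    unfolding bimodule_map_expand[OF \<Psi> z, symmetric]
    by (intro rep_sum_apply M_compose E_M M_adj eta_M z D(1))
  finally show ?thesis .
qed

text \<open>Insert the partition of unity on the left: the coefficients are e \<eta>_i y V = e
  \<Psi>(\<eta>_i y) = e \<Psi>(\<eta>_i) y, by right N-linearity.\<close>

lemma choi_commute:
  assumes \<Psi>: "bimodule_map N M \<Psi>" and y: "y \<in> N"
  shows "\<pi> y (choi \<Psi> h) = choi \<Psi> (\<pi> y h)"
proof -
  note D = bimodD[OF \<Psi>]
  have yM: "y \<in> M" using y by (rule N_M)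
  have "\<pi> y (choi \<Psi> h) = (\<Sum>i=1..m. \<pi> (adj (\<eta> i)) (e (\<pi> (\<eta> i) (\<pi> y (choi \<Psi> h)))))"
    by (rule basis_resolution[symmetric])
  also have "\<dots> = (\<Sum>i=1..m. \<pi> (adj (\<eta> i)) (e (\<pi> (\<Psi> (\<eta> i)) (\<pi> y h))))"
  proof (rule sum.cong[OF refl])
    fix i assume i: "i \<in> {1..m}"
    have "e (\<pi> (\<eta> i) (\<pi> y (choi \<Psi> h))) = e (\<pi> (\<Psi> (\<eta> i o\<^sub>L y)) h)"
      unfolding rep_apply[OF eta_M[OF i] yM] by (rule choi_jones[OF \<Psi> M_compose[OF eta_M[OF i] yM]])
    then show "\<pi> (adj (\<eta> i)) (e (\<pi> (\<eta> i) (\<pi> y (choi \<Psi> h))))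
        = \<pi> (adj (\<eta> i)) (e (\<pi> (\<Psi> (\<eta> i)) (\<pi> y h)))"
      by (simp add: D(5) eta_M[OF i] y rep_apply D(1) yM)
  qed
  finally show ?thesis by (simp add: choi_apply)
qed

section \<open>Multipliers in the second relative commutant\<close>

definition M2 where "M2 = basic_construction (\<pi> ` M) M1 \<pi>1 \<Omega>1"
definition Q where "Q = commutant (\<pi>1 ` \<pi> ` M) \<inter> M2"
definition hat where "hat = fourier_multiplier M Q vec lam m \<eta>"

lemma M2_csubspace: "csubspace M2"
  and M2_compose: "S \<in> M2 \<Longrightarrow> T \<in> M2 \<Longrightarrow> S o\<^sub>L T \<in> M2"
  unfolding M2_def basic_construction_def vna_generated_def
  by (auto intro!: csubspace_commutant commutant_compose dest: commutant_bop)

lemma e2_M2: "up.e \<in> M2" and rep_M2: "s \<in> M1 \<Longrightarrow> \<pi>1 s \<in> M2"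
proof -
  have b: "insert up.e (\<pi>1 ` M1) \<subseteq> bop" using up.jones_bop up.rep_bop by auto
  show "up.e \<in> M2" "s \<in> M1 \<Longrightarrow> \<pi>1 s \<in> M2"
    using vna_generated_superset[OF b] by (auto simp: M2_def basic_construction_def)
qed

lemma jones2_vec:
  assumes xy: "x \<in> M" "y \<in> M"
  shows "up.e (vec x y) = lam *\<^sub>R \<pi>1 (\<pi> (x o\<^sub>L y)) \<Omega>1"
proof -
  have "E1 (\<pi> x o\<^sub>L e o\<^sub>L \<pi> y) = \<pi> x o\<^sub>L (lam *\<^sub>R id_blinfun) o\<^sub>L \<pi> y"
    using up.E_bimodule[OF e_M1, of "\<pi> x" "\<pi> y"] xy by (simp add: E1_jones)
  also have "\<dots> = of_real lam *\<^sub>C \<pi> (x o\<^sub>L y)"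
    by (rule blinfun_eqI)
      (simp add: rep_compose xy scaleR_scaleC scaleC_blinfun_apply bopD[OF rep_bop[OF xy(1)]])
  finally show ?thesis
    by (simp add: vec_def up.jones_apply vec_M1 xy up.rep_scaleC rep_M1 M_compose
        scaleC_blinfun_apply scaleR_scaleC)
qed

text \<open>With \<open>V = choi \<Psi>\<close>, this operator maps \<open>x e\<^sub>1 y \<Omega>\<^sub>1\<close> to a multiple of
  \<open>\<Sum>\<^sub>i \<eta>\<^sub>i\<^sup>* V E(\<eta>\<^sub>i x) y \<Omega>\<^sub>1 = x V y \<Omega>\<^sub>1\<close>, because \<open>e\<^sub>2 x e\<^sub>1 y \<Omega>\<^sub>1 = \<lambda> x y \<Omega>\<^sub>1\<close> and \<open>V\<close> commutes with \<open>N\<close>.\<close>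

definition multiplier where
  "multiplier \<Psi> = (lam powr (- 3 / 2)) *\<^sub>R
     (\<Sum>i=1..m. \<pi>1 (\<pi> (adj (\<eta> i)) o\<^sub>L choi \<Psi>) o\<^sub>L up.e o\<^sub>L \<pi>1 (e o\<^sub>L \<pi> (\<eta> i)))"

lemma multiplier_vec:
  assumes \<Psi>: "bimodule_map N M \<Psi>" and xy: "x \<in> M" "y \<in> M"
  shows "multiplier \<Psi> (vec x y) = (lam powr (- 1 / 2)) *\<^sub>R \<pi>1 (\<pi> x o\<^sub>L choi \<Psi> o\<^sub>L \<pi> y) \<Omega>1"
proof -
  let ?L = "\<lambda>i. \<pi>1 (\<pi> (adj (\<eta> i)) o\<^sub>L choi \<Psi>) o\<^sub>L up.e o\<^sub>L \<pi>1 (e o\<^sub>L \<pi> (\<eta> i))"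
  let ?R = "\<lambda>i. \<pi> (adj (\<eta> i) o\<^sub>L E (\<eta> i o\<^sub>L x)) o\<^sub>L (choi \<Psi> o\<^sub>L \<pi> y)"
  note cM = choi_M1[OF \<Psi>]
  have summand: "(?L i) (vec x y)
      = lam *\<^sub>R \<pi>1 (?R i) \<Omega>1"
    if i: "i \<in> {1..m}" for i
  proof -
    note \<eta>i = eta_M[OF i]
    have \<eta>x: "\<eta> i o\<^sub>L x \<in> M" by (intro M_compose \<eta>i xy)
    have "\<pi>1 (e o\<^sub>L \<pi> (\<eta> i)) (vec x y) = vec (E (\<eta> i o\<^sub>L x)) y"
      by (simp add: up.rep_compose e_M1 rep_M1 \<eta>i rep_vec xy e_vec \<eta>x)
    then have "(?L i) (vec x y)
        = lam *\<^sub>R \<pi>1 (\<pi> (adj (\<eta> i)) o\<^sub>L choi \<Psi>) (\<pi>1 (\<pi> (E (\<eta> i o\<^sub>L x) o\<^sub>L y)) \<Omega>1)"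
      by (simp add: jones2_vec E_M \<eta>x xy blinfun.scaleR_right)
    also have "\<pi>1 (\<pi> (adj (\<eta> i)) o\<^sub>L choi \<Psi>) (\<pi>1 (\<pi> (E (\<eta> i o\<^sub>L x) o\<^sub>L y)) \<Omega>1)
        = \<pi>1 ((\<pi> (adj (\<eta> i)) o\<^sub>L choi \<Psi>) o\<^sub>L \<pi> (E (\<eta> i o\<^sub>L x) o\<^sub>L y)) \<Omega>1"
      by (rule up.rep_vector) (intro up.M_compose rep_M1 cM M_compose M_adj \<eta>i E_M xy)+
    also have "(\<pi> (adj (\<eta> i)) o\<^sub>L choi \<Psi>) o\<^sub>L \<pi> (E (\<eta> i o\<^sub>L x) o\<^sub>L y)
        = ?R i"
      by (rule blinfun_eqI)
        (simp add: rep_compose M_adj \<eta>i E_M \<eta>x xy choi_commute[OF \<Psi> E_N[OF \<eta>x], symmetric])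
    finally show ?thesis .
  qed
  have "(\<Sum>i=1..m. ?L i) (vec x y)
      = lam *\<^sub>R (\<Sum>i=1..m. \<pi>1 (?R i) \<Omega>1)"
    unfolding blinfun.sum_left scaleR_sum_right by (intro sum.cong refl summand)
  also have "(\<Sum>i=1..m. \<pi>1 (?R i) \<Omega>1)
      = \<pi>1 (\<Sum>i=1..m. ?R i) \<Omega>1"
    by (subst up.rep_sum)
      (auto simp: blinfun.sum_left intro!: up.M_compose rep_M1 cM M_compose M_adj E_M eta_M xy)
  also have "(\<Sum>i=1..m. ?R i) = \<pi> x o\<^sub>L choi \<Psi> o\<^sub>L \<pi> y"
  proof (rule blinfun_eqI)
    fix h
    have "(\<Sum>i=1..m. \<pi> (adj (\<eta> i) o\<^sub>L E (\<eta> i o\<^sub>L x)) (choi \<Psi> (\<pi> y h)))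
        = \<pi> (\<Sum>i=1..m. adj (\<eta> i) o\<^sub>L E (\<eta> i o\<^sub>L x)) (choi \<Psi> (\<pi> y h))"
      by (intro rep_sum_apply M_compose M_adj E_M eta_M xy)
    then show "(\<Sum>i=1..m. ?R i) h
        = (\<pi> x o\<^sub>L choi \<Psi> o\<^sub>L \<pi> y) h"
      by (simp add: blinfun.sum_left basis_expand_adj[OF xy(1)] del: One_nat_def)
  qed
  finally have "multiplier \<Psi> (vec x y)
      = (lam powr (- 3 / 2) * lam) *\<^sub>R \<pi>1 (\<pi> x o\<^sub>L choi \<Psi> o\<^sub>L \<pi> y) \<Omega>1"
    by (simp add: multiplier_def blinfun.scaleR_left)
  \<comment> \<open>The exponent -3/2 in \<open>multiplier\<close> anticipates the factor lam that
    the second Jones projection produces in \<open>jones2_vec\<close>.\<close>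
  also have "lam powr (- 3 / 2) * lam = lam powr (- 1 / 2)"
    using lam_pos powr_add[of lam "- 3 / 2" 1] by simp
  finally show ?thesis .
qed

lemma vec_ext:
  fixes S T :: "'g \<Rightarrow>\<^sub>L 'g"
  assumes "S \<in> bop" "T \<in> bop" "\<And>x y. x \<in> M \<Longrightarrow> y \<in> M \<Longrightarrow> S (vec x y) = T (vec x y)"
  shows "S = T"
proof (rule blinfun_eqI)
  fix g
  show "S g = T g"
  proof (rule eq_on_closure_cspan)
    show "g \<in> closure (cspan {vec x y | x y. x \<in> M \<and> y \<in> M})" by (simp add: vec_total)
  qed (use assms in \<open>auto simp: bop_iff\<close>)
qed

text \<open>Membership in M2 is visible from the formula. Commutation with M is tested on the total
  vectors: left multiplication by z only changes x in x V y \<Omega>1.\<close>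

lemma multiplier_Q:
  assumes \<Psi>: "bimodule_map N M \<Psi>" shows "multiplier \<Psi> \<in> Q"
proof -
  have M2: "multiplier \<Psi> \<in> M2"
    unfolding multiplier_def
    by (intro csubspaceD(4) csubspace_sum M2_csubspace M2_compose e2_M2 rep_M2 up.M_compose choi_M1[OF \<Psi>] e_M1 rep_M1 M_adj eta_M)
  then have b: "multiplier \<Psi> \<in> bop" by (simp add: M2_def basic_construction_def vna_generated_def commutant_bop)
  moreover have "multiplier \<Psi> \<in> commutant (\<pi>1 ` \<pi> ` M)"
  proof (rule commutantI[OF b])
    fix s g assume "s \<in> \<pi>1 ` \<pi> ` M"
    then obtain z where z: "z \<in> M" "s = \<pi>1 (\<pi> z)" by auto
    have sb: "s \<in> bop" unfolding z(2) by (intro up.rep_bop rep_M1 z(1))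
    have "multiplier \<Psi> o\<^sub>L s = s o\<^sub>L multiplier \<Psi>"
    proof (rule vec_ext[OF bop_compose[OF b sb] bop_compose[OF sb b]])
      fix x y assume xy: "x \<in> M" "y \<in> M"
      have cy: "\<pi> x o\<^sub>L choi \<Psi> o\<^sub>L \<pi> y \<in> M1" by (intro up.M_compose rep_M1 xy choi_M1[OF \<Psi>])
      have "\<pi>1 (\<pi> z) (\<pi>1 (\<pi> x o\<^sub>L choi \<Psi> o\<^sub>L \<pi> y) \<Omega>1) = \<pi>1 (\<pi> (z o\<^sub>L x) o\<^sub>L choi \<Psi> o\<^sub>L \<pi> y) \<Omega>1"
        by (simp add: up.rep_vector[OF rep_M1[OF z(1)] cy])
          (simp add: rep_compose z(1) xy blinfun_compose_assoc)
      then show "(multiplier \<Psi> o\<^sub>L s) (vec x y) = (s o\<^sub>L multiplier \<Psi>) (vec x y)"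
        by (simp add: z(2) rep_vec z(1) xy multiplier_vec[OF \<Psi>] M_compose blinfun.scaleR_right)
    qed
    then show "multiplier \<Psi> (s g) = s (multiplier \<Psi> g)"
      by (metis blinfun_apply_blinfun_compose)
  qed
  ultimately show ?thesis using M2 by (simp add: Q_def)
qed

lemma choi_vec_sum:
  assumes \<Psi>: "bimodule_map N M \<Psi>" and xy: "x \<in> M" "y \<in> M"
  shows "(\<Sum>j=1..m. vec (x o\<^sub>L adj (\<eta> j)) (\<Psi> (\<eta> j) o\<^sub>L y)) = \<pi>1 (\<pi> x o\<^sub>L choi \<Psi> o\<^sub>L \<pi> y) \<Omega>1"
proof -
  note D = bimodD[OF \<Psi>]
  have "\<pi> x o\<^sub>L choi \<Psi> o\<^sub>L \<pi> y
      = (\<Sum>j=1..m. \<pi> (x o\<^sub>L adj (\<eta> j)) o\<^sub>L e o\<^sub>L \<pi> (\<Psi> (\<eta> j) o\<^sub>L y))"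
    by (rule blinfun_eqI)
      (simp add: choi_apply blinfun.sum_left blinfun.sum_right rep_compose xy M_adj eta_M D(1))
  then show ?thesis
    by (simp add: vec_def)
      (subst up.rep_sum, auto simp: blinfun.sum_left xy M_adj eta_M D(1)
        intro!: up.M_compose rep_M1 e_M1 M_compose)
qed

text \<open>Discharges the definite description: \<open>multiplier\<close> gives existence, totality
  of the vectors gives uniqueness.\<close>

lemma hat_eq_multiplier:
  assumes \<Psi>: "bimodule_map N M \<Psi>" shows "hat \<Psi> = multiplier \<Psi>"
  unfolding hat_def fourier_multiplier_def
proof (rule the_equality)
  let ?F = "\<lambda>x y. (lam powr (- 1 / 2)) *\<^sub>R (\<Sum>j=1..m. vec (x o\<^sub>L adj (\<eta> j)) (\<Psi> (\<eta> j) o\<^sub>L y))"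
  have *: "multiplier \<Psi> (vec x y) = ?F x y"
    if "x \<in> M" "y \<in> M" for x y
    using that by (simp only: multiplier_vec[OF \<Psi>] choi_vec_sum[OF \<Psi>])
  then show "multiplier \<Psi> \<in> Q \<and> (\<forall>x\<in>M. \<forall>y\<in>M. multiplier \<Psi> (vec x y) = ?F x y)"
    using multiplier_Q[OF \<Psi>] by blast
  fix T assume T: "T \<in> Q \<and> (\<forall>x\<in>M. \<forall>y\<in>M. T (vec x y) = ?F x y)"
  have Qb: "T \<in> bop" if "T \<in> Q" for T using that commutant_bop by (auto simp: Q_def)
  show "T = multiplier \<Psi>"
    using T * Qb multiplier_Q[OF \<Psi>] by (intro vec_ext) auto
qed

lemma hat_Q: "bimodule_map N M \<Psi> \<Longrightarrow> hat \<Psi> \<in> Q"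
  by (simp add: hat_eq_multiplier multiplier_Q)

text \<open>At the vector e \<Omega>1 the relation says that the combination of the elements V kills
  \<Omega>1, hence vanishes. Then e z V = e \<Psi>(z) carries it to the maps. Linear combinations at
  points of M are used because values outside M are arbitrary.\<close>

lemma hat_linear_injective:
  assumes \<Psi>: "\<And>i. i \<in> I \<Longrightarrow> bimodule_map N M (\<Psi> i)" and I: "finite I"
    and zero: "(\<Sum>i\<in>I. c i *\<^sub>C hat (\<Psi> i)) = 0" and z: "z \<in> M"
  shows "(\<Sum>i\<in>I. c i *\<^sub>C \<Psi> i z) = 0"
proof -
  let ?k = "lam powr (- 1 / 2)"
  have D: "\<And>i. i \<in> I \<Longrightarrow> \<Psi> i z \<in> M" using bimodD(1)[OF \<Psi> z] .
  have cM: "\<And>i. i \<in> I \<Longrightarrow> choi (\<Psi> i) \<in> M1" using choi_M1[OF \<Psi>] .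
  have "0 = (\<Sum>i\<in>I. c i *\<^sub>C hat (\<Psi> i)) (vec id_blinfun id_blinfun)" by (simp add: zero)
  also have "\<dots> = (\<Sum>i\<in>I. c i *\<^sub>C ?k *\<^sub>R \<pi>1 (choi (\<Psi> i)) \<Omega>1)"
    unfolding scaleC_sum_left_apply
    by (intro sum.cong refl arg_cong[where f = "scaleC _"])
      (simp add: hat_eq_multiplier \<Psi> multiplier_vec M_id rep_id)
  also have "\<dots> = ?k *\<^sub>R (\<Sum>i\<in>I. \<pi>1 (c i *\<^sub>C choi (\<Psi> i)) \<Omega>1)"
    unfolding scaleR_sum_right
    by (intro sum.cong refl) (simp add: scaleC_scaleR_commute up.rep_scaleC cM scaleC_blinfun_apply)
  also have "\<dots> = ?k *\<^sub>R \<pi>1 (\<Sum>i\<in>I. c i *\<^sub>C choi (\<Psi> i)) \<Omega>1"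
    by (subst up.rep_sum) (auto simp: blinfun.sum_left intro!: up.M_linear cM)
  finally have "\<pi>1 (\<Sum>i\<in>I. c i *\<^sub>C choi (\<Psi> i)) \<Omega>1 = 0" using lam_pos by simp
  then have choi0: "(\<Sum>i\<in>I. c i *\<^sub>C choi (\<Psi> i)) = 0"
    by (rule up.rep_separating[rotated]) (intro up.M_sum up.M_linear cM)
  show ?thesis
  proof (rule jones_separating)
    show "(\<Sum>i\<in>I. c i *\<^sub>C \<Psi> i z) \<in> M" by (intro M_sum M_linear D)
    fix h
    have "e (\<pi> (\<Sum>i\<in>I. c i *\<^sub>C \<Psi> i z) h) = (\<Sum>i\<in>I. c i *\<^sub>C e (\<pi> (\<Psi> i z) h))"
      by (subst rep_sum)
        (auto simp: blinfun.sum_left blinfun.sum_right rep_scaleC D scaleC_blinfun_apply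
          bopD[OF jones_bop] intro!: M_linear D)
    also have "\<dots> = (\<Sum>i\<in>I. c i *\<^sub>C e (\<pi> z (choi (\<Psi> i) h)))"
      by (simp add: choi_jones[OF \<Psi> z])
    also have "\<dots> = e (\<pi> z ((\<Sum>i\<in>I. c i *\<^sub>C choi (\<Psi> i)) h))"
      by (simp add: scaleC_sum_left_apply blinfun.sum_right bopD[OF jones_bop] bopD[OF rep_bop[OF z]])
    also have "\<dots> = 0" by (simp add: choi0)
    finally show "e (\<pi> (\<Sum>i\<in>I. c i *\<^sub>C \<Psi> i z) h) = 0" .
  qed
qed

section \<open>Convolution as composition\<close>

lemma hat_injective:
  assumes "bimodule_map N M \<Psi>" "bimodule_map N M \<Theta>" "hat \<Psi> = hat \<Theta>" "z \<in> M"
  shows "\<Psi> z = \<Theta> z"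
proof -
  \<comment> \<open>A two-element family with coefficients 1 and -1 turns the linear statement into
    injectivity.\<close>
  have "(\<Sum>i\<in>{True, False}. (if i then 1 else - 1) *\<^sub>C (if i then \<Psi> else \<Theta>) z) = 0"
    by (rule hat_linear_injective)
      (use assms in \<open>auto simp: complex_vector.scale_minus_left scaleC_one\<close>)
  then show ?thesis by (simp add: complex_vector.scale_minus_left scaleC_one)
qed

text \<open>Needed because bimodule maps are total functions that \<open>hat_injective\<close>
  identifies only on M.\<close>

lemma hat_cong:
  assumes "\<And>x. x \<in> M \<Longrightarrow> \<Psi> x = \<Theta> x" shows "hat \<Psi> = hat \<Theta>"
proof -
  have "(\<Sum>j=1..m. vec (x o\<^sub>L adj (\<eta> j)) (\<Psi> (\<eta> j) o\<^sub>L y))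
      = (\<Sum>j=1..m. vec (x o\<^sub>L adj (\<eta> j)) (\<Theta> (\<eta> j) o\<^sub>L y))" for x y
    by (intro sum.cong refl) (simp add: assms eta_M)
  then show ?thesis by (simp add: hat_def fourier_multiplier_def)
qed

text \<open>The definition quantifies over representing maps; by injectivity any two choices agree
  on M, so the composite has a well-determined multiplier.\<close>

lemma convolution_hat:
  assumes "bimodule_map N M \<Psi>" "bounded_map_on M \<Psi>" "bimodule_map N M \<Theta>" "bounded_map_on M \<Theta>"
  shows "convolution N M hat (hat \<Psi>) (hat \<Theta>) = hat (\<Psi> \<circ> \<Theta>)"
  unfolding convolution_def
proof (rule the_equality)
  let ?P = "\<lambda>R. \<exists>\<Psi>' \<Theta>'. bimodule_map N M \<Psi>' \<and> bounded_map_on M \<Psi>' \<and> bimodule_map N M \<Theta>' \<and> bounded_map_on M \<Theta>' \<and>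
      hat \<Psi> = hat \<Psi>' \<and> hat \<Theta> = hat \<Theta>' \<and> R = hat (\<Psi>' \<circ> \<Theta>')"
  show "?P (hat (\<Psi> \<circ> \<Theta>))"
    using assms by blast
  fix R assume "?P R"
  then obtain \<Psi>' \<Theta>' where *: "bimodule_map N M \<Psi>'" "bimodule_map N M \<Theta>'" "hat \<Psi> = hat \<Psi>'"
    "hat \<Theta> = hat \<Theta>'" "R = hat (\<Psi>' \<circ> \<Theta>')" by blast
  have "(\<Psi>' \<circ> \<Theta>') x = (\<Psi> \<circ> \<Theta>) x" if x: "x \<in> M" for x
    using hat_injective[OF assms(1) *(1,3) bimodD(1)[OF assms(3) x]]
      hat_injective[OF assms(3) *(2,4) x] by simp
  then show "R = hat (\<Psi> \<circ> \<Theta>)" unfolding *(5) by (rule hat_cong)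
qed

lemma bimodule_map_power: "bimodule_map N M \<Phi> \<Longrightarrow> bimodule_map N M (\<Phi> ^^ k)"
  by (rule bimodule_map_funpow) (auto intro: N_id M_csubspace M_compose N_M)

lemma convolution_power_hat:
  assumes \<Phi>: "bimodule_map N M \<Phi>" and C: "bounded_map_on M \<Phi>"
  shows "convolution_power N M hat (hat \<Phi>) k = hat (\<Phi> ^^ k)"
proof -
  note B = bimodule_map_power[OF \<Phi>]
  have bdd: "bounded_map_on M (\<Phi> ^^ k)" for k
  proof (induction k)
    case 0
    show ?case by (auto simp: bounded_map_on_def intro: exI[of _ 1])
  next
    case (Suc k)
    obtain C where C: "\<And>x. x \<in> M \<Longrightarrow> norm (\<Phi> x) \<le> C * norm x"
      using assms(2) by (auto simp: bounded_map_on_def)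
    obtain D where D: "\<And>x. x \<in> M \<Longrightarrow> norm ((\<Phi> ^^ k) x) \<le> D * norm x"
      using Suc by (auto simp: bounded_map_on_def)
    have "norm ((\<Phi> ^^ Suc k) x) \<le> (\<bar>C\<bar> * D) * norm x" if x: "x \<in> M" for x
    proof -
      have "norm ((\<Phi> ^^ Suc k) x) \<le> C * norm ((\<Phi> ^^ k) x)"
        using C[OF bimodD(1)[OF B x]] by simp
      also have "\<dots> \<le> \<bar>C\<bar> * norm ((\<Phi> ^^ k) x)" by (intro mult_right_mono) auto
      \<comment> \<open>The constant in \<open>bounded_map_on\<close> may be negative.\<close>
      also have "\<dots> \<le> \<bar>C\<bar> * (D * norm x)" by (intro mult_left_mono D x) auto
      finally show ?thesis by (simp add: mult.assoc)
    qed
    then show ?case by (auto simp: bounded_map_on_def)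
  qed
  show ?thesis
  proof (induction k)
    case (Suc k)
    then show ?case
      using convolution_hat[OF \<Phi> C B[of k] bdd[of k]] by (simp only: convolution_power.simps funpow.simps)
  qed (simp only: convolution_power.simps funpow.simps)
qed

end

section \<open>Completely positive maps\<close>

locale cp_map = vna_carrier M
  for M :: "('h::chilbert_space \<Rightarrow>\<^sub>L 'h) set" +
  fixes \<Phi> :: "('h \<Rightarrow>\<^sub>L 'h) \<Rightarrow> ('h \<Rightarrow>\<^sub>L 'h)"
  assumes cp: "completely_positive M \<Phi>"
    and closed: "x \<in> M \<Longrightarrow> \<Phi> x \<in> M" and linear: "clinear_map_on M \<Phi>"
begin

lemma map_add: "x \<in> M \<Longrightarrow> y \<in> M \<Longrightarrow> \<Phi> (x + y) = \<Phi> x + \<Phi> y"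
  and map_scaleC: "x \<in> M \<Longrightarrow> \<Phi> (c *\<^sub>C x) = c *\<^sub>C \<Phi> x"
  using linear by (auto simp: clinear_map_on_def)

lemma map_scaleR: "x \<in> M \<Longrightarrow> \<Phi> (r *\<^sub>R x) = r *\<^sub>R \<Phi> x"
  by (simp add: scaleR_scaleC map_scaleC)

lemma map_diff: "x \<in> M \<Longrightarrow> y \<in> M \<Longrightarrow> \<Phi> (x - y) = \<Phi> x - \<Phi> y"
  using map_add[of "x - y" y] by (simp add: M_linear)

lemma map_positive:
  assumes "x \<in> M" "positive_op x" shows "positive_op (\<Phi> x)"
proof -
  have "positive_op_matrix 1 (\<lambda>_ _. x)"
    using assms(2) by (simp add: positive_op_matrix_def positive_op_def)
  then have "positive_op_matrix 1 (\<lambda>_ _. \<Phi> x)"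
    using cp assms(1) unfolding completely_positive_def by (elim allE[of _ 1] allE[of _ "\<lambda>_ _. x"]) simp
  then have "cinner (\<Phi> x h) h \<in> \<real>\<^sub>\<ge>\<^sub>0" for h
    unfolding positive_op_matrix_def by (elim allE[of _ "\<lambda>_. h"]) simp
  then show ?thesis by (simp add: positive_op_def M_bop closed assms(1))
qed

lemma map_mono: "x \<in> M \<Longrightarrow> y \<in> M \<Longrightarrow> op_le x y \<Longrightarrow> op_le (\<Phi> x) (\<Phi> y)"
  using map_positive[of "y - x"] by (simp add: op_le_def M_linear map_diff)

text \<open>Complete positivity at size 2, for the Gram matrix of z and w, which is positive as a
  sum of the form u^* u.\<close>

lemma cp_form:
  assumes z: "z \<in> M" and w: "w \<in> M"
  shows "cinner (\<Phi> (adj z o\<^sub>L z) k) k + cinner (\<Phi> (adj z o\<^sub>L w) h) k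
    + (cinner (\<Phi> (adj w o\<^sub>L z) k) h + cinner (\<Phi> (adj w o\<^sub>L w) h) h) \<in> \<real>\<^sub>\<ge>\<^sub>0"
proof -
  define u where "u i = (if i = 0 then z else w)" for i :: nat
  have uM: "u i \<in> M" for i using z w by (simp add: u_def)
  have sum2: "(\<Sum>i<2. f i) = f 0 + f (1::nat)" for f :: "nat \<Rightarrow> complex"
    by (simp add: numeral_2_eq_2)
  have "positive_op_matrix 2 (\<lambda>i j. adj (u i) o\<^sub>L u j)"
    unfolding positive_op_matrix_def
  proof
    fix \<xi> :: "nat \<Rightarrow> 'h"
    have "(\<Sum>i<2. \<Sum>j<2. cinner ((adj (u i) o\<^sub>L u j) (\<xi> j)) (\<xi> i))
        = cinner (u 0 (\<xi> 0) + u 1 (\<xi> 1)) (u 0 (\<xi> 0) + u 1 (\<xi> 1))"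
      by (simp only: sum2 blinfun_apply_blinfun_compose cinner_adj_left[OF M_bop[OF uM]]
        cinner_add_left cinner_add_right ac_simps)
    then show "(\<Sum>i<2. \<Sum>j<2. cinner ((adj (u i) o\<^sub>L u j) (\<xi> j)) (\<xi> i)) \<in> \<real>\<^sub>\<ge>\<^sub>0"
      by (simp add: cinner_self del: of_real_power)
  qed
  moreover have "adj (u i) o\<^sub>L u j \<in> M" for i j by (intro M_compose M_adj uM)
  ultimately have "positive_op_matrix 2 (\<lambda>i j. \<Phi> (adj (u i) o\<^sub>L u j))"
    using cp[unfolded completely_positive_def, rule_format, of 2 "\<lambda>i j. adj (u i) o\<^sub>L u j"] by blast
  then have "(\<Sum>i<2. \<Sum>j<2. cinner (\<Phi> (adj (u i) o\<^sub>L u j) ((\<lambda>i. if i = 0 then k else h) j))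
      ((\<lambda>i. if i = 0 then k else h) (i::nat))) \<in> \<real>\<^sub>\<ge>\<^sub>0"
    unfolding positive_op_matrix_def by (rule spec)
  then show ?thesis by (simp add: sum2 u_def)
qed

text \<open>Replacing h by r h in \<open>cp_form\<close> gives a quadratic polynomial in r that is
  nonnegative for all real r; the inequality is the one for its discriminant.\<close>

lemma cp_schwarz:
  assumes z: "z \<in> M" and w: "w \<in> M"
  shows "(Re (cinner (\<Phi> (adj z o\<^sub>L w) h) k))\<^sup>2
    \<le> quad_form (\<Phi> (adj z o\<^sub>L z)) k * quad_form (\<Phi> (adj w o\<^sub>L w)) h"
proof (rule discriminant_le)
  have pos: "positive_op (\<Phi> (adj v o\<^sub>L v))" if v: "v \<in> M" for v
    by (intro map_positive positive_op_square M_compose M_adj M_bop v)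
  have im: "Im (cinner (\<Phi> (adj v o\<^sub>L v) x) x) = 0" if "v \<in> M" for v x
    using quad_form_Im positive_opD(1)[OF pos[OF that]] by blast
  have zwb: "\<Phi> (adj z o\<^sub>L w) \<in> bop" by (intro M_bop closed M_compose M_adj z w)
  \<comment> \<open>The total is real also at i h, and this equates the real parts of the two mixed
    terms at h.\<close>
  have "Im (cinner (\<Phi> (adj z o\<^sub>L w) (\<i> *\<^sub>C h)) k + cinner (\<Phi> (adj w o\<^sub>L z) k) (\<i> *\<^sub>C h)) = 0"
    using cp_form[OF z w, of k "\<i> *\<^sub>C h"] im[OF z, of k] im[OF w, of "\<i> *\<^sub>C h"]
    by (simp add: complex_nonneg_Reals_iff)
  then have re: "Re (cinner (\<Phi> (adj w o\<^sub>L z) k) h) = Re (cinner (\<Phi> (adj z o\<^sub>L w) h) k)"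
    by (simp add: bopD[OF zwb] cinner_scaleC_left cinner_scaleC_right)
  fix r :: real
  show "0 \<le> quad_form (\<Phi> (adj z o\<^sub>L z)) k + 2 * r * Re (cinner (\<Phi> (adj z o\<^sub>L w) h) k)
      + r\<^sup>2 * quad_form (\<Phi> (adj w o\<^sub>L w)) h"
    using cp_form[OF z w, of k "r *\<^sub>R h"] re
    by (simp add: complex_nonneg_Reals_iff blinfun.scaleR_right cinner_scaleR_left cinner_scaleR_right
      quad_form_def power2_eq_square algebra_simps)
  show "0 \<le> quad_form (\<Phi> (adj w o\<^sub>L w)) h" by (rule positive_opD(2)[OF pos[OF w]])
qed

text \<open>The Schwarz inequality with z = 1 and k = \<Phi>(x) h, together with the bound of x^* x
  by the squared norm of x. Convolution is only defined through bounded maps, so this admits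
  \<Phi>.\<close>

lemma cp_bounded: "bounded_map_on M \<Phi>"
  unfolding bounded_map_on_def
proof (intro exI ballI)
  fix x assume x: "x \<in> M"
  let ?c = "norm (\<Phi> id_blinfun)"
  have "norm (\<Phi> x h) \<le> ?c * norm x * norm h" for h
  proof (cases "\<Phi> x h = 0")
    case False
    have le: "op_le (adj x o\<^sub>L x) ((norm x)\<^sup>2 *\<^sub>R id_blinfun)"
    proof (rule op_leI)
      have xb: "x \<in> bop" by (rule M_bop[OF x])
      show "hermitian_op (adj x o\<^sub>L x)" by (rule positive_opD(1)[OF positive_op_square[OF xb]])
      fix y
      have "(norm (x y))\<^sup>2 \<le> (norm x * norm y)\<^sup>2" by (intro power_mono norm_blinfun) simp
      then show "quad_form (adj x o\<^sub>L x) y \<le> quad_form ((norm x)\<^sup>2 *\<^sub>R id_blinfun) y"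
        using xb by (simp add: quad_form_def cinner_adj_left cinner_self blinfun.scaleR_left
          cinner_scaleR_left power_mult_distrib)
    qed simp
    have "op_le (\<Phi> (adj x o\<^sub>L x)) ((norm x)\<^sup>2 *\<^sub>R \<Phi> id_blinfun)"
      using map_mono[OF _ _ le] by (simp add: map_scaleR M_id M_compose M_adj x M_linear)
    then have "quad_form (\<Phi> (adj x o\<^sub>L x)) h \<le> (norm x)\<^sup>2 * quad_form (\<Phi> id_blinfun) h"
      using op_leD by fastforce
    also have "\<dots> \<le> (norm x)\<^sup>2 * (?c * (norm h)\<^sup>2)" by (intro mult_left_mono quad_form_le_norm) simp
    finally have q: "quad_form (\<Phi> (adj x o\<^sub>L x)) h \<le> (norm x)\<^sup>2 * (?c * (norm h)\<^sup>2)" .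
    let ?y = "\<Phi> x h"
    have "((norm ?y)\<^sup>2)\<^sup>2 \<le> quad_form (\<Phi> id_blinfun) ?y * quad_form (\<Phi> (adj x o\<^sub>L x)) h"
      using cp_schwarz[OF M_id x, of h ?y] by (simp add: cinner_self)
    also have "\<dots> \<le> (?c * (norm ?y)\<^sup>2) * ((norm x)\<^sup>2 * (?c * (norm h)\<^sup>2))"
    proof (rule mult_mono[OF quad_form_le_norm q])
      show "0 \<le> quad_form (\<Phi> (adj x o\<^sub>L x)) h"
        by (intro positive_opD(2) map_positive positive_op_square M_compose M_adj M_bop x)
    qed simp
    finally have "(norm ?y)\<^sup>2 * (norm ?y)\<^sup>2 \<le> (?c * norm x * norm h)\<^sup>2 * (norm ?y)\<^sup>2"
      by (simp only: power2_eq_square mult_ac)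
    then have "(norm ?y)\<^sup>2 \<le> (?c * norm x * norm h)\<^sup>2"
      by (rule mult_right_le_imp_le) (use False in simp)
    then show ?thesis by (rule power2_le_imp_le) simp
  qed simp
  then show "norm (\<Phi> x) \<le> ?c * norm x" by (intro norm_blinfun_bound) simp_all
qed

lemma cp_kernel:
  assumes "z \<in> M" "w \<in> M" "quad_form (\<Phi> (adj z o\<^sub>L z)) k \<le> 0"
  shows "Re (cinner (\<Phi> (adj z o\<^sub>L w) h) k) = 0"
proof -
  have "0 \<le> quad_form (\<Phi> (adj w o\<^sub>L w)) h"
    by (intro positive_opD(2) map_positive positive_op_square M_compose M_adj M_bop assms)
  then have "quad_form (\<Phi> (adj z o\<^sub>L z)) k * quad_form (\<Phi> (adj w o\<^sub>L w)) h \<le> 0"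
    by (rule mult_nonpos_nonneg[OF assms(3)])
  with cp_schwarz[OF assms(1,2), of h k] have "(Re (cinner (\<Phi> (adj z o\<^sub>L w) h) k))\<^sup>2 \<le> 0"
    by (rule order_trans)
  then show ?thesis by simp
qed

text \<open>The component u of the vector in the kernel of p has vanishing \<Phi>(p)-form, since
  \<Phi>(p) lies below c p. By \<open>cp_kernel\<close> the vector has zero real inner product with
  u, hence u = 0.\<close>

lemma cp_projection:
  assumes p: "p \<in> M" "is_projection p" and c: "op_le (\<Phi> p) (c *\<^sub>R p)" and x: "x \<in> M"
  shows "p (\<Phi> (p o\<^sub>L x) h) = \<Phi> (p o\<^sub>L x) h"
proof -
  note P = is_projection_apply[OF p(2)]
  have pp: "p o\<^sub>L p = p" "adj p = p" using p(2) by (auto simp: is_projection_def)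
  let ?v = "\<Phi> (p o\<^sub>L x) h"
  define u where "u = ?v - p ?v"
  have pu: "p u = 0" by (simp add: u_def blinfun.diff_right P)
  have "quad_form (\<Phi> (adj p o\<^sub>L p)) u \<le> 0"
    using op_leD[OF c, of u] pu by (simp add: pp quad_form_def blinfun.scaleR_left)
  then have "Re (cinner ?v u) = 0" using cp_kernel[OF p(1) x, of u h] by (simp add: pp)
  moreover have "cinner (p ?v) u = 0" using P(3)[of ?v u] pu by simp
  ultimately have "Re (cinner u u) = 0" by (simp add: u_def[of] cinner_diff_left)
  then have "u = 0" by (simp add: cinner_self)
  then show ?thesis by (simp add: u_def)
qed

lemma power_closed: "x \<in> M \<Longrightarrow> (\<Phi> ^^ k) x \<in> M"
  by (induction k) (simp_all add: closed)

lemma cp_map_power: "cp_map M (\<Phi> ^^ k)"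
proof (induction k)
  case 0
  show ?case by standard (simp_all add: vna completely_positive_def clinear_map_on_def)
next
  case (Suc k)
  interpret k: cp_map M "\<Phi> ^^ k" by (rule Suc)
  show ?case
  proof
    show "completely_positive M (\<Phi> ^^ Suc k)"
      unfolding completely_positive_def
    proof (intro allI impI)
      fix n and a :: "nat \<Rightarrow> nat \<Rightarrow> 'h \<Rightarrow>\<^sub>L 'h"
      assume a: "(\<forall>i<n. \<forall>j<n. a i j \<in> M) \<and> positive_op_matrix n a"
      then have "positive_op_matrix n (\<lambda>i j. (\<Phi> ^^ k) (a i j))"
        using k.cp unfolding completely_positive_def by blast
      moreover have "\<forall>i<n. \<forall>j<n. (\<Phi> ^^ k) (a i j) \<in> M" using a k.closed by blast
      ultimately show "positive_op_matrix n (\<lambda>i j. (\<Phi> ^^ Suc k) (a i j))"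
        using cp[unfolded completely_positive_def, rule_format, of n "\<lambda>i j. (\<Phi> ^^ k) (a i j)"] by simp
    qed
    show "clinear_map_on M (\<Phi> ^^ Suc k)"
      by (simp add: clinear_map_on_def k.map_add k.map_scaleC map_add map_scaleC k.closed)
  qed (simp_all add: vna closed k.closed)
qed

lemma power_mono:
  assumes p: "p \<in> M" and c: "0 \<le> c" "op_le (\<Phi> p) (c *\<^sub>R p)"
  shows "op_le ((\<Phi> ^^ k) p) (c ^ k *\<^sub>R p)"
proof (induction k)
  case (Suc k)
  have "op_le (\<Phi> ((\<Phi> ^^ k) p)) (\<Phi> (c ^ k *\<^sub>R p))"
    by (intro map_mono Suc power_closed M_linear p)
  also have "\<Phi> (c ^ k *\<^sub>R p) = c ^ k *\<^sub>R \<Phi> p" by (rule map_scaleR[OF p])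
  finally have "op_le (\<Phi> ((\<Phi> ^^ k) p)) (c ^ k *\<^sub>R \<Phi> p)" .
  moreover have "op_le (c ^ k *\<^sub>R \<Phi> p) (c ^ Suc k *\<^sub>R p)"
  proof -
    have "c ^ Suc k *\<^sub>R p - c ^ k *\<^sub>R \<Phi> p = c ^ k *\<^sub>R (c *\<^sub>R p - \<Phi> p)"
      by (simp add: scaleR_diff_right mult.commute)
    then show ?thesis using c by (simp add: op_le_def positive_op_iff)
  qed
  ultimately show ?case by (auto intro: op_le_trans)
qed simp

end

section \<open>Range projections of positive operators\<close>

lemma
  fixes T :: "'h::chilbert_space \<Rightarrow>\<^sub>L 'h"
  assumes "T \<in> bop"
  shows is_projection_range_projection: "is_projection (range_projection T)"
    and range_range_projection: "ran (range_projection T) = closure (ran T)"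
proof -
  have "csubspace (closure (ran T))"
    using assms by (intro csubspace_closure csubspace_range) (simp add: bop_iff)
  then show "is_projection (range_projection T)"
    "ran (range_projection T) = closure (ran T)"
    unfolding range_projection_def
    using is_projection_projection_onto range_projection_onto closed_closure by blast+
qed

lemma ran_scaleR:
  assumes "c \<noteq> 0" shows "ran (c *\<^sub>R T) = ran T"
proof -
  have sub: "ran (c *\<^sub>R T) \<subseteq> ran T" for c T
    by (auto simp: blinfun.scaleR_left simp flip: blinfun.scaleR_right)
  show ?thesis using sub[of c T] sub[of "1 / c" "c *\<^sub>R T"] assms by auto
qed

lemma range_projection_eqI:
  fixes T :: "'h::chilbert_space \<Rightarrow>\<^sub>L 'h"
  assumes "hermitian_op T" "s \<in> closure (ran T)" "T (x - s) = 0"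
  shows "range_projection T x = s"
  unfolding range_projection_def
proof (rule projection_onto_eqI)
  show "csubspace (closure (ran T))"
    using hermitian_opD(1)[OF assms(1)] by (intro csubspace_closure csubspace_range) (simp add: bop_iff)
  fix t assume t: "t \<in> closure (ran T)"
  show "cinner (x - s) t = 0"
  proof (rule orthogonal_closure[OF _ t])
    fix y assume "y \<in> ran T"
    then obtain z where z: "y = T z" by blast
    have "cinner (x - s) y = cinner (T (x - s)) z" by (simp only: z hermitian_opD(3)[OF assms(1)])
    also have "\<dots> = 0" by (simp only: assms(3) cinner_zero_left)
    finally show "cinner (x - s) y = 0" .
  qed
qed (use assms in simp_all)

lemma range_projection_kernel:
  fixes T :: "'h::chilbert_space \<Rightarrow>\<^sub>L 'h"
  assumes "hermitian_op T" shows "T (x - range_projection T x) = 0"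
proof (rule cinner_ext)
  fix y
  note Tb = hermitian_opD(1)[OF assms]
  note P = is_projection_range_projection[OF Tb] and R = range_range_projection[OF Tb]
  have "T y \<in> closure (ran T)" by (rule subsetD[OF closure_subset]) simp
  then have "range_projection T (T y) = T y" using is_projection_range_iff[OF P] R by blast
  then have "cinner (x - range_projection T x) (T y) = 0"
    using is_projection_apply(3)[OF P, of x "T y"] by (simp add: cinner_diff_left)
  then show "cinner (T (x - range_projection T x)) y = cinner 0 y"
    by (simp only: hermitian_opD(3)[OF assms] cinner_zero_left)
qed

text \<open>The two inequalities give T and p the same kernel, and for hermitian operators the
  kernel determines the closed range.\<close>

lemma range_projection_sandwich:
  assumes p: "is_projection p" and le: "op_le p T" "op_le T (C *\<^sub>R p)"
  shows "range_projection T = p"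
proof (rule blinfun_eqI)
  fix x
  note P = is_projection_apply[OF p]
  have ph: "hermitian_op p" by (rule hermitian_opI[OF P(1) P(3)])
  have qp: "quad_form p y = (norm (p y))\<^sup>2" for y
    using P(3)[of "p y" y] P(2) by (simp add: quad_form_def cinner_self)
  have T: "positive_op T"
    using op_le_hermitian[OF le(1) ph] op_leD[OF le(1)] qp
    by (metis order_trans positive_op_iff zero_le_power2)
  note Th = positive_opD(1)[OF T]
  have 0: "T y = 0 \<longleftrightarrow> p y = 0" for y
  proof
    assume "T y = 0"
    then have "quad_form p y \<le> 0" using op_leD[OF le(1), of y] by (simp add: quad_form_def)
    then show "p y = 0" by (simp add: qp)
  next
    assume "p y = 0"
    then have "quad_form T y \<le> 0" using op_leD[OF le(2), of y] by (simp add: quad_form_def[of p])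
    then show "T y = 0" using positive_op_quad_form_zero[OF T, of y] positive_opD(2)[OF T, of y] by simp
  qed
  let ?s = "range_projection T (p x)"
  note R = is_projection_range_projection[OF hermitian_opD(1)[OF Th]] range_range_projection[OF hermitian_opD(1)[OF Th]]
  have "p (p x - ?s) = 0" using range_projection_kernel[OF Th] 0 by blast
  then have "cinner (p x - ?s) (p x) = 0" using P(3)[of "p x - ?s" x] by simp
  moreover have "cinner (p x - ?s) ?s = 0"
    using is_projection_apply(3)[OF R(1), of "p x - ?s" "p x"] is_projection_apply(2)[OF R(1)]
    by (simp add: blinfun.diff_right)
  ultimately have "cinner (p x - ?s) (p x - ?s) = 0" by (simp add: cinner_diff_right)
  then have "p x \<in> closure (ran T)"
    using R(2) by (metis cinner_self_eq_zero eq_iff_diff_eq_0 rangeI)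
  moreover have "p (x - p x) = 0" by (simp add: blinfun.diff_right P(2))
  then have "T (x - p x) = 0" using 0 by blast
  ultimately show "range_projection T x = p x" by (intro range_projection_eqI Th) auto
qed

section \<open>Powers of an effect and approximation of range projections\<close>

primrec op_power :: "('h::chilbert_space \<Rightarrow>\<^sub>L 'h) \<Rightarrow> nat \<Rightarrow> 'h \<Rightarrow>\<^sub>L 'h" where
  "op_power S 0 = id_blinfun"
| "op_power S (Suc n) = S o\<^sub>L op_power S n"

lemma op_power_commute: "op_power S n (S x) = S (op_power S n x)"
  by (induction n) simp_all

lemma op_power_add: "op_power S (m + n) x = op_power S m (op_power S n x)"
  by (induction m) simp_all

lemma op_power_hermitian: "hermitian_op S \<Longrightarrow> hermitian_op (op_power S n)"
proof (induction n)
  case (Suc n)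
  show ?case
  proof (rule hermitian_opI)
    show "op_power S (Suc n) \<in> bop" using Suc by (simp add: bop_compose hermitian_opD(1))
    show "cinner (op_power S (Suc n) x) y = cinner x (op_power S (Suc n) y)" for x y
      using Suc by (simp add: hermitian_opD(3) op_power_commute)
  qed
qed simp

text \<open>Moving half of the factors to the other side of the form reduces positivity and
  monotonicity of powers to properties of S itself, without square roots.\<close>

lemma quad_form_op_power:
  assumes "hermitian_op S"
  shows "quad_form (op_power S (k + k)) x = (norm (op_power S k x))\<^sup>2"
    "quad_form (op_power S (Suc (k + k))) x = quad_form S (op_power S k x)"
  using hermitian_opD(3)[OF op_power_hermitian[OF assms, of k]]
  by (simp_all add: quad_form_def op_power_add cinner_self op_power_commute[symmetric])

lemma parity_cases:
  fixes n :: nat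
  obtains (even) k where "n = k + k" | (odd) k where "n = Suc (k + k)"
  by (metis dvdE mult_2 oddE Suc_eq_plus1)

lemma op_power_decreasing:
  assumes "effect_op S" shows "op_le (op_power S (Suc n)) (op_power S n)"
proof (rule op_leI)
  note D = effect_opD[OF assms]
  show "hermitian_op (op_power S (Suc n))" "hermitian_op (op_power S n)"
    by (rule op_power_hermitian[OF D(2)])+
  fix x
  show "quad_form (op_power S (Suc n)) x \<le> quad_form (op_power S n) x"
  \<comment> \<open>Even n uses S \<le> 1, odd n uses that the square of S lies below S, both at the
    vector \<open>op_power S k x\<close>.\<close>
  proof (cases n rule: parity_cases)
    case (even k)
    show ?thesis unfolding even quad_form_op_power[OF D(2)] by (rule D(6))
  next
    case (odd k)
    have "quad_form (op_power S (Suc n)) x = (norm (op_power S (Suc k) x))\<^sup>2"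
      using quad_form_op_power(1)[OF D(2), of "Suc k" x] by (simp only: odd add_Suc_right add_Suc)
    also have "\<dots> \<le> quad_form S (op_power S k x)" using D(8) by simp
    finally show ?thesis unfolding odd quad_form_op_power[OF D(2)] .
  qed
qed

lemma effect_op_power:
  assumes "effect_op S" shows "effect_op (op_power S n)"
proof -
  note D = effect_opD[OF assms]
  have "0 \<le> quad_form (op_power S n) x" for x
  proof (cases n rule: parity_cases)
    case (even k)
    show ?thesis unfolding even quad_form_op_power[OF D(2)] by simp
  next
    case (odd k)
    show ?thesis unfolding odd quad_form_op_power[OF D(2)] by (rule D(7))
  qed
  then have "positive_op (op_power S n)" by (simp add: positive_op_iff op_power_hermitian D(2))
  moreover have "op_le (op_power S n) id_blinfun"
  proof (induction n)
    case (Suc n)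
    then show ?case using op_power_decreasing[OF assms] op_le_trans by blast
  qed simp
  ultimately show ?thesis by (simp add: effect_op_def)
qed

text \<open>The functions \<open>1 - (1 - t)\<^sup>n\<close> increase to the indicator function of \<open>(0, 1]\<close>.\<close>

lemma increasing_to_range_projection:
  assumes T: "effect_op T"
  shows "increasing_to (\<lambda>n. id_blinfun - op_power (id_blinfun - T) n) (range_projection T)"
proof -
  define S where "S = id_blinfun - T"
  have S: "effect_op S" unfolding S_def by (intro effect_op_diff T effect_opD(4)[OF T]) simp
  have Sx: "S x = x - T x" for x by (simp add: S_def blinfun.diff_left)
  define f where "f n = id_blinfun - op_power S n" for n
  have "effect_op (f n)" for n
    unfolding f_def using effect_op_power[OF S, of n] by (intro effect_op_diff) (auto simp: effect_opD(4))
  moreover have "op_le (f n) (f (Suc n))" for n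
    using op_power_decreasing[OF S, of n] by (simp add: f_def op_le_def)
  ultimately obtain s where s: "increasing_to f s" using increasing_converges by blast
  note D = increasing_toD[OF s]
  have Th: "hermitian_op T" by (rule effect_opD(2)[OF T])
  have Tlin: "csubspace (ran T)"
    using effect_opD(3)[OF T] by (intro csubspace_range) (simp add: bop_iff)
  have ran: "f n x \<in> ran T" for n x
  proof (induction n)
    case 0
    show ?case using csubspaceD(1)[OF Tlin] by (simp add: f_def blinfun.diff_left)
  next
    case (Suc n)
    have "f (Suc n) x = f n x + T (op_power S n x)" by (simp add: f_def Sx blinfun.diff_left)
    then show ?case using csubspaceD(2)[OF Tlin Suc] by simp
  qed
  have "range_projection T x = s x" for x
  proof (rule range_projection_eqI[OF Th])
    show "s x \<in> closure (ran T)"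
      unfolding closure_sequential using ran D(4)[of x] by (intro exI[of _ "\<lambda>n. f n x"]) simp
    \<comment> \<open>Consecutive differences of a convergent sequence tend to 0, but here they
      equal T (x - f n x), so the limit satisfies T (x - s x) = 0.\<close>
    have "(\<lambda>n. f (Suc n) x - f n x) \<longlonglongrightarrow> s x - s x" by (intro tendsto_diff D(4) LIMSEQ_Suc)
    moreover have "f (Suc n) x - f n x = T (x - f n x)" for n by (simp add: f_def Sx blinfun.diff_left)
    ultimately have "(\<lambda>n. T (x - f n x)) \<longlonglongrightarrow> 0" by simp
    moreover have "(\<lambda>n. T (x - f n x)) \<longlonglongrightarrow> T (x - s x)"
      by (intro bounded_linear.tendsto[OF blinfun.bounded_linear_right] tendsto_diff tendsto_const D(4))
    ultimately show "T (x - s x) = 0" using LIMSEQ_unique by blast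
  qed
  then have "range_projection T = s" by (rule blinfun_eqI)
  then show ?thesis using s by (simp add: f_def[abs_def] S_def)
qed

text \<open>From \<Phi>(T) \<le> C T the form of \<Phi>(T) vanishes on the kernel of T. So do the
  images of the approximants f n of the range projection q. Each \<Phi>(f n) therefore lives on the
  range of q and is bounded there by \<Phi>(1), uniformly in n; normality passes to the
  limit.\<close>

lemma (in cp_map) range_projection_invariant:
  assumes normal: "normal_map M \<Phi>" and T: "T \<in> M" "positive_op T" and C: "op_le (\<Phi> T) (C *\<^sub>R T)"
  shows "range_projection T \<in> M" "\<exists>c>0. op_le (\<Phi> (range_projection T)) (c *\<^sub>R range_projection T)"
proof -
  define K where "K = norm T + 1"
  have K: "K > 0" by (simp add: K_def add_nonneg_pos)
  define T' where "T' = (1 / K) *\<^sub>R T"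
  have T'M: "T' \<in> M" using T(1) by (simp add: T'_def M_linear)
  have Th: "hermitian_op T" by (rule positive_opD(1)[OF T(2)])
  have T'e: "effect_op T'"
    unfolding effect_op_iff
  proof (intro conjI allI)
    show "hermitian_op T'" by (simp add: T'_def Th)
    show "0 \<le> quad_form T' x" for x using K positive_opD(2)[OF T(2), of x] by (simp add: T'_def)
    show "quad_form T' x \<le> (norm x)\<^sup>2" for x
    proof -
      have "quad_form T x \<le> norm T * (norm x)\<^sup>2" by (rule quad_form_le_norm)
      also have "\<dots> \<le> K * (norm x)\<^sup>2" by (simp add: K_def mult_right_mono)
      finally show ?thesis using K by (simp add: T'_def field_simps)
    qed
  qed
  have "ran T' = ran T" using K by (simp add: T'_def ran_scaleR)
  then have q: "range_projection T = range_projection T'" by (simp add: range_projection_def)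
  define f where "f n = id_blinfun - op_power (id_blinfun - T') n" for n
  have inc: "increasing_to f (range_projection T)"
    unfolding q f_def[abs_def] by (rule increasing_to_range_projection[OF T'e])
  note D = increasing_toD[OF inc]
  have pM: "op_power (id_blinfun - T') n \<in> M" for n
    by (induction n) (auto intro!: M_compose M_linear M_id T'M)
  have fM: "f n \<in> M" for n unfolding f_def by (intro M_linear M_id pM)
  show qM: "range_projection T \<in> M"
    by (rule von_neumann_algebraD(7)[OF vna fM _ D(4)]) (rule effect_opD(3)[OF D(5)])
  \<comment> \<open>Divisibility on the left by T' puts f n into the form to which
    \<open>cp_kernel\<close> applies with z = T'.\<close>
  have factor: "\<exists>g\<in>M. f n = T' o\<^sub>L g" for n
  proof (induction n)
    case 0
    show ?case by (rule bexI[of _ 0]) (auto simp: f_def M_linear intro: blinfun_eqI)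
  next
    case (Suc n)
    then obtain g where g: "g \<in> M" "f n = T' o\<^sub>L g" by blast
    have "f (Suc n) = f n + (T' o\<^sub>L op_power (id_blinfun - T') n)"
      by (rule blinfun_eqI) (simp add: f_def blinfun.diff_left blinfun.add_left)
    also have "\<dots> = T' o\<^sub>L (g + op_power (id_blinfun - T') n)"
      by (rule blinfun_eqI) (simp add: g(2) blinfun.add_left blinfun.add_right)
    finally show ?case using g(1) pM M_linear(2) by blast
  qed
  \<comment> \<open>The added 1 keeps c positive when \<Phi>(1) = 0.\<close>
  define c where "c = norm (\<Phi> id_blinfun) + 1"
  have c: "c > 0" by (simp add: c_def add_nonneg_pos)
  note Q = is_projection_range_projection[OF hermitian_opD(1)[OF Th]]
  let ?q = "range_projection T"
  have bound: "op_le (\<Phi> (f n)) (c *\<^sub>R ?q)" for n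
  proof (rule op_leI)
    have pos: "positive_op (\<Phi> (f n))" by (rule map_positive[OF fM effect_opD(1)[OF D(1)]])
    note h = positive_opD(1)[OF pos]
    show "hermitian_op (\<Phi> (f n))" by (rule h)
    show "hermitian_op (c *\<^sub>R ?q)" by (intro hermitian_op_simps effect_opD(2)[OF D(5)])
    fix x
    let ?k = "x - ?q x"
    have Tk: "T ?k = 0" by (rule range_projection_kernel[OF Th])
    have T'q: "adj T' = T'" by (rule effect_opD(5)[OF T'e])
    have "op_le (\<Phi> (adj T' o\<^sub>L T')) (\<Phi> T')"
      by (intro map_mono op_le_square T'e M_compose M_adj T'M)
    then have "quad_form (\<Phi> (adj T' o\<^sub>L T')) ?k \<le> quad_form (\<Phi> T') ?k" by (rule op_leD)
    also have "\<dots> = (1 / K) * quad_form (\<Phi> T) ?k" by (simp only: T'_def map_scaleR[OF T(1)] quad_form_simps)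
    also have "\<dots> \<le> (1 / K) * quad_form (C *\<^sub>R T) ?k" using K by (intro mult_left_mono op_leD[OF C]) simp
    also have "\<dots> = 0" using Tk by (simp only: quad_form_simps) (simp only: quad_form_def cinner_zero_left, simp)
    finally have "quad_form (\<Phi> (adj T' o\<^sub>L T')) ?k \<le> 0" .
    moreover obtain g where "g \<in> M" "f n = T' o\<^sub>L g" using factor by blast
    ultimately have "quad_form (\<Phi> (f n)) ?k = 0"
      using cp_kernel[OF T'M, of g ?k ?k] T'q by (simp add: quad_form_def)
    then have k0: "\<Phi> (f n) ?k = 0" by (rule positive_op_quad_form_zero[OF pos])
    then have kx: "\<Phi> (f n) x = \<Phi> (f n) (?q x)" by (simp add: blinfun.diff_right)
    have "quad_form (\<Phi> (f n)) x = Re (cinner (\<Phi> (f n) (?q x)) x)" by (simp only: quad_form_def kx)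
    also have "\<dots> = Re (cinner (?q x) (\<Phi> (f n) x))" by (simp only: hermitian_opD(3)[OF h])
    also have "\<dots> = Re (cinner (?q x) (\<Phi> (f n) (?q x)))" by (simp only: kx)
    also have "\<dots> = quad_form (\<Phi> (f n)) (?q x)" by (simp only: quad_form_def hermitian_opD(3)[OF h])
    also have "\<dots> \<le> quad_form (\<Phi> id_blinfun) (?q x)"
      by (intro op_leD map_mono fM M_id effect_opD(4)[OF D(1)])
    also have "\<dots> \<le> norm (\<Phi> id_blinfun) * (norm (?q x))\<^sup>2" by (rule quad_form_le_norm)
    also have "\<dots> \<le> c * (norm (?q x))\<^sup>2" by (simp add: c_def mult_right_mono)
    also have "\<dots> = quad_form (c *\<^sub>R ?q) x"
      using is_projection_apply(3)[OF Q, of "?q x" x] is_projection_apply(2)[OF Q]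
      by (simp add: quad_form_def[of ?q] cinner_self)
    finally show "quad_form (\<Phi> (f n)) x \<le> quad_form (c *\<^sub>R ?q) x" .
  qed
  \<comment> \<open>By normality \<Phi>(q) is the least upper bound of the \<Phi>(f n), so the
    common bound c q passes to it.\<close>
  have "range f \<subseteq> {a \<in> M. positive_op a}" using fM effect_opD(1)[OF D(1)] by auto
  then have "op_lub_in M (\<Phi> ` range f) (\<Phi> ?q)"
    using normal op_directed_increasing[OF inc] op_lub_in_increasing[OF inc qM]
    unfolding normal_map_def by blast
  then have "op_le (\<Phi> ?q) (c *\<^sub>R ?q)"
    using bound qM M_linear(4) unfolding op_lub_in_def by blast
  then show "\<exists>c>0. op_le (\<Phi> ?q) (c *\<^sub>R ?q)" using c by blast
qed

section \<open>Linear dependence of the powers\<close>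

text \<open>There are \<open>cdim Q\<close> + 1 vectors. Dependence is a notion for sets, so a
  family with a repeated value is treated separately.\<close>

lemma linear_dependence:
  fixes f :: "nat \<Rightarrow> 'a::complex_vector"
  assumes fin: "finite_cdim Q" and f: "\<And>j. j \<le> cdim Q \<Longrightarrow> f j \<in> Q"
  obtains c where "\<exists>j\<le>cdim Q. c j \<noteq> 0" "(\<Sum>j\<le>cdim Q. c j *\<^sub>C f j) = 0"
proof (cases "inj_on f {..cdim Q}")
  case False
  then obtain i j where ij: "i \<le> cdim Q" "j \<le> cdim Q" "i \<noteq> j" "f i = f j"
    by (auto simp: inj_on_def)
  \<comment> \<open>A repeated value cancels with coefficients 1 and -1.\<close>
  define c :: "nat \<Rightarrow> complex" where "c l = (if l = i then 1 else if l = j then - 1 else 0)" for l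
  have "(\<Sum>l\<le>cdim Q. c l *\<^sub>C f l) = (\<Sum>l\<in>{i, j}. c l *\<^sub>C f l)"
    by (rule sum.mono_neutral_right) (use ij in \<open>auto simp: c_def\<close>)
  also have "\<dots> = 0"
    using ij by (simp add: c_def complex_vector.scale_minus_left)
  finally have "(\<Sum>l\<le>cdim Q. c l *\<^sub>C f l) = 0" .
  then show ?thesis using ij by (intro that[of c]) (auto simp: c_def intro!: exI[of _ i])
next
  case True
  let ?F = "f ` {..cdim Q}"
  obtain b where b: "finite b" "Q \<subseteq> cspan b" using fin by (auto simp: finite_cdim_def)
  obtain B where B: "B \<subseteq> Q" "\<not> complex_vector.dependent B" "Q \<subseteq> cspan B" "card B = cdim Q"
    using complex_vector.basis_exists[of Q] by blast
  have finB: "finite B"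
    using complex_vector.independent_span_bound[OF b(1) B(2)] B(1) b(2) by blast
  have FB: "?F \<subseteq> cspan B" using f B(3) by auto
  have "complex_vector.dependent ?F"
  proof (rule ccontr)
    assume "\<not> complex_vector.dependent ?F"
    then have "card ?F \<le> card B"
      using complex_vector.independent_span_bound[OF finB _ FB] by blast
    then show False using True B(4) by (simp add: card_image)
  qed
  then obtain u v where u: "v \<in> ?F" "u v \<noteq> 0" "(\<Sum>v\<in>?F. u v *\<^sub>C v) = 0"
    using complex_vector.dependent_finite[of ?F] by auto
  show ?thesis
  proof (rule that[of "u \<circ> f"])
    show "\<exists>j\<le>cdim Q. (u \<circ> f) j \<noteq> 0" using u by auto
    show "(\<Sum>j\<le>cdim Q. (u \<circ> f) j *\<^sub>C f j) = 0"
      using u(3) by (simp add: sum.reindex[OF True])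
  qed
qed

section \<open>Relative irreducibility\<close>

context jones_tower
begin

lemma multiplier_bop: "bimodule_map N M \<Psi> \<Longrightarrow> multiplier \<Psi> \<in> bop"
  using multiplier_Q commutant_bop by (auto simp: Q_def)

text \<open>With r = 1 - p, the inner product of x V y \<Omega>1 with p e r \<Omega>1 is \<tau>1(r e
  p x V y) = \<tau>1(r e \<Psi>(p x) y). Expecting onto M leaves lam \<tau>(r \<Psi>(p x) y), and r
  \<Psi>(p x) = 0.\<close>

lemma multiplier_orthogonal:
  assumes \<Psi>: "bimodule_map N M \<Psi>" and p: "p \<in> M" "is_projection p"
    and fixed: "\<And>x h. x \<in> M \<Longrightarrow> p (\<Psi> (p o\<^sub>L x) h) = \<Psi> (p o\<^sub>L x) h"
  shows "cinner (vec p (id_blinfun - p)) (multiplier \<Psi> g) = 0"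
proof -
  define r where "r = id_blinfun - p"
  have rM: "r \<in> M" by (simp add: r_def M_linear M_id p(1))
  have radj: "adj r = r" using p(2) by (simp add: r_def adj_diff is_projection_def)
  have adjw: "adj (\<pi> p o\<^sub>L e o\<^sub>L \<pi> r) = \<pi> r o\<^sub>L e o\<^sub>L \<pi> p"
    using p(2) by (simp add: adj_compose bop_compose jones_bop rep_bop p(1) rM adj_e
      rep_adj[symmetric] radj is_projection_def blinfun_compose_assoc)
  \<comment> \<open>Moving the multiplier to the fixed vector reduces the claim for all g to the
    total vectors \<open>vec x y\<close>.\<close>
  have 0: "cinner (adj (multiplier \<Psi>) (vec p r)) v = 0" if v: "v \<in> {vec x y | x y. x \<in> M \<and> y \<in> M}" for v
  proof -
    obtain x y where xy: "x \<in> M" "y \<in> M" "v = vec x y" using v by blast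
    have AM: "\<pi> x o\<^sub>L choi \<Psi> o\<^sub>L \<pi> y \<in> M1" by (intro up.M_compose rep_M1 xy choi_M1[OF \<Psi>])
    have px: "p o\<^sub>L x \<in> M" by (rule M_compose[OF p(1) xy(1)])
    note \<Psi>x = bimodD(1)[OF \<Psi> px]
    define z where "z = \<Psi> (p o\<^sub>L x) o\<^sub>L y"
    have zM: "z \<in> M" unfolding z_def by (rule M_compose[OF \<Psi>x xy(2)])
    have prod: "(\<pi> r o\<^sub>L e o\<^sub>L \<pi> p) o\<^sub>L (\<pi> x o\<^sub>L choi \<Psi> o\<^sub>L \<pi> y) = \<pi> r o\<^sub>L e o\<^sub>L \<pi> z"
    proof (rule blinfun_eqI)
      fix h
      have "e (\<pi> p (\<pi> x (choi \<Psi> (\<pi> y h)))) = e (\<pi> (\<Psi> (p o\<^sub>L x)) (\<pi> y h))"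
        unfolding rep_apply[OF p(1) xy(1)] by (rule choi_jones[OF \<Psi> px])
      then show "((\<pi> r o\<^sub>L e o\<^sub>L \<pi> p) o\<^sub>L (\<pi> x o\<^sub>L choi \<Psi> o\<^sub>L \<pi> y)) h = (\<pi> r o\<^sub>L e o\<^sub>L \<pi> z) h"
        by (simp add: z_def rep_apply \<Psi>x xy(2))
    qed
    have "E1 (\<pi> r o\<^sub>L e o\<^sub>L \<pi> z) = lam *\<^sub>R \<pi> (r o\<^sub>L z)"
      using up.E_bimodule[OF e_M1, of "\<pi> r" "\<pi> z"] rM zM
      by (auto simp: E1_jones rep_compose blinfun.scaleR_left blinfun.scaleR_right intro!: blinfun_eqI)
    also have "r o\<^sub>L z = 0"
      by (rule blinfun_eqI) (simp add: r_def z_def blinfun.diff_left fixed xy)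
    finally have "\<tau>1 (\<pi> r o\<^sub>L e o\<^sub>L \<pi> z) = 0"
      using up.E_trace[OF vec_M1[OF rM zM]] by (simp add: rep_zero)
    then have "cinner (\<pi>1 (\<pi> x o\<^sub>L choi \<Psi> o\<^sub>L \<pi> y) \<Omega>1) (vec p r) = 0"
      by (simp only: vec_def up.rep_inner[OF AM vec_M1[OF p(1) rM]] adjw prod)
    then have "cinner (multiplier \<Psi> v) (vec p r) = 0"
      by (simp add: xy(3) multiplier_vec[OF \<Psi> xy(1,2)] cinner_scaleR_left)
    then show ?thesis
      using cinner_commute[of "vec p r" "multiplier \<Psi> v"] by (simp add: cinner_adj_left[OF multiplier_bop[OF \<Psi>]])
  qed
  have "g \<in> closure (cspan {vec x y | x y. x \<in> M \<and> y \<in> M})" by (simp add: vec_total)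
  then have "cinner (adj (multiplier \<Psi>) (vec p r)) g = 0"
    using orthogonal_closure_cspan[OF 0] by blast
  then show ?thesis by (simp add: r_def cinner_adj_left[OF multiplier_bop[OF \<Psi>]])
qed

text \<open>p e (1 - p) = 0 and its adjoint make p commute with e. Applied to \<Omega> this reads
  E(p) \<Omega> = p \<Omega>, so p = E(p).\<close>

lemma projection_in_N:
  assumes p: "p \<in> M" "is_projection p" and zero: "vec p (id_blinfun - p) = 0"
  shows "p \<in> N"
proof -
  have "\<pi> p o\<^sub>L e o\<^sub>L \<pi> (id_blinfun - p) = 0"
    using zero unfolding vec_def by (rule up.rep_separating[rotated]) (intro vec_M1 M_linear M_id p(1))
  from arg_cong[OF this, of "\<lambda>T. blinfun_apply T h" for h]
  have per: "\<pi> p (e h) = \<pi> p (e (\<pi> p h))" for h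
    by (simp add: rep_diff M_id p(1) rep_id blinfun.diff_left blinfun.diff_right)
  have pp: "adj (\<pi> p) = \<pi> p" using p(2) rep_adj[OF p(1)] by (simp add: is_projection_def)
  have ps: "cinner (\<pi> p u) v = cinner u (\<pi> p v)" for u v
    using cinner_adj_left[OF rep_bop[OF p(1)], of u v] by (simp add: pp)
  have "e (\<pi> p h) = \<pi> p (e (\<pi> p h))" for h
  proof (rule cinner_ext)
    fix v
    have "cinner (e (\<pi> p h)) v = cinner h (\<pi> p (e v))"
      by (simp add: jones_selfadjoint ps)
    also have "\<dots> = cinner (\<pi> p (e (\<pi> p h))) v"
      by (subst per) (simp add: jones_selfadjoint ps)
    finally show "cinner (e (\<pi> p h)) v = cinner (\<pi> p (e (\<pi> p h))) v" .
  qed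
  then have "e (\<pi> p \<Omega>) = \<pi> p (e \<Omega>)" using per by metis
  then have "\<pi> (E p) \<Omega> = \<pi> p \<Omega>" by (simp add: jones_apply p(1) jones_vector)
  then have "E p = p" by (intro rep_eqI E_M p(1))
  then show "p \<in> N" using E_N[OF p(1)] by simp
qed

end

section \<open>Irreducibility and the iterates of \<Phi> + id\<close>

locale tower_cp = jones_tower M N \<tau> \<pi> \<Omega> E M1 \<tau>1 \<pi>1 \<Omega>1 E1 lam m \<eta> + cp: cp_map M \<Phi>
  for M N :: "('k::chilbert_space \<Rightarrow>\<^sub>L 'k) set" and \<tau> and \<pi> :: "('k \<Rightarrow>\<^sub>L 'k) \<Rightarrow> ('h::chilbert_space \<Rightarrow>\<^sub>L 'h)"
    and \<Omega> E and M1 :: "('h \<Rightarrow>\<^sub>L 'h) set" and \<tau>1 and \<pi>1 :: "('h \<Rightarrow>\<^sub>L 'h) \<Rightarrow> ('g::chilbert_space \<Rightarrow>\<^sub>L 'g)"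
    and \<Omega>1 E1 lam m \<eta> \<Phi> +
  assumes bimodule: "bimodule_map N M \<Phi>"
begin

theorem relatively_irreducible_of_join:
  assumes join: "projection_join (range (\<lambda>k. range_projection (hat (\<Phi> ^^ k)))) = id_blinfun"
  shows "relatively_irreducible N M \<Phi>"
  unfolding relatively_irreducible_def
proof (intro ballI impI, elim conjE exE)
  fix p c assume p: "p \<in> M" "is_projection p" and c: "0 < c" "op_le (\<Phi> p) (c *\<^sub>R p)"
  note B = bimodule_map_power[OF bimodule]
  define w where "w = vec p (id_blinfun - p)"
  let ?R = "\<Union>P\<in>range (\<lambda>k. range_projection (hat (\<Phi> ^^ k))). ran P"
  have cl: "closed (closure (cspan ?R))" "csubspace (closure (cspan ?R))"
    by (simp_all add: csubspace_closure csubspace_cspan)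
  have wR: "cinner w t = 0" if t: "t \<in> ?R" for t
  proof -
    obtain k where k: "t \<in> ran (range_projection (hat (\<Phi> ^^ k)))" using t by blast
    interpret k: cp_map M "\<Phi> ^^ k" by (rule cp.cp_map_power)
    have kp: "p ((\<Phi> ^^ k) (p o\<^sub>L x) h) = (\<Phi> ^^ k) (p o\<^sub>L x) h" if "x \<in> M" for x h
      by (rule k.cp_projection[OF p cp.power_mono[OF p(1) less_imp_le[OF c(1)] c(2)] that])
    have "t \<in> closure (ran (multiplier (\<Phi> ^^ k)))"
      using k by (simp add: hat_eq_multiplier[OF B] range_range_projection multiplier_bop[OF B])
    then show ?thesis
    proof (rule orthogonal_closure[rotated])
      fix s assume "s \<in> ran (multiplier (\<Phi> ^^ k))"
      then show "cinner w s = 0" using multiplier_orthogonal[OF B p kp] by (auto simp: w_def)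
    qed
  qed
  \<comment> \<open>The join is 1, so its range is everything; thus w is orthogonal to
    itself.\<close>
  have "w \<in> closure (cspan ?R)"
    using range_projection_onto[OF cl] join by (simp add: projection_join_def)
  then have "cinner w w = 0" by (rule orthogonal_closure_cspan[rotated]) (rule wR)
  then show "p \<in> N" by (intro projection_in_N[OF p]) (simp add: w_def)
qed

abbreviation T where "T n \<equiv> (\<lambda>x. \<Phi> x + x) ^^ n"

lemma T_positive:
  assumes "p \<in> M" "positive_op p" shows "T n p \<in> M \<and> positive_op (T n p)"
proof (induction n)
  case (Suc n)
  then have "positive_op (\<Phi> (T n p))" using cp.map_positive by blast
  then show ?case using Suc by (simp add: M_linear cp.closed positive_op_iff)
qed (use assms in simp)

text \<open>Every power up to n occurs in the binomial expansion with coefficient at least 1, and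
  the other terms are positive.\<close>

lemma power_le_T:
  assumes p: "p \<in> M" "positive_op p" and "j \<le> n"
  shows "op_le ((\<Phi> ^^ j) p) (T n p)"
  using assms(3)
proof (induction n arbitrary: j)
  case (Suc n)
  note Tn = T_positive[OF p, of n]
  have "positive_op (\<Phi> (T n p))" using Tn cp.map_positive by blast
  then have 1: "op_le (T n p) (T (Suc n) p)" by (simp add: op_le_def)
  show ?case
  proof (cases "j = Suc n")
    case True
    have "op_le (\<Phi> ((\<Phi> ^^ n) p)) (\<Phi> (T n p))"
      using Suc.IH[of n] Tn by (intro cp.map_mono cp.power_closed p(1)) auto
    moreover have "op_le (\<Phi> (T n p)) (T (Suc n) p)" using Tn by (simp add: op_le_def)
    ultimately show ?thesis using True op_le_trans by auto
  next
    case False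
    then show ?thesis using Suc.IH[of j] Suc.prems 1 op_le_trans by auto
  qed
qed simp

text \<open>The powers of \<open>\<Phi>\<close> embed linearly into \<open>Q\<close>, so \<open>\<Phi>\<^sup>d(p)\<close> is a combination of the lower powers.\<close>

lemma top_power_bound:
  assumes fin: "finite_cdim Q" and p: "p \<in> M" "positive_op p"
  obtains K where "op_le ((\<Phi> ^^ cdim Q) p) (K *\<^sub>R T (cdim Q - 1) p)" "1 \<le> cdim Q"
proof -
  define d where "d = cdim Q"
  note B = bimodule_map_power[OF bimodule]
  obtain c where c: "\<exists>j\<le>d. c j \<noteq> 0" "(\<Sum>j\<le>d. c j *\<^sub>C hat (\<Phi> ^^ j)) = 0"
    using linear_dependence[OF fin, of "\<lambda>j. hat (\<Phi> ^^ j)"] hat_Q[OF B] unfolding d_def by blast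
  have rel: "(\<Sum>j\<le>d. c j *\<^sub>C (\<Phi> ^^ j) z) = 0" if "z \<in> M" for z
    using hat_linear_injective[of "{..d}" "\<lambda>j. \<Phi> ^^ j" c z] B c(2) that by simp
  let ?J = "{j. j \<le> d \<and> c j \<noteq> 0}"
  \<comment> \<open>The degree of the relation; it may be smaller than d.\<close>
  define i where "i = Max ?J"
  have ne: "?J \<noteq> {}" "finite ?J" using c(1) by auto
  have i: "i \<le> d" "c i \<noteq> 0" using Max_in[OF ne(2,1)] by (auto simp: i_def)
  have above: "c j = 0" if "j \<le> d" "i < j" for j
  proof (rule ccontr)
    assume "c j \<noteq> 0"
    then have "j \<le> i" unfolding i_def using that(1) by (intro Max_ge ne(2)) simp
    then show False using that(2) by simp
  qed
  have rel': "c i *\<^sub>C (\<Phi> ^^ i) z + (\<Sum>j<i. c j *\<^sub>C (\<Phi> ^^ j) z) = 0" if "z \<in> M" for z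
  proof -
    have "(\<Sum>j\<le>d. c j *\<^sub>C (\<Phi> ^^ j) z) = (\<Sum>j\<in>insert i {..<i}. c j *\<^sub>C (\<Phi> ^^ j) z)"
      by (rule sum.mono_neutral_right) (use i above in \<open>auto simp: not_less\<close>)
    then show ?thesis using rel[OF that] by simp
  qed
  \<comment> \<open>A relation of degree 0 would make the identity vanish, against \<tau>(1) = 1.
    This also excludes d = 0.\<close>
  have i0: "i \<noteq> 0"
  proof
    assume "i = 0"
    then have "c i *\<^sub>C (id_blinfun :: 'k \<Rightarrow>\<^sub>L 'k) = 0" using rel'[OF M_id] by simp
    then have "(id_blinfun :: 'k \<Rightarrow>\<^sub>L 'k) = 0" using i(2) by simp
    then show False using tau_id tau_zero by simp
  qed
  \<comment> \<open>Evaluating the relation at this element raises its top exponent from i to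
    d.\<close>
  let ?z = "(\<Phi> ^^ (d - i)) p"
  have zM: "?z \<in> M" by (rule cp.power_closed[OF p(1)])
  have pw: "(\<Phi> ^^ j) ?z = (\<Phi> ^^ (j + (d - i))) p" for j by (simp add: funpow_add)
  define b where "b j = - c j / c i" for j
  \<comment> \<open>The coefficients are complex, but the powers of \<Phi> at p have nonnegative
    forms, so moduli suffice. Since j < i, the exponents j + (d - i) stay below d, where
    \<open>power_le_T\<close> applies.\<close>
  define K where "K = (\<Sum>j<i. cmod (b j))"
  have top: "(\<Phi> ^^ d) p = (\<Sum>j<i. b j *\<^sub>C (\<Phi> ^^ (j + (d - i))) p)"
  proof -
    have "c i *\<^sub>C (\<Phi> ^^ i) ?z = - (\<Sum>j<i. c j *\<^sub>C (\<Phi> ^^ j) ?z)"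
      using rel'[OF zM] by (simp add: eq_neg_iff_add_eq_0)
    then have "(1 / c i) *\<^sub>C c i *\<^sub>C (\<Phi> ^^ i) ?z = (1 / c i) *\<^sub>C (\<Sum>j<i. (- c j) *\<^sub>C (\<Phi> ^^ j) ?z)"
      by (simp add: sum_negf complex_vector.scale_minus_left)
    also have "\<dots> = (\<Sum>j<i. b j *\<^sub>C (\<Phi> ^^ j) ?z)"
      by (simp add: complex_vector.scale_sum_right scaleC_scaleC b_def)
    finally show ?thesis using i by (simp add: scaleC_scaleC scaleC_one pw)
  qed
  have pos: "positive_op ((\<Phi> ^^ j) p)" for j
    using cp_map.map_positive[OF cp.cp_map_power p] .
  show ?thesis
  proof (rule that)
    show "1 \<le> cdim Q" using i0 i(1) by (simp add: d_def[symmetric])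
    show "op_le ((\<Phi> ^^ cdim Q) p) (K *\<^sub>R T (cdim Q - 1) p)"
      unfolding d_def[symmetric]
    proof (rule op_leI)
      show "hermitian_op ((\<Phi> ^^ d) p)" by (rule positive_opD(1)[OF pos])
      show "hermitian_op (K *\<^sub>R T (d - 1) p)"
        using T_positive[OF p] by (intro hermitian_op_simps positive_opD(1)) blast
      fix h
      have "quad_form ((\<Phi> ^^ d) p) h = (\<Sum>j<i. Re (b j * cinner ((\<Phi> ^^ (j + (d - i))) p h) h))"
        by (simp add: top quad_form_def scaleC_sum_left_apply cinner_sum_left cinner_scaleC_left)
      also have "\<dots> \<le> (\<Sum>j<i. cmod (b j) * quad_form (T (d - 1) p) h)"
      proof (rule sum_mono)
        fix j assume j: "j \<in> {..<i}"
        let ?P = "(\<Phi> ^^ (j + (d - i))) p"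
        have "cinner (?P h) h = of_real (quad_form ?P h)"
          using quad_form_Im[OF positive_opD(1)[OF pos], of "j + (d - i)" h] by (simp add: complex_eq_iff quad_form_def)
        then have "Re (b j * cinner (?P h) h) = Re (b j) * quad_form ?P h" by simp
        also have "\<dots> \<le> cmod (b j) * quad_form ?P h"
          by (intro mult_right_mono complex_Re_le_cmod positive_opD(2)[OF pos])
        also have "\<dots> \<le> cmod (b j) * quad_form (T (d - 1) p) h"
          using j i by (intro mult_left_mono op_leD power_le_T p) auto
        finally show "Re (b j * cinner (?P h) h) \<le> cmod (b j) * quad_form (T (d - 1) p) h" .
      qed
      also have "\<dots> = quad_form (K *\<^sub>R T (d - 1) p) h" by (simp add: K_def sum_distrib_right)
      finally show "quad_form ((\<Phi> ^^ d) p) h \<le> quad_form (K *\<^sub>R T (d - 1) p) h" .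
    qed
  qed
qed

text \<open>Induction over the mixed terms \<open>(\<Phi> ^^ j) (T i p)\<close> with i + j \<le> n
  avoids binomial coefficients: one factor of \<Phi> + id splits such a term into two with smaller
  i.\<close>

lemma T_invariant:
  assumes fin: "finite_cdim Q" and p: "p \<in> M" "positive_op p"
  obtains C where "op_le (\<Phi> (T (cdim Q - 1) p)) (C *\<^sub>R T (cdim Q - 1) p)"
proof -
  define n where "n = cdim Q - 1"
  obtain K where K': "op_le ((\<Phi> ^^ cdim Q) p) (K *\<^sub>R T (cdim Q - 1) p)" "1 \<le> cdim Q"
    using top_power_bound[OF fin p] .
  have "cdim Q = Suc n" using K'(2) by (simp add: n_def)
  with K'(1) have K: "op_le ((\<Phi> ^^ Suc n) p) (K *\<^sub>R T n p)" by (simp only: diff_Suc_1)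
  have "(\<Phi> ^^ j) (T i p) \<in> M \<and> (\<exists>C. op_le (\<Phi> ((\<Phi> ^^ j) (T i p))) (C *\<^sub>R T n p))" if "i + j \<le> n" for i j
    using that
  proof (induction i arbitrary: j)
    case 0
    \<comment> \<open>Exponents up to n lie below T n p with constant 1; only the exponent n + 1 = d
      needs the linear relation.\<close>
    have "op_le (\<Phi> ((\<Phi> ^^ j) p)) ((if j = n then K else 1) *\<^sub>R T n p)"
      using 0 K power_le_T[OF p, of "Suc j" n] by auto
    then show ?case using cp.power_closed[OF p(1)] by auto
  next
    case (Suc i)
    interpret j: cp_map M "\<Phi> ^^ j" by (rule cp.cp_map_power)
    have Ti: "T i p \<in> M" using T_positive[OF p] by blast
    have split: "(\<Phi> ^^ j) (T (Suc i) p) = (\<Phi> ^^ Suc j) (T i p) + (\<Phi> ^^ j) (T i p)"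
      using j.map_add[OF cp.closed[OF Ti] Ti] by (simp add: funpow_swap1)
    obtain C where C: "op_le (\<Phi> ((\<Phi> ^^ Suc j) (T i p))) (C *\<^sub>R T n p)" "(\<Phi> ^^ Suc j) (T i p) \<in> M"
      using Suc.IH[of "Suc j"] Suc.prems by auto
    obtain C' where C': "op_le (\<Phi> ((\<Phi> ^^ j) (T i p))) (C' *\<^sub>R T n p)" "(\<Phi> ^^ j) (T i p) \<in> M"
      using Suc.IH[of j] Suc.prems by auto
    have "\<Phi> ((\<Phi> ^^ j) (T (Suc i) p)) = \<Phi> ((\<Phi> ^^ Suc j) (T i p)) + \<Phi> ((\<Phi> ^^ j) (T i p))"
      unfolding split by (rule cp.map_add[OF C(2) C'(2)])
    with op_le_add[OF C(1) C'(1)]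
    have "op_le (\<Phi> ((\<Phi> ^^ j) (T (Suc i) p))) ((C + C') *\<^sub>R T n p)" by (simp only: scaleR_add_left)
    moreover have "(\<Phi> ^^ j) (T (Suc i) p) \<in> M" unfolding split by (rule M_linear(2)[OF C(2) C'(2)])
    ultimately show ?case by blast
  qed
  from this[of n 0] show ?thesis using that by (auto simp: n_def)
qed

theorem relatively_irreducible_iff:
  assumes fin: "finite_cdim Q" and normal: "normal_map M \<Phi>"
  shows "relatively_irreducible N M \<Phi> \<longleftrightarrow>
    (\<forall>p\<in>M. is_projection p \<longrightarrow> range_projection (T (cdim Q - 1) p) \<in> N)"
proof (intro iffI ballI impI)
  let ?n = "cdim Q - 1"
  fix p assume irr: "relatively_irreducible N M \<Phi>" and p: "p \<in> M" "is_projection p"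
  have pos: "positive_op p"
    using p(2) by (rule positive_op_projection)
  note Tn = T_positive[OF p(1) pos, of "cdim Q - 1"]
  obtain C where "op_le (\<Phi> (T ?n p)) (C *\<^sub>R T ?n p)"
    using T_invariant[OF fin p(1) pos] .
  then show "range_projection (T ?n p) \<in> N"
    using cp.range_projection_invariant[OF normal, of "T ?n p" C] Tn irr
      is_projection_range_projection[OF positive_opD(3), of "T ?n p"]
    unfolding relatively_irreducible_def by blast
next
  let ?n = "cdim Q - 1"
  assume N: "\<forall>p\<in>M. is_projection p \<longrightarrow> range_projection (T ?n p) \<in> N"
  show "relatively_irreducible N M \<Phi>"
    unfolding relatively_irreducible_def
  proof (intro ballI impI, elim conjE exE)
    fix p c assume p: "p \<in> M" "is_projection p" and c: "0 < c" "op_le (\<Phi> p) (c *\<^sub>R p)"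
    have pos: "positive_op p"
      using p(2) by (rule positive_op_projection)
    have up: "op_le (T n p) ((1 + c) ^ n *\<^sub>R p)" for n
    proof (induction n)
      case (Suc n)
      note Tn = T_positive[OF p(1) pos, of n]
      let ?a = "(1 + c) ^ n"
      have "op_le (\<Phi> (T n p)) (\<Phi> (?a *\<^sub>R p))" using Suc Tn by (intro cp.map_mono M_linear p(1)) auto
      then have le: "op_le (\<Phi> (T n p)) (?a *\<^sub>R \<Phi> p)" by (simp add: cp.map_scaleR p(1))
      have "quad_form (T (Suc n) p) h \<le> quad_form ((1 + c) ^ Suc n *\<^sub>R p) h" for h
      proof -
        have "quad_form (\<Phi> (T n p)) h \<le> ?a * quad_form (\<Phi> p) h" using op_leD[OF le, of h] by simp
        also have "\<dots> \<le> ?a * (c * quad_form p h)" using op_leD[OF c(2), of h] c(1) by (intro mult_left_mono) auto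
        finally show ?thesis using op_leD[OF Suc, of h] by (simp add: algebra_simps)
      qed
      then show ?case
        using T_positive[OF p(1) pos, of "Suc n"] pos positive_opD(1)
        by (intro op_leI hermitian_op_simps) blast+
    qed simp
    have "op_le p (T ?n p)" using power_le_T[OF p(1) pos, of 0 "cdim Q - 1"] by simp
    then have "range_projection (T ?n p) = p" by (rule range_projection_sandwich[OF p(2) _ up])
    then show "p \<in> N" using bspec[OF N p(1)] p(2) by simp
  qed
qed

end

text \<open>The equivalence is stated under \<open>finite_cdim Q\<close>, because
  \<open>cdim\<close> returns 0 on an infinite-dimensional space and then is not the dimension
  d.\<close>

theorem theorem5p8:
  fixes N M :: "('k::chilbert_space \<Rightarrow>\<^sub>L 'k) set"
    and \<tau> :: "('k \<Rightarrow>\<^sub>L 'k) \<Rightarrow> complex"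
    and \<pi> :: "('k \<Rightarrow>\<^sub>L 'k) \<Rightarrow> ('h::chilbert_space \<Rightarrow>\<^sub>L 'h)" and \<Omega> :: 'h
    and e\<^sub>1 :: "'h \<Rightarrow>\<^sub>L 'h" and M\<^sub>1 :: "('h \<Rightarrow>\<^sub>L 'h) set" and \<tau>\<^sub>1 :: "('h \<Rightarrow>\<^sub>L 'h) \<Rightarrow> complex"
    and \<pi>\<^sub>1 :: "('h \<Rightarrow>\<^sub>L 'h) \<Rightarrow> ('g::chilbert_space \<Rightarrow>\<^sub>L 'g)" and \<Omega>\<^sub>1 :: 'g
    and M\<^sub>2 Q :: "('g \<Rightarrow>\<^sub>L 'g) set" and \<tau>\<^sub>2 :: "('g \<Rightarrow>\<^sub>L 'g) \<Rightarrow> complex"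
    and lam :: real
    and E\<^sub>N :: "('k \<Rightarrow>\<^sub>L 'k) \<Rightarrow> ('k \<Rightarrow>\<^sub>L 'k)" and m :: nat and \<eta> :: "nat \<Rightarrow> 'k \<Rightarrow>\<^sub>L 'k"
    and hat :: "(('k \<Rightarrow>\<^sub>L 'k) \<Rightarrow> ('k \<Rightarrow>\<^sub>L 'k)) \<Rightarrow> 'g \<Rightarrow>\<^sub>L 'g"
    and \<Phi> :: "('k \<Rightarrow>\<^sub>L 'k) \<Rightarrow> ('k \<Rightarrow>\<^sub>L 'k)"
    and B :: "'g \<Rightarrow>\<^sub>L 'g"
  assumes "finite_von_neumann_algebra N" and "finite_von_neumann_algebra M" and "N \<subseteq> M"
    and "faithful_normal_tracial_state M \<tau>"
    and "gns_representation M \<tau> \<pi> \<Omega>"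
    and "e\<^sub>1 = jones_projection N \<pi> \<Omega>"
    and "M\<^sub>1 = basic_construction N M \<pi> \<Omega>"
    and "finite_von_neumann_algebra M\<^sub>1"
    and "lambda_extension N M \<tau> \<pi> \<Omega> lam \<tau>\<^sub>1"
    and "gns_representation M\<^sub>1 \<tau>\<^sub>1 \<pi>\<^sub>1 \<Omega>\<^sub>1"
    and "M\<^sub>2 = basic_construction (\<pi> ` M) M\<^sub>1 \<pi>\<^sub>1 \<Omega>\<^sub>1"
    and "lambda_extension (\<pi> ` M) M\<^sub>1 \<tau>\<^sub>1 \<pi>\<^sub>1 \<Omega>\<^sub>1 lam \<tau>\<^sub>2"
    and "Q = commutant (\<pi>\<^sub>1 ` \<pi> ` M) \<inter> M\<^sub>2"
    and "conditional_expectation N M \<tau> E\<^sub>N"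
    and "pimsner_popa_basis M E\<^sub>N m \<eta>"
    and "hat = fourier_multiplier M Q (\<lambda>x y. \<pi>\<^sub>1 (\<pi> x o\<^sub>L e\<^sub>1 o\<^sub>L \<pi> y) \<Omega>\<^sub>1) lam m \<eta>"
    and "bimodule_map N M \<Phi>" and "completely_positive M \<Phi>" and "normal_map M \<Phi>"
    and "B = projection_join (range (\<lambda>k. range_projection (convolution_power N M hat (hat \<Phi>) k)))"
  shows "(B = id_blinfun \<longrightarrow> relatively_irreducible N M \<Phi>) \<and>
    (finite_cdim Q \<longrightarrow>
      (relatively_irreducible N M \<Phi> \<longleftrightarrow>
        (\<forall>p\<in>M. is_projection p \<longrightarrow>
           range_projection (((\<lambda>x. \<Phi> x + x) ^^ (cdim Q - 1)) p) \<in> N)))"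
proof -
  note Nf = assms(1) and Mf = assms(2) and gns = assms(5) and e1 = assms(6) and M1 = assms(7) and M1f = assms(8)
    and lext = assms(9)
  have vN: "von_neumann_algebra N" and vM: "von_neumann_algebra M" and vM1: "von_neumann_algebra M\<^sub>1"
    using Nf Mf M1f by (auto simp: finite_von_neumann_algebra_def)
  note ND = von_neumann_algebraD[OF vN]
  interpret base: trace_expectation M \<tau> \<pi> \<Omega> N E\<^sub>N
  proof
    show "von_neumann_algebra M" "faithful_normal_tracial_state M \<tau>" "gns_representation M \<tau> \<pi> \<Omega>"
      "N \<subseteq> M" "csubspace N" "id_blinfun \<in> N" "conditional_expectation N M \<tau> E\<^sub>N"
      by (rule vM assms(3,4,14) gns ND(4,5))+
    show "adj x \<in> N" if "x \<in> N" for x using that by (rule ND(3))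
  qed
  have gen: "insert base.e (\<pi> ` M) \<subseteq> bop" using base.jones_bop base.rep_bop by auto
  obtain E1 where E1: "conditional_expectation (\<pi> ` M) M\<^sub>1 \<tau>\<^sub>1 E1" "E1 base.e = lam *\<^sub>R id_blinfun"
    and lam: "lam > 0" and tr1: "faithful_normal_tracial_state M\<^sub>1 \<tau>\<^sub>1"
    using lext by (auto simp: lambda_extension_def M1)
  interpret tw: tower_cp M N \<tau> \<pi> \<Omega> E\<^sub>N M\<^sub>1 \<tau>\<^sub>1 \<pi>\<^sub>1 \<Omega>\<^sub>1 E1 lam m \<eta> \<Phi>
  proof
    show "von_neumann_algebra M\<^sub>1" "faithful_normal_tracial_state M\<^sub>1 \<tau>\<^sub>1"
      "gns_representation M\<^sub>1 \<tau>\<^sub>1 \<pi>\<^sub>1 \<Omega>\<^sub>1" "conditional_expectation (\<pi> ` M) M\<^sub>1 \<tau>\<^sub>1 E1"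
      by (rule vM1 tr1 assms(10) E1(1))+
    show "\<pi> ` M \<subseteq> M\<^sub>1"
      using vna_generated_superset[OF gen] by (auto simp: M1 basic_construction_def)
    show "adj x \<in> \<pi> ` M" if "x \<in> \<pi> ` M" for x
      using that base.rep_adj[symmetric] base.M_adj by auto
    show "csubspace (\<pi> ` M)"
      using gns base.M_csubspace by (intro csubspace_image) (auto simp: gns_representation_def)
    show "id_blinfun \<in> \<pi> ` M" using base.rep_id base.M_id by (metis image_eqI)
    show "\<Phi> x \<in> M" if "x \<in> M" for x using assms(17) that by (auto simp: bimodule_map_def)
    show "clinear_map_on M \<Phi>" using assms(17) by (simp add: bimodule_map_def)
  qed (use M1 lam E1 assms vM in auto)
  have Q: "Q = tw.Q" unfolding assms(13) tw.Q_def tw.M2_def assms(11) ..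
  have hat: "hat = tw.hat" unfolding assms(16) tw.hat_def Q tw.vec_def[abs_def] e1 ..
  \<comment> \<open>Complete positivity makes \<Phi> bounded, so the convolution powers are the
    multipliers of its powers.\<close>
  have B: "B = projection_join (range (\<lambda>k. range_projection (tw.hat (\<Phi> ^^ k))))"
    unfolding assms(20) hat tw.convolution_power_hat[OF assms(17) tw.cp.cp_bounded] ..
  show ?thesis
    unfolding Q
  proof (intro conjI impI)
    assume "B = id_blinfun"
    then show "relatively_irreducible N M \<Phi>" by (intro tw.relatively_irreducible_of_join) (simp only: B)
  next
    assume "finite_cdim tw.Q"
    then show "relatively_irreducible N M \<Phi> \<longleftrightarrow> (\<forall>p\<in>M. is_projection p \<longrightarrow>
        range_projection (((\<lambda>x. \<Phi> x + x) ^^ (cdim tw.Q - 1)) p) \<in> N)"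
      by (rule tw.relatively_irreducible_iff[OF _ assms(19)])
  qed
qed

end
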